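(* Let $0<\beta<1/2$, $0\le\theta\le1$, and let $K\in L^\infty(0,1)$ with $0<K_m\le K\le K_M<\infty$. Assume that $$1+\theta\big({}_0^{l}I_1^\beta u_l\big)-(1-\theta)\big({}_0^{r}I_1^\beta u_l\big)\neq0 .$$ Assume furthermore that $K\in C^{m+1}[0,1]$ and $f\in H^m(0,1)$ with $m$ a nonnegative integer. Then the weak solution $u\in H^{1-\beta}_0(0,1)$ of the Petrov-Galerkin formulation $$\big(K\,DI^\beta_\theta u,Dv\big)_{L^2(0,1)}=\langle f,v\rangle\qquad\forall v\in H^1_0(0,1)$$ satisfies $I^\beta_\theta u\in H^{m+2}(0,1)$ and $$\big\|I^\beta_\theta u\big\|_{H^{m+2}(0,1)}\le C\big(\|K\|_{C^{m+1}[0,1]}+\|f\|_{H^m(0,1)}\big),$$ where $C>0$ is a constant independent of $f$ and $u$. In other words, the weighted high-order Riemann-Liouville derivatives $D^{m+2}I^\beta_\theta u$ exist and are bounded by these norms of the data.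
   Context: $D$ is the first-order derivative in $x$. For $\phi$ on $(0,1)$: ${}_0^{l}I_x^{\beta}\phi(x)=\frac1{\Gamma(\beta)}\int_0^x\frac{\phi(s)}{(x-s)^{1-\beta}}ds$, ${}_x^{r}I_1^{\beta}\phi(x)=\frac1{\Gamma(\beta)}\int_x^1\frac{\phi(s)}{(s-x)^{1-\beta}}ds$, and $I^\beta_\theta\phi=\theta\,{}_0^{l}I_x^\beta\phi+(1-\theta)\,{}_x^{r}I_1^\beta\phi$. The numbers ${}_0^{l}I_1^\beta\phi=\frac1{\Gamma(\beta)}\int_0^1(1-s)^{\beta-1}\phi(s)ds$ and ${}_0^{r}I_1^\beta\phi=\frac1{\Gamma(\beta)}\int_0^1 s^{\beta-1}\phi(s)ds$ are the values of the left integral at $x=1$ and of the right integral at $x=0$. For $\mu>0$, $H^\mu_0(0,1)$ is the completion of $C_0^\infty(0,1)$ (functions extended by zero) in the norm $\|w\|_{H^\mu(\mathbb{R})}=\big(\|w\|_{L^2(\mathbb{R})}^2+\||\omega|^\mu\mathcal{F}(w)\|_{L^2(\mathbb{R})}^2\big)^{1/2}$. Let $w_l^c(x)=1-x$, $w_r^c(x)=x$ and $w_l(x)=\big(\int_0^1\frac{ds}{K(s)}\big)^{-1}\int_x^1\frac{ds}{K(s)}$. The function $u_l$ is the unique element of $H^{1-\beta}_0(0,1)$ satisfying $I^\beta_\theta u_l-(1-\theta)({}_0^{r}I_1^\beta u_l)w_l^c-\theta({}_0^{l}I_1^\beta u_l)w_r^c=w_l-w_l^c$. Under the stated nonvanishing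 condition the Petrov-Galerkin formulation has a unique solution $u$ for every $f\in H^{-1}(0,1)$ (the dual of $H^1_0(0,1)$), and "the weak solution" refers to it. $H^0(0,1)=L^2(0,1)$. *)

theory Defs
  imports "HOL-Analysis.Analysis"
begin

text \<open>
  Functions on the interval (0,1) are represented by total functions on the reals whose values
  outside the interval are irrelevant (they are replaced by zero where an extension is needed).
  Only the spaces of continuously differentiable functions, which live on [0,1], look at more
  than the a.e. class on (0,1).
\<close>

abbreviation unit_ivl :: "real measure"
  where "unit_ivl \<equiv> lebesgue_on {0<..<1}"

definition L2 :: "(real \<Rightarrow> real) set"
  where "L2 = {g. g \<in> borel_measurable unit_ivl \<and> integrable unit_ivl (\<lambda>x. (g x)\<^sup>2)}"

definition L2_inner :: "(real \<Rightarrow> real) \<Rightarrow> (real \<Rightarrow> real) \<Rightarrow> real"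
  where "L2_inner g h = (\<integral>x. g x * h x \<partial>unit_ivl)"

definition L2_norm :: "(real \<Rightarrow> real) \<Rightarrow> real"
  where "L2_norm g = sqrt (\<integral>x. (g x)\<^sup>2 \<partial>unit_ivl)"

definition test_fun :: "(real \<Rightarrow> real) set"
  where "test_fun = {\<phi>. (\<forall>n. (deriv ^^ n) \<phi> differentiable_on UNIV) \<and>
     (\<exists>a b. 0 < a \<and> b < 1 \<and> (\<forall>x. x \<notin> {a..b} \<longrightarrow> \<phi> x = 0))}"


subsection \<open>Integer order Sobolev spaces and weak derivatives\<close>

definition loc_integrable :: "(real \<Rightarrow> real) \<Rightarrow> bool"
  where "loc_integrable g \<longleftrightarrow> (\<forall>a b. 0 < a \<and> b < 1 \<longrightarrow> set_integrable lebesgue {a..b} g)"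

definition has_weak_deriv :: "nat \<Rightarrow> (real \<Rightarrow> real) \<Rightarrow> (real \<Rightarrow> real) \<Rightarrow> bool"
  where "has_weak_deriv k w g \<longleftrightarrow> loc_integrable w \<and> loc_integrable g \<and>
     (\<forall>\<phi>\<in>test_fun. L2_inner w ((deriv ^^ k) \<phi>) = (- 1) ^ k * L2_inner g \<phi>)"

text \<open>The weak derivative is unique almost everywhere; the choice of representative is immaterial.\<close>

definition weak_deriv :: "nat \<Rightarrow> (real \<Rightarrow> real) \<Rightarrow> real \<Rightarrow> real"
  where "weak_deriv k w = (SOME g. has_weak_deriv k w g)"

definition Sobolev :: "nat \<Rightarrow> (real \<Rightarrow> real) set"
  where "Sobolev k = {w \<in> L2. \<forall>j\<le>k. \<exists>g\<in>L2. has_weak_deriv j w g}"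

definition Sobolev_norm :: "nat \<Rightarrow> (real \<Rightarrow> real) \<Rightarrow> real"
  where "Sobolev_norm k w = sqrt (\<Sum>j\<le>k. (L2_norm (weak_deriv j w))\<^sup>2)"


subsection \<open>The spaces of k times continuously differentiable functions on [0,1]\<close>

text \<open>Derivatives are taken within [0,1], hence are one-sided at the end points.\<close>

definition cderiv :: "nat \<Rightarrow> (real \<Rightarrow> real) \<Rightarrow> real \<Rightarrow> real"
  where "cderiv j g = ((\<lambda>h x. vector_derivative h (at x within {0..1})) ^^ j) g"

definition Ck :: "nat \<Rightarrow> (real \<Rightarrow> real) set"
  where "Ck k = {g. (\<forall>j<k. cderiv j g differentiable_on {0..1}) \<and>
     (\<forall>j\<le>k. continuous_on {0..1} (cderiv j g))}"

definition Ck_norm :: "nat \<Rightarrow> (real \<Rightarrow> real) \<Rightarrow> real"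
  where "Ck_norm k g = (MAX j\<in>{..k}. SUP x\<in>{0..1}. \<bar>cderiv j g x\<bar>)"


subsection \<open>Fractional order Sobolev spaces with zero extension\<close>

definition zero_ext :: "(real \<Rightarrow> real) \<Rightarrow> real \<Rightarrow> real"
  where "zero_ext w x = (if x \<in> {0<..<1} then w x else 0)"

text \<open>
  Only applied to square integrable functions supported in [0,1]. These are integrable, so the
  integral below is their (Plancherel) Fourier transform.
\<close>

definition fourier :: "(real \<Rightarrow> real) \<Rightarrow> real \<Rightarrow> complex"
  where "fourier w \<omega> = (\<integral>x. cis (- (\<omega> * x)) * complex_of_real (w x) \<partial>lebesgue)"

definition Hmu_norm :: "real \<Rightarrow> (real \<Rightarrow> real) \<Rightarrow> real"
  where "Hmu_norm \<mu> w = sqrt ((\<integral>x. (w x)\<^sup>2 \<partial>lebesgue) +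
     (\<integral>\<omega>. (\<bar>\<omega>\<bar> powr \<mu> * cmod (fourier w \<omega>))\<^sup>2 \<partial>lebesgue))"

text \<open>
  The completion of the test functions in the above norm, realised as their closure in the
  complete space \<open>H\<^sup>\<mu>\<close> of the real line. The second condition makes the norms of the
  differences genuine finite integrals.
\<close>

definition H0 :: "real \<Rightarrow> (real \<Rightarrow> real) set"
  where "H0 \<mu> = {w \<in> L2.
     integrable lebesgue (\<lambda>\<omega>. (\<bar>\<omega>\<bar> powr \<mu> * cmod (fourier (zero_ext w) \<omega>))\<^sup>2) \<and>
     (\<exists>\<phi>::nat \<Rightarrow> real \<Rightarrow> real. (\<forall>n. \<phi> n \<in> test_fun) \<and>
        (\<lambda>n. Hmu_norm \<mu> (\<lambda>x. zero_ext w x - \<phi> n x)) \<longlonglongrightarrow> 0)}"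


subsection \<open>Fractional integrals\<close>

definition left_int :: "real \<Rightarrow> (real \<Rightarrow> real) \<Rightarrow> real \<Rightarrow> real"
  where "left_int \<beta> \<phi> x = 1 / Gamma \<beta> *
     (LINT s:{0<..<x}|lebesgue. \<phi> s / (x - s) powr (1 - \<beta>))"

definition right_int :: "real \<Rightarrow> (real \<Rightarrow> real) \<Rightarrow> real \<Rightarrow> real"
  where "right_int \<beta> \<phi> x = 1 / Gamma \<beta> *
     (LINT s:{x<..<1}|lebesgue. \<phi> s / (s - x) powr (1 - \<beta>))"

definition frac_int :: "real \<Rightarrow> real \<Rightarrow> (real \<Rightarrow> real) \<Rightarrow> real \<Rightarrow> real"
  where "frac_int \<beta> \<theta> \<phi> x = \<theta> * left_int \<beta> \<phi> x + (1 - \<theta>) * right_int \<beta> \<phi> x"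


subsection \<open>The auxiliary function and the Petrov-Galerkin formulation\<close>

definition wlc :: "real \<Rightarrow> real" where "wlc x = 1 - x"

definition wrc :: "real \<Rightarrow> real" where "wrc x = x"

definition wl :: "(real \<Rightarrow> real) \<Rightarrow> real \<Rightarrow> real"
  where "wl K x = inverse (LINT s:{0<..<1}|lebesgue. 1 / K s) *
     (LINT s:{x<..<1}|lebesgue. 1 / K s)"

definition is_ul :: "real \<Rightarrow> real \<Rightarrow> (real \<Rightarrow> real) \<Rightarrow> (real \<Rightarrow> real) \<Rightarrow> bool"
  where "is_ul \<beta> \<theta> K ul \<longleftrightarrow> ul \<in> H0 (1 - \<beta>) \<and>
     (AE x in unit_ivl. frac_int \<beta> \<theta> ul x - (1 - \<theta>) * right_int \<beta> ul 0 * wlc x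
        - \<theta> * left_int \<beta> ul 1 * wrc x = wl K x - wlc x)"

text \<open>
  For \<open>u \<in> H0 (1 - \<beta>)\<close> the function \<open>frac_int \<beta> \<theta> u\<close> has a square integrable first weak
  derivative, as has every \<open>v \<in> H0 1\<close>. The duality pairing with a right-hand side \<open>f \<in> L2\<close>
  is the inner product of \<open>L2\<close>.
\<close>

definition weak_solution ::
    "real \<Rightarrow> real \<Rightarrow> (real \<Rightarrow> real) \<Rightarrow> (real \<Rightarrow> real) \<Rightarrow> (real \<Rightarrow> real) \<Rightarrow> bool"
  where "weak_solution \<beta> \<theta> K f u \<longleftrightarrow> u \<in> H0 (1 - \<beta>) \<and>
     (\<forall>v\<in>H0 1. L2_inner (\<lambda>x. K x * weak_deriv 1 (frac_int \<beta> \<theta> u) x) (weak_deriv 1 v)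
        = L2_inner f v)"

end

theory Submission
  imports Defs "HOL-Probability.Characteristic_Functions" "HOL-Probability.Sinc_Integral"
begin

text \<open>
  Let \<open>w\<close> be the two-sided fractional integral of the weak solution \<open>u\<close>. Tested with smooth functions,
  the variational equation says that the flux \<open>K w'\<close> has the weak derivative \<open>- f\<close>. Hence
  \<open>w' = (a - F) / K\<close> with the primitive \<open>F\<close> of \<open>f\<close> and a constant \<open>a\<close> (lemma \<open>weak_solution_flux\<close>), and
  differentiating this identity \<open>m + 1\<close> times by the Leibniz rule (lemma \<open>sob_le_mult\<close>) shows that \<open>w\<close>
  has weak derivatives up to order \<open>m + 2\<close>. Two things remain: that \<open>w\<close> has a weak derivative in the
  first place, and that \<open>a\<close> and the value of \<open>w\<close> at 0 are bounded by the norm of \<open>f\<close>.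

  The first is a statement about orders: taking the derivative of a fractional integral of order \<open>\<beta>\<close>
  costs \<open>1 - \<beta>\<close> derivatives, which is what the space of \<open>u\<close> offers. For test functions \<open>\<phi>\<close> the derivative
  of the fractional integral is, on the unit interval, the convolution of \<open>\<phi>'\<close> with a kernel cut off
  at distance 1, whose Fourier transform decays like \<open>\<bar>\<omega>\<bar> powr (- \<beta>)\<close>. With Plancherel's inequality the
  \<open>L2\<close> norm is at most a multiple of the norm of order \<open>1 - \<beta>\<close> (lemma \<open>frac_deriv_L2_le\<close>), and the case
  of \<open>u\<close> follows by approximation and the completeness of \<open>L2\<close>.

  For the second, a suitable function \<open>\<psi> s = s powr (- p) * (1 - s) powr (- q)\<close> with \<open>p + q = \<beta>\<close> solves
  the generalised Abel equation: the fractional integral with exchanged weights, which is the adjoint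
  one, maps it to a positive constant \<open>c\<close> (theorem \<open>abel_equation_solution\<close>). Pairing the fractional
  integral of \<open>g\<close> with \<open>\<psi>\<close> therefore gives \<open>c\<close> times the integral of \<open>g\<close>. For \<open>g = \<phi>'\<close> the result is 0,
  and a commutator computation gives \<open>- (1 - \<beta>) c\<close> times the integral of \<open>\<phi>\<close> if \<open>\<psi>\<close> is replaced by
  \<open>x \<psi>(x)\<close>. As \<open>\<beta> < 1 / 2\<close>, the function \<open>\<psi>\<close> is square integrable and both identities pass to the limit
  \<open>u\<close> (theorem \<open>frac_conv_weak_deriv\<close>). The first one says that \<open>w'\<close> is orthogonal to \<open>\<psi>\<close>; it makes
  \<open>a\<close> a weighted mean of \<open>F\<close>. The second one bounds the integral of \<open>u\<close>, which up to a factor is the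
  pairing of \<open>w\<close> with \<open>\<psi>\<close>, and this pairing determines the value of \<open>w\<close> at 0.
\<close>

section \<open>Test functions\<close>

text \<open>
  Recursion on the number of derivatives makes the closure properties of smooth functions simple
  inductions; \<open>ndiff_iff\<close> relates it to iterated derivatives.
\<close>

fun ndiff :: "nat \<Rightarrow> (real \<Rightarrow> real) \<Rightarrow> bool" where
  "ndiff 0 f = True"
| "ndiff (Suc n) f = ((\<forall>x. (f has_real_derivative deriv f x) (at x)) \<and> ndiff n (deriv f))"

lemma ndiff_SucI:
  assumes "\<And>x. (f has_real_derivative f' x) (at x)" "ndiff n f'"
  shows "ndiff (Suc n) f"
proof -
  have "deriv f = f'" using assms(1) by (intro ext DERIV_imp_deriv)
  then show ?thesis using assms by simp
qed

lemma ndiff_iff: "(\<forall>n. ndiff n f) \<longleftrightarrow> (\<forall>n. (deriv ^^ n) f differentiable_on UNIV)"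
proof -
  have "ndiff n f \<longleftrightarrow> (\<forall>k<n. (deriv ^^ k) f differentiable_on UNIV)" for n
  proof (induction n arbitrary: f)
    case (Suc n)
    have "(\<forall>x. (f has_real_derivative deriv f x) (at x)) \<longleftrightarrow> f differentiable_on UNIV"
      unfolding differentiable_on_def real_differentiable_def
      by (simp add: DERIV_deriv_iff_real_differentiable real_differentiable_def)
    moreover have "(\<forall>k<Suc n. (deriv ^^ k) f differentiable_on UNIV) \<longleftrightarrow>
        f differentiable_on UNIV \<and> (\<forall>k<n. (deriv ^^ k) (deriv f) differentiable_on UNIV)"
      by (auto simp: less_Suc_eq_0_disj funpow_Suc_right simp del: funpow.simps)
    ultimately show ?case using Suc by simp
  qed simp
  then show ?thesis by (metis lessI)
qed

lemma ndiff_const: "ndiff n (\<lambda>x. c)"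
proof (induction n arbitrary: c)
  case (Suc n)
  show ?case by (rule ndiff_SucI[where f'="\<lambda>x. 0"]) (auto intro: Suc)
qed simp

lemma ndiff_mono: "ndiff (Suc n) f \<Longrightarrow> ndiff n f"
  by (induction n arbitrary: f) auto

lemma ndiff_add: "ndiff n f \<Longrightarrow> ndiff n g \<Longrightarrow> ndiff n (\<lambda>x. f x + g x)"
proof (induction n arbitrary: f g)
  case (Suc n)
  show ?case
    by (rule ndiff_SucI[where f'="\<lambda>x. deriv f x + deriv g x"])
      (use Suc in \<open>auto intro!: DERIV_add\<close>)
qed simp

lemma ndiff_mult: "ndiff n f \<Longrightarrow> ndiff n g \<Longrightarrow> ndiff n (\<lambda>x. f x * g x)"
proof (induction n arbitrary: f g)
  case (Suc n)
  have fg: "ndiff n f" "ndiff n g" using Suc.prems ndiff_mono by blast+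
  show ?case
  proof (rule ndiff_SucI)
    show "((\<lambda>x. f x * g x) has_real_derivative deriv f x * g x + f x * deriv g x) (at x)" for x
      by (rule DERIV_cong, rule DERIV_mult) (use Suc.prems in auto)
    show "ndiff n (\<lambda>x. deriv f x * g x + f x * deriv g x)"
      by (rule ndiff_add) (use Suc fg in auto)
  qed
qed simp

lemma ndiff_affine: "ndiff n f \<Longrightarrow> ndiff n (\<lambda>x. f (a * x + b))"
proof (induction n arbitrary: f)
  case (Suc n)
  show ?case
  proof (rule ndiff_SucI)
    show "((\<lambda>x. f (a * x + b)) has_real_derivative a * deriv f (a * x + b)) (at x)" for x
    proof -
      have f: "(f has_real_derivative deriv f (a * x + b)) (at (a * x + b))" using Suc.prems by simp
      have g: "((\<lambda>x. a * x + b) has_real_derivative a) (at x)" by (auto intro!: derivative_eq_intros)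
      show ?thesis using DERIV_chain2[OF f g] by (simp add: mult.commute)
    qed
    show "ndiff n (\<lambda>x. a * deriv f (a * x + b))"
      by (rule ndiff_mult) (use Suc ndiff_const in auto)
  qed
qed simp

text \<open>
  With the polynomial \<open>p\<close> as a parameter this family is closed under differentiation. The case
  \<open>p = 1\<close> is the standard flat function.
\<close>

definition exp_tail :: "real poly \<Rightarrow> real \<Rightarrow> real" where
  "exp_tail p x = (if 0 < x then poly p (1 / x) * exp (- (1 / x)) else 0)"

lemma poly_exp_tendsto_0: "((\<lambda>t. poly p t * exp (- t)) \<longlongrightarrow> 0) at_top" for p :: "real poly"
proof -
  have "((\<lambda>t. \<Sum>i\<le>degree p. coeff p i * (t ^ i / exp t)) \<longlongrightarrow> (\<Sum>i\<le>degree p. coeff p i * 0)) at_top"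
    by (intro tendsto_sum tendsto_mult tendsto_const tendsto_power_div_exp_0)
  then show ?thesis
    by (simp add: poly_altdef sum_divide_distrib exp_minus divide_inverse sum_distrib_right mult.assoc)
qed

lemma exp_tail_tendsto_0: "(exp_tail p \<longlongrightarrow> 0) (at 0)"
proof -
  have "((\<lambda>x. poly p (1 / x) * exp (- (1 / x))) \<longlongrightarrow> 0) (at_right 0)"
    using filterlim_compose[OF poly_exp_tendsto_0[of p] filterlim_inverse_at_top_right]
    by (simp add: inverse_eq_divide)
  then have "(exp_tail p \<longlongrightarrow> 0) (at_right 0)"
    by (rule Lim_transform_eventually) (auto simp: eventually_at_right_less exp_tail_def intro!: eventually_mono[OF eventually_at_right_less])
  moreover have "(exp_tail p \<longlongrightarrow> 0) (at_left 0)"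
    by (rule Lim_transform_eventually[OF tendsto_const])
      (auto simp: exp_tail_def eventually_at_filter)
  ultimately show ?thesis by (simp add: filterlim_split_at)
qed

lemma DERIV_exp_tail:
  "(exp_tail p has_real_derivative exp_tail ([:0, 0, 1:] * (p - pderiv p)) x) (at x)"
proof -
  consider "x < 0" | "x = 0" | "0 < x" by linarith
  then show ?thesis
  proof cases
    case 1
    have "((\<lambda>_. 0) has_real_derivative 0) (at x)" by simp
    then have "(exp_tail p has_real_derivative 0) (at x)"
      by (rule has_field_derivative_transform_within_open[where S="{..<0}"])
        (use 1 in \<open>auto simp: exp_tail_def\<close>)
    then show ?thesis using 1 by (simp add: exp_tail_def)
  next
    case 2
    have "((\<lambda>h. (exp_tail p h - exp_tail p 0) / h) \<longlongrightarrow> 0) (at 0)"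
    proof (rule Lim_transform_eventually[OF exp_tail_tendsto_0[of "pCons 0 p"]])
      show "\<forall>\<^sub>F h in at 0. exp_tail (pCons 0 p) h = (exp_tail p h - exp_tail p 0) / h"
        by (auto simp: exp_tail_def eventually_at_filter)
    qed
    then show ?thesis using 2 by (simp add: DERIV_def exp_tail_def)
  next
    case 3
    have "((\<lambda>x. poly p (1 / x) * exp (- (1 / x))) has_real_derivative
        (poly p (1/x) - poly (pderiv p) (1/x)) / x\<^sup>2 * exp (- (1 / x))) (at x)"
    proof -
      have i: "((\<lambda>x. 1 / x) has_real_derivative - (1 / x\<^sup>2)) (at x)"
        using 3 by (auto intro!: derivative_eq_intros simp: power2_eq_square)
      have "((\<lambda>x. poly p (1/x)) has_real_derivative poly (pderiv p) (1/x) * - (1 / x\<^sup>2)) (at x)"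
        by (rule DERIV_chain2[OF poly_DERIV i])
      moreover have "((\<lambda>x. exp (- (1 / x))) has_real_derivative exp (- (1 / x)) * (1/x\<^sup>2)) (at x)"
        by (rule DERIV_cong, rule DERIV_chain2[OF DERIV_exp], rule DERIV_minus[OF i]) simp
      ultimately show ?thesis
        by (rule DERIV_cong[OF DERIV_mult]) (use 3 in \<open>simp add: field_simps\<close>)
    qed
    then have "(exp_tail p has_real_derivative
        (poly p (1/x) - poly (pderiv p) (1/x)) / x\<^sup>2 * exp (- (1 / x))) (at x)"
      by (rule has_field_derivative_transform_within_open[where S="{0<..}"])
        (use 3 in \<open>auto simp: exp_tail_def\<close>)
    then show ?thesis using 3 by (simp add: exp_tail_def power2_eq_square field_simps)
  qed
qed

lemma ndiff_exp_tail: "ndiff n (exp_tail p)"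
proof (induction n arbitrary: p)
  case (Suc n)
  show ?case by (rule ndiff_SucI[OF DERIV_exp_tail Suc])
qed simp

lemma test_fun_iff:
  "\<phi> \<in> test_fun \<longleftrightarrow> (\<forall>n. ndiff n \<phi>) \<and> (\<exists>a b. 0 < a \<and> b < 1 \<and> (\<forall>x. x \<notin> {a..b} \<longrightarrow> \<phi> x = 0))"
  by (simp add: test_fun_def ndiff_iff)

lemma test_funI:
  assumes "\<And>n. ndiff n \<phi>" "0 < a" "b < 1" "\<And>x. x \<notin> {a..b} \<Longrightarrow> \<phi> x = 0"
  shows "\<phi> \<in> test_fun"
  using assms unfolding test_fun_iff by blast

lemma test_fun_supp:
  assumes "\<phi> \<in> test_fun"
  obtains a b where "0 < a" "a < b" "b < 1" "\<And>x. x \<notin> {a..b} \<Longrightarrow> \<phi> x = 0"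
proof -
  obtain a b where ab: "0 < a" "b < 1" "\<And>x. x \<notin> {a..b} \<Longrightarrow> \<phi> x = 0"
    using assms unfolding test_fun_iff by blast
  show ?thesis
  proof (rule that)
    show "0 < min a (1/3)" "min a (1/3) < max b (1/2)" "max b (1/2) < 1" using ab by auto
    show "\<phi> x = 0" if "x \<notin> {min a (1/3)..max b (1/2)}" for x
      by (rule ab(3)) (use that in auto)
  qed
qed

lemma test_fun_zero: "\<phi> \<in> test_fun \<Longrightarrow> x \<notin> {0<..<1} \<Longrightarrow> \<phi> x = 0"
  by (erule test_fun_supp) (metis atLeastAtMost_iff greaterThanLessThan_iff order_less_le_trans order_le_less_trans)

lemma test_fun_DERIV: "\<phi> \<in> test_fun \<Longrightarrow> (\<phi> has_real_derivative deriv \<phi> x) (at x)"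
  by (metis ndiff.simps(2) test_fun_iff)

lemma test_fun_deriv:
  assumes "\<phi> \<in> test_fun" shows "deriv \<phi> \<in> test_fun"
proof -
  obtain a b where ab: "0 < a" "b < 1" "\<And>x. x \<notin> {a..b} \<Longrightarrow> \<phi> x = 0"
    using assms unfolding test_fun_iff by blast
  show ?thesis
  proof (rule test_funI[OF _ ab(1,2)])
    show "ndiff n (deriv \<phi>)" for n using assms by (metis ndiff.simps(2) test_fun_iff)
    show "deriv \<phi> x = 0" if "x \<notin> {a..b}" for x
    proof -
      have "((\<lambda>_. 0) has_real_derivative 0) (at x)" by simp
      then have "(\<phi> has_real_derivative 0) (at x)"
        by (rule has_field_derivative_transform_within_open[where S="- {a..b}"])
          (use that ab in auto)
      then show ?thesis by (rule DERIV_imp_deriv)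
    qed
  qed
qed

lemma test_fun_deriv_pow: "\<phi> \<in> test_fun \<Longrightarrow> (deriv ^^ n) \<phi> \<in> test_fun"
  by (induction n) (auto simp: test_fun_deriv)

lemma test_fun_cont: "\<phi> \<in> test_fun \<Longrightarrow> continuous_on S \<phi>"
  by (meson DERIV_isCont continuous_at_imp_continuous_on test_fun_DERIV)

lemma test_fun_borel: "\<phi> \<in> test_fun \<Longrightarrow> \<phi> \<in> borel_measurable borel"
  by (intro borel_measurable_continuous_onI test_fun_cont)

lemma test_fun_bounded:
  assumes "\<phi> \<in> test_fun" obtains B where "0 \<le> B" "\<And>x. \<bar>\<phi> x\<bar> \<le> B"
proof -
  have "bounded (\<phi> ` {0..1})"
    by (intro compact_imp_bounded compact_continuous_image test_fun_cont assms) auto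
  then obtain B where B: "\<And>x. x \<in> {0..1} \<Longrightarrow> \<bar>\<phi> x\<bar> \<le> B"
    by (metis bounded_iff imageI real_norm_def)
  have "\<bar>\<phi> x\<bar> \<le> max B 0" for x
    using B[of x] test_fun_zero[OF assms, of x] by (cases "x \<in> {0<..<1}") auto
  then show ?thesis by (intro that[of "max B 0"]) auto
qed

lemma test_fun_lincomb:
  assumes "\<phi> \<in> test_fun" "\<psi> \<in> test_fun"
  shows "(\<lambda>x. c * \<phi> x + d * \<psi> x) \<in> test_fun"
proof -
  obtain a b a' b' where ab: "0 < a" "b < 1" "\<And>x. x \<notin> {a..b} \<Longrightarrow> \<phi> x = 0"
    "0 < a'" "b' < 1" "\<And>x. x \<notin> {a'..b'} \<Longrightarrow> \<psi> x = 0"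
    by (metis assms test_fun_supp)
  show ?thesis
  proof (rule test_funI)
    show "ndiff n (\<lambda>x. c * \<phi> x + d * \<psi> x)" for n
      using assms by (intro ndiff_add ndiff_mult ndiff_const) (auto simp: test_fun_iff)
    show "0 < min a a'" "max b b' < 1" using ab by auto
    show "c * \<phi> x + d * \<psi> x = 0" if "x \<notin> {min a a'..max b b'}" for x
      using ab(3)[of x] ab(6)[of x] that by fastforce
  qed
qed

lemma test_fun_diff: "\<phi> \<in> test_fun \<Longrightarrow> \<psi> \<in> test_fun \<Longrightarrow> (\<lambda>x. \<phi> x - \<psi> x) \<in> test_fun"
  using test_fun_lincomb[of \<phi> \<psi> 1 "-1"] by simp

text \<open>
  The roots \<open>exp (- 1 / (n (x - c)))\<close> of the flat function \<open>exp (- 1 / (x - c))\<close> increase to the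
  indicator function of the half line \<open>x > c\<close>; products of two of them do the same for an interval,
  so that no smooth plateau functions have to be constructed.
\<close>

lemma test_fun_approx_interval:
  assumes "0 < c" "c < d" "d < 1"
  obtains \<phi> :: "nat \<Rightarrow> real \<Rightarrow> real"
  where "\<And>n. \<phi> n \<in> test_fun" "\<And>n x. 0 \<le> \<phi> n x" "\<And>n x. \<phi> n x \<le> indicator {c<..<d} x"
    "\<And>x. (\<lambda>n. \<phi> n x) \<longlonglongrightarrow> indicator {c<..<d} x"
proof -
  define \<phi> where "\<phi> n x = exp_tail 1 (real (Suc n) * x + - (real (Suc n) * c)) *
    exp_tail 1 (- real (Suc n) * x + real (Suc n) * d)" for n x
  have out: "\<phi> n x = 0" if "x \<notin> {c<..<d}" for n x
  proof -
    have "real (Suc n) * x + - (real (Suc n) * c) = real (Suc n) * (x - c)"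
      "- real (Suc n) * x + real (Suc n) * d = real (Suc n) * (d - x)" by (auto simp: algebra_simps)
    then show ?thesis using that by (auto simp: \<phi>_def exp_tail_def zero_less_mult_iff simp del: of_nat_Suc)
  qed
  have ins: "\<phi> n x = exp (- (1 / (x - c) / real (Suc n))) * exp (- (1 / (d - x) / real (Suc n)))"
    if "x \<in> {c<..<d}" for n x
  proof -
    have "real (Suc n) * x + - (real (Suc n) * c) = real (Suc n) * (x - c)"
      "- real (Suc n) * x + real (Suc n) * d = real (Suc n) * (d - x)" by (auto simp: algebra_simps)
    then show ?thesis using that
      by (simp add: \<phi>_def exp_tail_def zero_less_mult_iff mult.commute del: of_nat_Suc)
  qed
  show ?thesis
  proof (rule that)
    show "\<phi> n \<in> test_fun" for n
    proof (rule test_funI)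
      show "ndiff k (\<phi> n)" for k
        unfolding \<phi>_def by (intro ndiff_mult ndiff_affine ndiff_exp_tail)
      show "0 < c" "d < 1" by fact+
      show "\<phi> n x = 0" if "x \<notin> {c..d}" for x using out that by auto
    qed
    show "0 \<le> \<phi> n x" for n x by (simp add: \<phi>_def exp_tail_def)
    show "\<phi> n x \<le> indicator {c<..<d} x" for n x
    proof (cases "x \<in> {c<..<d}")
      case True
      then have "\<phi> n x \<le> 1 * 1" unfolding ins[OF True] by (intro mult_mono) auto
      then show ?thesis using True by simp
    qed (simp add: out)
    show "(\<lambda>n. \<phi> n x) \<longlonglongrightarrow> indicator {c<..<d} x" for x
    proof (cases "x \<in> {c<..<d}")
      case True
      have "(\<lambda>n. 1 / y / real (Suc n)) \<longlonglongrightarrow> 0" for y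
        using tendsto_mult[OF tendsto_const[of "1/y"] LIMSEQ_inverse_real_of_nat]
        by (simp add: field_simps)
      then have "(\<lambda>n. exp (- (1 / (x - c) / real (Suc n))) * exp (- (1 / (d - x) / real (Suc n))))
        \<longlonglongrightarrow> exp (-0) * exp (-0)" by (intro tendsto_mult tendsto_exp tendsto_minus)
      then show ?thesis using True by (simp add: ins)
    qed (simp add: out)
  qed
qed

section \<open>The unit interval as a measure space\<close>

lemma space_unit [simp]: "space unit_ivl = {0<..<1}"
  by (simp add: space_restrict_space)

lemma measurable_unit: "f \<in> borel_measurable borel \<Longrightarrow> f \<in> borel_measurable unit_ivl"
  by (simp add: measurable_restrict_space1 measurable_completion)

lemma indicator_unit: "A \<in> sets borel \<Longrightarrow> (indicator A :: real \<Rightarrow> real) \<in> borel_measurable unit_ivl"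
  by (rule measurable_unit) simp

lemma measurable_id_unit: "(\<lambda>x::real. x) \<in> unit_ivl \<rightarrow>\<^sub>M borel"
  by (rule measurable_unit) auto

interpretation U: prob_space unit_ivl
  by (rule prob_spaceI) (simp add: emeasure_restrict_space)

interpretation UU: pair_sigma_finite unit_ivl unit_ivl ..

lemma AE_unit_iff: "(AE x in unit_ivl. P x) \<longleftrightarrow> (AE x in lebesgue. x \<in> {0<..<1} \<longrightarrow> P x)"
  by (rule AE_restrict_space_iff) auto

lemma integrable_unit_iff:
  fixes f :: "real \<Rightarrow> 'a::{banach, second_countable_topology}"
  shows "integrable unit_ivl f \<longleftrightarrow> set_integrable lebesgue {0<..<1} f"
  unfolding set_integrable_def by (rule integrable_restrict_space) auto

lemma integral_unit_eq:
  fixes f :: "real \<Rightarrow> 'a::{banach, second_countable_topology}"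
  shows "integral\<^sup>L unit_ivl f = (LINT x:{0<..<1}|lebesgue. f x)"
  unfolding set_lebesgue_integral_def by (rule integral_restrict_space) auto

lemma integrable_unit_lborel:
  fixes f :: "real \<Rightarrow> 'a::{banach, second_countable_topology}"
  assumes "f \<in> borel_measurable borel"
  shows "integrable unit_ivl f \<longleftrightarrow> set_integrable lborel {0<..<1} f"
  unfolding integrable_unit_iff set_integrable_def using assms
  by (intro integrable_completion) auto

lemma integral_unit_lborel:
  fixes f :: "real \<Rightarrow> 'a::{banach, second_countable_topology}"
  assumes "f \<in> borel_measurable borel"
  shows "integral\<^sup>L unit_ivl f = (LINT x:{0<..<1}|lborel. f x)"
  unfolding integral_unit_eq set_lebesgue_integral_def using assms
  by (intro integral_completion) auto

lemma nn_integral_unit: "(\<integral>\<^sup>+x. f x \<partial>unit_ivl) = (\<integral>\<^sup>+x. f x * indicator {0<..<1} x \<partial>lborel)"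
  by (subst nn_integral_restrict_space) (auto simp: nn_integral_completion)

lemma measurable_unit_AE_cong:
  fixes f g :: "real \<Rightarrow> real"
  assumes "f \<in> borel_measurable unit_ivl" "AE x in unit_ivl. f x = g x"
  shows "g \<in> borel_measurable unit_ivl"
proof -
  have "(\<lambda>x. indicator {0<..<1} x *\<^sub>R f x) \<in> borel_measurable lebesgue"
    using assms(1) by (subst (asm) borel_measurable_restrict_space_iff) auto
  moreover have "AE x in lebesgue. indicator {0<..<1} x *\<^sub>R f x = indicator {0<..<1} x *\<^sub>R g x"
    using assms(2) unfolding AE_unit_iff by (auto elim!: eventually_mono simp: indicator_def)
  ultimately have "(\<lambda>x. indicator {0<..<1} x *\<^sub>R g x) \<in> borel_measurable lebesgue"
    by (rule borel_measurable_AE)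
  then show ?thesis by (subst borel_measurable_restrict_space_iff) auto
qed

lemma integrable_unit_AE_cong:
  fixes f g :: "real \<Rightarrow> real"
  assumes "integrable unit_ivl f" "AE x in unit_ivl. f x = g x"
  shows "integrable unit_ivl g"
  using assms measurable_unit_AE_cong[of f g] integrable_cong_AE[of f unit_ivl g] by auto

lemma integrable_unit_mult_bounded:
  fixes f g :: "real \<Rightarrow> real"
  assumes f: "integrable unit_ivl f" and g: "g \<in> borel_measurable unit_ivl"
    and B: "\<And>x. x \<in> {0<..<1} \<Longrightarrow> \<bar>g x\<bar> \<le> B"
  shows "integrable unit_ivl (\<lambda>x. f x * g x)"
proof (rule Bochner_Integration.integrable_bound)
  show "integrable unit_ivl (\<lambda>x. B * \<bar>f x\<bar>)" using f by auto
  show "(\<lambda>x. f x * g x) \<in> borel_measurable unit_ivl" using f g by measurable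
  show "AE x in unit_ivl. norm (f x * g x) \<le> norm (B * \<bar>f x\<bar>)"
  proof (rule AE_I2)
    fix x assume "x \<in> space unit_ivl"
    then have "\<bar>g x\<bar> \<le> B" using B by simp
    then have "\<bar>f x\<bar> * \<bar>g x\<bar> \<le> \<bar>f x\<bar> * \<bar>B\<bar>" by (intro mult_left_mono) auto
    then show "norm (f x * g x) \<le> norm (B * \<bar>f x\<bar>)" by (simp add: abs_mult mult.commute)
  qed
qed

lemma continuous_unit:
  fixes g :: "real \<Rightarrow> real"
  assumes "continuous_on {0..1} g"
  shows "g \<in> borel_measurable unit_ivl" "\<exists>B\<ge>0. \<forall>x\<in>{0..1}. \<bar>g x\<bar> \<le> B"
proof -
  have "(\<lambda>x. indicator {0<..<1} x *\<^sub>R g x) \<in> borel_measurable borel"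
    by (rule borel_measurable_continuous_on_indicator)
      (auto intro: continuous_on_subset[OF assms])
  then have "(\<lambda>x. indicator {0<..<1} x *\<^sub>R g x) \<in> borel_measurable lebesgue"
    by (intro measurable_completion) simp
  then show "g \<in> borel_measurable unit_ivl"
    by (subst borel_measurable_restrict_space_iff) auto
  have "bounded (g ` {0..1})"
    by (intro compact_imp_bounded compact_continuous_image assms) auto
  then obtain B where "\<And>x. x \<in> {0..1} \<Longrightarrow> \<bar>g x\<bar> \<le> B"
    by (metis bounded_iff imageI real_norm_def)
  then show "\<exists>B\<ge>0. \<forall>x\<in>{0..1}. \<bar>g x\<bar> \<le> B"
    by (intro exI[of _ "max B 0"]) (auto simp: max.coboundedI1)
qed

lemma integrable_unit_mult_continuous:
  fixes f g :: "real \<Rightarrow> real"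
  assumes "integrable unit_ivl f" "continuous_on {0..1} g"
  shows "integrable unit_ivl (\<lambda>x. f x * g x)"
  using continuous_unit[OF assms(2)] assms(1)
  by (metis atLeastAtMost_iff greaterThanLessThan_iff integrable_unit_mult_bounded less_eq_real_def)

lemma L2_integrable: assumes "g \<in> L2" shows "integrable unit_ivl g"
proof (rule Bochner_Integration.integrable_bound)
  show "integrable unit_ivl (\<lambda>x. 1 + (g x)\<^sup>2)" "g \<in> borel_measurable unit_ivl"
    using assms by (auto simp: L2_def)
  have "\<bar>y\<bar> \<le> 1 + y\<^sup>2" for y :: real
  proof -
    have "0 \<le> (\<bar>y\<bar> - 1 / 2)\<^sup>2" by simp
    then show ?thesis by (simp add: power2_diff) (simp add: power2_eq_square)
  qed
  then show "AE x in unit_ivl. norm (g x) \<le> norm (1 + (g x)\<^sup>2)" by auto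
qed

lemma L2_AE_cong:
  assumes "f \<in> L2" and ae: "AE x in unit_ivl. f x = g x" shows "g \<in> L2"
proof -
  have "AE x in unit_ivl. (f x)\<^sup>2 = (g x)\<^sup>2" using ae by eventually_elim simp
  then have "integrable unit_ivl (\<lambda>x. (g x)\<^sup>2)"
    by (rule integrable_unit_AE_cong[rotated]) (use assms in \<open>simp add: L2_def\<close>)
  moreover have "g \<in> borel_measurable unit_ivl"
    by (rule measurable_unit_AE_cong[OF _ ae]) (use assms in \<open>simp add: L2_def\<close>)
  ultimately show ?thesis by (simp add: L2_def)
qed

lemma L2_norm_AE_cong:
  assumes "f \<in> L2" "AE x in unit_ivl. f x = g x"
  shows "L2_norm g = L2_norm f"
proof -
  have "(\<integral>x. (f x)\<^sup>2 \<partial>unit_ivl) = (\<integral>x. (g x)\<^sup>2 \<partial>unit_ivl)"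
  proof (rule integral_cong_AE)
    show "AE x in unit_ivl. (f x)\<^sup>2 = (g x)\<^sup>2" using assms(2) by eventually_elim simp
  qed (use assms(1) L2_AE_cong[OF assms] in \<open>simp_all add: L2_def borel_measurable_power\<close>)
  then show ?thesis by (simp add: L2_norm_def)
qed

lemma L2_norm_nonneg [simp]: "0 \<le> L2_norm g"
  by (simp add: L2_norm_def)

lemma L2_norm_sq: "(L2_norm g)\<^sup>2 = (\<integral>x. (g x)\<^sup>2 \<partial>unit_ivl)"
  by (simp add: L2_norm_def)

lemma L2_add:
  assumes "f \<in> L2" "g \<in> L2"
  shows "(\<lambda>x. f x + g x) \<in> L2" "L2_norm (\<lambda>x. f x + g x) \<le> 2 * (L2_norm f + L2_norm g)"
proof -
  have le: "(f x + g x)\<^sup>2 \<le> 2 * (f x)\<^sup>2 + 2 * (g x)\<^sup>2" for x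
    using sum_squares_bound[of "f x" "g x"] by (simp add: power2_sum)
  have i: "integrable unit_ivl (\<lambda>x. 2 * (f x)\<^sup>2 + 2 * (g x)\<^sup>2)" using assms by (auto simp: L2_def)
  have m: "(\<lambda>x. f x + g x) \<in> borel_measurable unit_ivl" using assms by (auto simp: L2_def)
  have i2: "integrable unit_ivl (\<lambda>x. (f x + g x)\<^sup>2)"
    by (rule Bochner_Integration.integrable_bound[OF i]) (use m le in auto)
  then show "(\<lambda>x. f x + g x) \<in> L2" using m by (simp add: L2_def)
  have "(L2_norm (\<lambda>x. f x + g x))\<^sup>2 \<le> (\<integral>x. 2 * (f x)\<^sup>2 + 2 * (g x)\<^sup>2 \<partial>unit_ivl)"
    unfolding L2_norm_sq by (rule integral_mono[OF i2 i le])
  also have "\<dots> = 2 * (L2_norm f)\<^sup>2 + 2 * (L2_norm g)\<^sup>2"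
    using assms by (simp add: L2_norm_sq L2_def)
  also have "\<dots> \<le> (2 * (L2_norm f + L2_norm g))\<^sup>2"
    by (simp add: power2_eq_square algebra_simps)
  finally show "L2_norm (\<lambda>x. f x + g x) \<le> 2 * (L2_norm f + L2_norm g)"
    by (rule power2_le_imp_le) simp
qed

lemma L2_mult_bounded:
  assumes "g \<in> L2" "a \<in> borel_measurable unit_ivl" "\<And>x. x \<in> {0<..<1} \<Longrightarrow> \<bar>a x\<bar> \<le> B" "0 \<le> B"
  shows "(\<lambda>x. a x * g x) \<in> L2" "L2_norm (\<lambda>x. a x * g x) \<le> B * L2_norm g"
proof -
  have le: "(a x * g x)\<^sup>2 \<le> B\<^sup>2 * (g x)\<^sup>2" if "x \<in> {0<..<1}" for x
    unfolding power_mult_distrib using assms(3)[OF that] assms(4)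
    by (intro mult_right_mono) (simp_all add: power2_le_iff_abs_le)
  have i: "integrable unit_ivl (\<lambda>x. B\<^sup>2 * (g x)\<^sup>2)" using assms by (auto simp: L2_def)
  have m: "(\<lambda>x. a x * g x) \<in> borel_measurable unit_ivl" using assms by (auto simp: L2_def)
  have i2: "integrable unit_ivl (\<lambda>x. (a x * g x)\<^sup>2)"
  proof (rule Bochner_Integration.integrable_bound[OF i])
    show "AE x in unit_ivl. norm ((a x * g x)\<^sup>2) \<le> norm (B\<^sup>2 * (g x)\<^sup>2)"
      using le by (intro AE_I2) simp
  qed (intro borel_measurable_power m)
  then show "(\<lambda>x. a x * g x) \<in> L2" using m by (simp add: L2_def)
  have "(L2_norm (\<lambda>x. a x * g x))\<^sup>2 \<le> (\<integral>x. B\<^sup>2 * (g x)\<^sup>2 \<partial>unit_ivl)"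
    unfolding L2_norm_sq by (rule integral_mono[OF i2 i]) (use le in simp)
  also have "\<dots> = (B * L2_norm g)\<^sup>2"
    by (simp add: L2_norm_sq power_mult_distrib)
  finally show "L2_norm (\<lambda>x. a x * g x) \<le> B * L2_norm g"
    by (rule power2_le_imp_le) (use assms in simp)
qed

lemma L2_bounded:
  assumes "a \<in> borel_measurable unit_ivl" "AE x in unit_ivl. \<bar>a x\<bar> \<le> B" "0 \<le> B"
  shows "a \<in> L2" "L2_norm a \<le> B"
proof -
  have le: "AE x in unit_ivl. (a x)\<^sup>2 \<le> B\<^sup>2"
    using assms(2) by eventually_elim (rule iffD2[OF power2_le_iff_abs_le[OF assms(3)]])
  have i: "integrable unit_ivl (\<lambda>x. (a x)\<^sup>2)"
  proof (rule Bochner_Integration.integrable_bound[where f="\<lambda>_. B\<^sup>2"])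
    show "AE x in unit_ivl. norm ((a x)\<^sup>2) \<le> norm (B\<^sup>2)" using le
      by (rule eventually_mono) (simp only: real_norm_def abs_power2)
    show "(\<lambda>x. (a x)\<^sup>2) \<in> borel_measurable unit_ivl" by (rule borel_measurable_power[OF assms(1)])
  qed (rule U.integrable_const)
  then show "a \<in> L2" using assms by (simp add: L2_def)
  have "(L2_norm a)\<^sup>2 \<le> (\<integral>x. B\<^sup>2 \<partial>unit_ivl)"
    unfolding L2_norm_sq by (rule integral_mono_AE[OF i _ le]) (rule U.integrable_const)
  also have "\<dots> = B\<^sup>2" using U.prob_space by simp
  finally show "L2_norm a \<le> B" by (rule power2_le_imp_le) (rule assms(3))
qed

lemma integral_abs_le_L2_norm:
  assumes "g \<in> L2" shows "(\<integral>x. \<bar>g x\<bar> \<partial>unit_ivl) \<le> L2_norm g"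
proof -
  have i: "integrable unit_ivl (\<lambda>x. \<bar>g x\<bar>)" using L2_integrable[OF assms] by simp
  have "0 \<le> U.variance (\<lambda>x. \<bar>g x\<bar>)" by simp
  also have "\<dots> = U.expectation (\<lambda>x. \<bar>g x\<bar>\<^sup>2) - (U.expectation (\<lambda>x. \<bar>g x\<bar>))\<^sup>2"
    by (rule U.variance_eq[OF i]) (use assms in \<open>simp add: L2_def\<close>)
  finally have "(\<integral>x. \<bar>g x\<bar> \<partial>unit_ivl)\<^sup>2 \<le> (L2_norm g)\<^sup>2" by (simp add: L2_norm_sq)
  then show ?thesis by (rule power2_le_imp_le) simp
qed

lemma L2_mult_integrable:
  assumes "f \<in> L2" "g \<in> L2" shows "integrable unit_ivl (\<lambda>x. f x * g x)"
proof (rule Bochner_Integration.integrable_bound[where f="\<lambda>x. (f x)\<^sup>2 + (g x)\<^sup>2"])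
  have "\<bar>f x * g x\<bar> \<le> (f x)\<^sup>2 + (g x)\<^sup>2" for x
  proof -
    have "2 * (f x * g x) \<le> (f x)\<^sup>2 + (g x)\<^sup>2" "2 * (f x * - g x) \<le> (f x)\<^sup>2 + (g x)\<^sup>2"
      using sum_squares_bound[of "f x" "g x"] sum_squares_bound[of "f x" "- g x"]
      by (simp_all only: power2_minus mult.assoc)
    then have "2 * \<bar>f x * g x\<bar> \<le> (f x)\<^sup>2 + (g x)\<^sup>2" by (simp add: abs_if)
    then show ?thesis by linarith
  qed
  then show "AE x in unit_ivl. norm (f x * g x) \<le> norm ((f x)\<^sup>2 + (g x)\<^sup>2)" by auto
  show "integrable unit_ivl (\<lambda>x. (f x)\<^sup>2 + (g x)\<^sup>2)" using assms by (simp add: L2_def)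
  show "(\<lambda>x. f x * g x) \<in> borel_measurable unit_ivl" using assms by (intro borel_measurable_times) (simp_all add: L2_def)
qed

lemma Cauchy_Schwarz_unit:
  assumes "f \<in> L2" "g \<in> L2"
  shows "\<bar>\<integral>x. f x * g x \<partial>unit_ivl\<bar> \<le> L2_norm f * L2_norm g"
proof -
  define a where "a = (\<integral>x. (f x)\<^sup>2 \<partial>unit_ivl)"
  define b where "b = (\<integral>x. f x * g x \<partial>unit_ivl)"
  define c where "c = (\<integral>x. (g x)\<^sup>2 \<partial>unit_ivl)"
  have i: "integrable unit_ivl (\<lambda>x. f x * g x)" by (rule L2_mult_integrable[OF assms])
  \<comment> \<open>The quadratic form of the Gram matrix of \<open>f\<close> and \<open>g\<close>.\<close>
  have q: "0 \<le> s\<^sup>2 * a + 2 * s * t * b + t\<^sup>2 * c" for s t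
  proof -
    have "0 \<le> (\<integral>x. (s * f x + t * g x)\<^sup>2 \<partial>unit_ivl)" by simp
    also have "\<dots> = (\<integral>x. s\<^sup>2 * (f x)\<^sup>2 + 2 * s * t * (f x * g x) + t\<^sup>2 * (g x)\<^sup>2 \<partial>unit_ivl)"
      by (rule Bochner_Integration.integral_cong) (auto simp: power2_eq_square algebra_simps)
    also have "\<dots> = s\<^sup>2 * a + 2 * s * t * b + t\<^sup>2 * c"
      using assms i by (simp add: a_def b_def c_def L2_def)
    finally show ?thesis .
  qed
  have a: "0 \<le> a" and c: "0 \<le> c" by (auto simp: a_def c_def)
  have "b\<^sup>2 \<le> a * c"
  proof (cases "c = 0")
    case True
    have "b = 0"
    proof (rule ccontr)
      assume "b \<noteq> 0"
      then show False
        using q[of 1 "- (a + 1) / (2 * b)"] True a by (simp add: field_simps)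
    qed
    then show ?thesis using True by simp
  next
    case False
    have "0 \<le> c * (a * c - b\<^sup>2)" using q[of c "- b"] by (simp add: power2_eq_square algebra_simps)
    then show ?thesis using False c by (simp add: zero_le_mult_iff)
  qed
  then have "\<bar>b\<bar>\<^sup>2 \<le> (L2_norm f * L2_norm g)\<^sup>2"
    by (simp add: power_mult_distrib L2_norm_sq a_def c_def)
  then show ?thesis unfolding b_def by (rule power2_le_imp_le) simp
qed

lemma L2_diff: "f \<in> L2 \<Longrightarrow> g \<in> L2 \<Longrightarrow> (\<lambda>x. f x - g x) \<in> L2"
  using L2_add(1)[of f "\<lambda>x. -1 * g x"] L2_mult_bounded(1)[of g "\<lambda>_. -1" 1] by simp

text \<open>
  A subsequence converges almost everywhere because an \<open>L2\<close> Cauchy sequence on a probability space is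
  Cauchy in the mean; Fatou's lemma then bounds the distance of the limit to each member.
\<close>

lemma L2_complete:
  assumes h: "\<And>n. h n \<in> L2" and d: "d \<longlonglongrightarrow> 0" and K: "0 \<le> K" "\<And>n. 0 \<le> d n"
    and le: "\<And>n m. L2_norm (\<lambda>x. h n x - h m x) \<le> K * (d n + d m)"
  obtains g where "g \<in> L2" "\<And>n. L2_norm (\<lambda>x. g x - h n x) \<le> K * d n"
proof -
  have hm: "h n \<in> borel_measurable unit_ivl" for n using h[of n] by (simp add: L2_def)
  have hi: "integrable unit_ivl (h n)" for n by (rule L2_integrable[OF h])
  have Kd: "(\<lambda>n. K * d n) \<longlonglongrightarrow> 0" using tendsto_mult_right[OF d, of K] by (simp add: mult.commute tendsto_mult_right_zero)
  obtain r where r: "strict_mono r" "AE x in unit_ivl. Cauchy (\<lambda>i. h (r i) x)"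
  proof (rule cauchy_L1_AE_cauchy_subseq[of unit_ivl h])
    show "integrable unit_ivl (h n)" for n by (rule hi)
    fix e :: real assume e: "0 < e"
    obtain N where N: "\<And>n. n \<ge> N \<Longrightarrow> K * d n < e / 2"
      using order_tendstoD(2)[OF Kd, of "e / 2"] e by (auto simp: eventually_sequentially)
    show "\<exists>N. \<forall>i\<ge>N. \<forall>j\<ge>N. LINT x|unit_ivl. norm (h i x - h j x) < e"
    proof (intro exI allI impI)
      fix i j assume ij: "N \<le> i" "N \<le> j"
      have "(LINT x|unit_ivl. norm (h i x - h j x)) \<le> L2_norm (\<lambda>x. h i x - h j x)"
        using integral_abs_le_L2_norm[OF L2_diff[OF h h]] by simp
      also have "\<dots> \<le> K * d i + K * d j" using le[of i j] by (simp add: distrib_left)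
      also have "\<dots> < e" using N[OF ij(1)] N[OF ij(2)] by simp
      finally show "(LINT x|unit_ivl. norm (h i x - h j x)) < e" .
    qed
  qed
  define g where "g x = lim (\<lambda>i. h (r i) x)" for x
  have gm: "g \<in> borel_measurable unit_ivl" unfolding g_def by (rule borel_measurable_lim_metric[OF hm])
  have conv: "AE x in unit_ivl. (\<lambda>i. h (r i) x) \<longlonglongrightarrow> g x"
    using r(2) by eventually_elim (simp add: g_def Cauchy_convergent convergent_LIMSEQ_iff[symmetric])
  have fatou: "(\<integral>\<^sup>+x. ennreal ((g x - h n x)\<^sup>2) \<partial>unit_ivl) \<le> ennreal ((K * d n)\<^sup>2)" for n
  proof -
    have dm: "(\<lambda>x. ennreal ((h (r i) x - h n x)\<^sup>2)) \<in> borel_measurable unit_ivl" for i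
      using hm[of "r i"] hm[of n] by measurable
    have "(\<integral>\<^sup>+x. ennreal ((g x - h n x)\<^sup>2) \<partial>unit_ivl) = (\<integral>\<^sup>+x. liminf (\<lambda>i. ennreal ((h (r i) x - h n x)\<^sup>2)) \<partial>unit_ivl)"
    proof (rule nn_integral_cong_AE)
      show "AE x in unit_ivl. ennreal ((g x - h n x)\<^sup>2) = liminf (\<lambda>i. ennreal ((h (r i) x - h n x)\<^sup>2))"
        using conv
      proof eventually_elim
        case (elim x)
        have "(\<lambda>i. ennreal ((h (r i) x - h n x)\<^sup>2)) \<longlonglongrightarrow> ennreal ((g x - h n x)\<^sup>2)"
          by (intro tendsto_ennrealI tendsto_power tendsto_diff elim tendsto_const)
        then show ?case by (intro lim_imp_Liminf[symmetric]) auto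
      qed
    qed
    also have "\<dots> \<le> liminf (\<lambda>i. \<integral>\<^sup>+x. ennreal ((h (r i) x - h n x)\<^sup>2) \<partial>unit_ivl)"
      by (rule nn_integral_liminf[OF dm])
    also have "\<dots> \<le> liminf (\<lambda>i. ennreal ((K * (d (r i) + d n))\<^sup>2))"
    proof (intro Liminf_mono always_eventually allI)
      fix i
      have "(\<integral>\<^sup>+x. ennreal ((h (r i) x - h n x)\<^sup>2) \<partial>unit_ivl) = ennreal ((L2_norm (\<lambda>x. h (r i) x - h n x))\<^sup>2)"
        unfolding L2_norm_sq by (rule nn_integral_eq_integral) (use L2_diff[OF h h] in \<open>auto simp: L2_def\<close>)
      also have "\<dots> \<le> ennreal ((K * (d (r i) + d n))\<^sup>2)"
        by (intro ennreal_leI power_mono le) simp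
      finally show "(\<integral>\<^sup>+x. ennreal ((h (r i) x - h n x)\<^sup>2) \<partial>unit_ivl) \<le> ennreal ((K * (d (r i) + d n))\<^sup>2)" .
    qed
    also have "\<dots> = ennreal ((K * (0 + d n))\<^sup>2)"
    proof (rule lim_imp_Liminf)
      have "(\<lambda>i. d (r i)) \<longlonglongrightarrow> 0" using LIMSEQ_subseq_LIMSEQ[OF d r(1)] by (simp add: o_def)
      then show "(\<lambda>i. ennreal ((K * (d (r i) + d n))\<^sup>2)) \<longlonglongrightarrow> ennreal ((K * (0 + d n))\<^sup>2)"
        by (intro tendsto_ennrealI tendsto_power tendsto_mult tendsto_add tendsto_const)
    qed simp
    finally show ?thesis by simp
  qed
  have i: "integrable unit_ivl (\<lambda>x. (g x - h n x)\<^sup>2)" for n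
  proof (rule integrableI_nonneg)
    show "(\<integral>\<^sup>+x. ennreal ((g x - h n x)\<^sup>2) \<partial>unit_ivl) < \<infinity>"
      using fatou[of n] by (simp add: le_less_trans)
  qed (use gm hm in \<open>auto intro!: borel_measurable_power borel_measurable_diff\<close>)
  have "(\<lambda>x. g x - h 0 x) \<in> L2" using i[of 0] gm hm[of 0] by (simp add: L2_def)
  then have "(\<lambda>x. (g x - h 0 x) + h 0 x) \<in> L2" by (rule L2_add(1)[OF _ h])
  then have g: "g \<in> L2" by simp
  moreover have "L2_norm (\<lambda>x. g x - h n x) \<le> K * d n" for n
  proof -
    have "ennreal ((L2_norm (\<lambda>x. g x - h n x))\<^sup>2) \<le> ennreal ((K * d n)\<^sup>2)"
      using fatou[of n] i[of n] unfolding L2_norm_sq by (subst (asm) nn_integral_eq_integral) auto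
    then have "(L2_norm (\<lambda>x. g x - h n x))\<^sup>2 \<le> (K * d n)\<^sup>2" by (simp add: ennreal_le_iff)
    then show ?thesis by (rule power2_le_imp_le) (use K in simp)
  qed
  ultimately show ?thesis by (rule that)
qed

lemma L2_pairing_tendsto:
  assumes g: "g \<in> L2" "\<And>n. h n \<in> L2" "k \<in> L2" and d: "d \<longlonglongrightarrow> 0"
    and le: "\<And>n. L2_norm (\<lambda>x. g x - h n x) \<le> d n"
  shows "(\<lambda>n. \<integral>x. h n x * k x \<partial>unit_ivl) \<longlonglongrightarrow> (\<integral>x. g x * k x \<partial>unit_ivl)"
proof (rule LIM_zero_cancel, rule Lim_null_comparison)
  show "(\<lambda>n. d n * L2_norm k) \<longlonglongrightarrow> 0" using tendsto_mult_right[OF d, of "L2_norm k"] by (simp add: mult.commute tendsto_mult_left_zero)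
  show "\<forall>\<^sub>F n in sequentially. norm ((\<integral>x. h n x * k x \<partial>unit_ivl) - (\<integral>x. g x * k x \<partial>unit_ivl)) \<le> d n * L2_norm k"
  proof (rule always_eventually, rule allI)
    fix n
    have "(\<integral>x. g x * k x \<partial>unit_ivl) - (\<integral>x. h n x * k x \<partial>unit_ivl) = (\<integral>x. (g x - h n x) * k x \<partial>unit_ivl)"
      using L2_mult_integrable[OF g(1,3)] L2_mult_integrable[OF g(2,3), of n] by (simp add: left_diff_distrib)
    then have "norm ((\<integral>x. h n x * k x \<partial>unit_ivl) - (\<integral>x. g x * k x \<partial>unit_ivl)) = \<bar>\<integral>x. (g x - h n x) * k x \<partial>unit_ivl\<bar>"
      by (subst norm_minus_commute) (simp only: real_norm_def)
    also have "\<dots> \<le> L2_norm (\<lambda>x. g x - h n x) * L2_norm k"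
      by (rule Cauchy_Schwarz_unit[OF L2_diff[OF g(1,2)] g(3)])
    also have "\<dots> \<le> d n * L2_norm k" by (rule mult_right_mono[OF le]) simp
    finally show "norm ((\<integral>x. h n x * k x \<partial>unit_ivl) - (\<integral>x. g x * k x \<partial>unit_ivl)) \<le> d n * L2_norm k" .
  qed
qed

section \<open>The fundamental lemma of the calculus of variations\<close>

text \<open>
  Positive and negative part are densities of finite measures that agree on all half lines, hence
  on all Borel sets.
\<close>

lemma integrable_zero_tails_AE:
  fixes g :: "real \<Rightarrow> real"
  assumes g: "integrable lborel g" and z: "\<And>x. (LINT y:{x<..}|lborel. g y) = 0"
  shows "AE x in lborel. g x = 0"
proof -
  have [measurable]: "g \<in> borel_measurable borel" using g by auto
  have fin: "emeasure (density lborel (\<lambda>x. ennreal (f x))) {x<..} = ennreal (LINT y:{x<..}|lborel. f y)"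
    if f: "integrable lborel f" "\<And>x. 0 \<le> f x" for f :: "real \<Rightarrow> real" and x
  proof -
    have [measurable]: "f \<in> borel_measurable borel" using f by auto
    have "emeasure (density lborel (\<lambda>x. ennreal (f x))) {x<..} = (\<integral>\<^sup>+y. ennreal (indicator {x<..} y *\<^sub>R f y) \<partial>lborel)"
      by (subst emeasure_density) (auto intro!: nn_integral_cong split: split_indicator)
    also have "\<dots> = ennreal (LINT y:{x<..}|lborel. f y)"
      unfolding set_lebesgue_integral_def
      by (rule nn_integral_eq_integral) (use f integrable_mult_indicator[OF _ f(1), of "{x<..}"] in auto)
    finally show ?thesis .
  qed
  have ip: "integrable lborel (\<lambda>x. max 0 (g x))" and im: "integrable lborel (\<lambda>x. max 0 (- g x))"
    using g by auto
  have eq: "(LINT y:{x<..}|lborel. max 0 (g y)) = (LINT y:{x<..}|lborel. max 0 (- g y))" for x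
  proof -
    have "(LINT y:{x<..}|lborel. max 0 (g y)) - (LINT y:{x<..}|lborel. max 0 (- g y))
      = (LINT y:{x<..}|lborel. max 0 (g y) - max 0 (- g y))"
      by (intro set_integral_diff(2)[symmetric]; unfold set_integrable_def)
        (rule integrable_mult_indicator, simp, fact)+
    also have "\<dots> = (LINT y:{x<..}|lborel. g y)"
      by (intro set_lebesgue_integral_cong) (auto simp: max_def)
    finally show ?thesis using z by simp
  qed
  have "density lborel (\<lambda>x. ennreal (max 0 (g x))) = density lborel (\<lambda>x. ennreal (max 0 (- g x)))"
  proof (rule measure_eqI_lessThan)
    show "emeasure (density lborel (\<lambda>x. ennreal (max 0 (g x)))) {x<..} < \<infinity>" for x
      by (subst fin[OF ip]) auto
    show "emeasure (density lborel (\<lambda>x. ennreal (max 0 (g x)))) {x<..} =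
      emeasure (density lborel (\<lambda>x. ennreal (max 0 (- g x)))) {x<..}" for x
      by (subst fin[OF ip], simp, subst fin[OF im], simp, simp add: eq)
  qed auto
  then have "AE x in lborel. ennreal (max 0 (g x)) = ennreal (max 0 (- g x))"
    by (intro sigma_finite_measure.density_unique[OF sigma_finite_lborel]) auto
  then show ?thesis
    by eventually_elim (auto simp: max_def split: if_splits)
qed

lemma integrable_test_fun_mult:
  assumes "loc_integrable g" "\<phi> \<in> test_fun"
  shows "integrable unit_ivl (\<lambda>x. g x * \<phi> x)"
proof -
  obtain a b where ab: "0 < a" "a < b" "b < 1" "\<And>x. x \<notin> {a..b} \<Longrightarrow> \<phi> x = 0"
    using test_fun_supp[OF assms(2)] by blast
  obtain B where B: "0 \<le> B" "\<And>x. \<bar>\<phi> x\<bar> \<le> B" using test_fun_bounded[OF assms(2)] by blast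
  have i: "integrable lebesgue (\<lambda>x. indicator {a..b} x *\<^sub>R g x)"
    using assms(1) ab unfolding loc_integrable_def set_integrable_def by auto
  have "integrable unit_ivl (\<lambda>x. indicator {a..b} x *\<^sub>R g x)"
    unfolding integrable_unit_iff set_integrable_def by (rule integrable_mult_indicator[OF _ i]) auto
  then have "integrable unit_ivl (\<lambda>x. indicator {a..b} x *\<^sub>R g x * \<phi> x)"
    by (rule integrable_unit_mult_bounded[OF _ measurable_unit[OF test_fun_borel[OF assms(2)]] B(2)])
  moreover have "(\<lambda>x. indicator {a..b} x *\<^sub>R g x * \<phi> x) = (\<lambda>x. g x * \<phi> x)"
  proof
    fix x show "indicator {a..b} x *\<^sub>R g x * \<phi> x = g x * \<phi> x"
      using ab(4)[of x] by (cases "x \<in> {a..b}") simp_all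
  qed
  ultimately show ?thesis by (simp only:)
qed

lemma loc_integrable_unit: "integrable unit_ivl g \<Longrightarrow> loc_integrable g"
  unfolding loc_integrable_def integrable_unit_iff by (auto elim: set_integrable_subset)

text \<open>
  By dominated convergence the integral of \<open>g\<close> over every interval with end points inside the unit
  interval is 0.
\<close>

theorem fundamental_lemma:
  assumes g: "loc_integrable g" and z: "\<And>\<phi>. \<phi> \<in> test_fun \<Longrightarrow> L2_inner g \<phi> = 0"
  shows "AE x in unit_ivl. g x = 0"
proof -
  have int: "(LINT x:{c<..<d}|lebesgue. g x) = 0" if cd: "0 < c" "d < 1" for c d
  proof (cases "c < d")
    case True
    obtain \<phi> where \<phi>: "\<And>n. \<phi> n \<in> test_fun" "\<And>n x. 0 \<le> \<phi> n x" "\<And>n x. \<phi> n x \<le> indicator {c<..<d} x"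
      "\<And>x. (\<lambda>n. \<phi> n x) \<longlonglongrightarrow> indicator {c<..<d} x"
      using test_fun_approx_interval[OF cd(1) True cd(2)] by blast
    have i: "integrable lebesgue (\<lambda>x. indicator {c..d} x *\<^sub>R g x)"
      using g cd unfolding loc_integrable_def set_integrable_def by auto
    have ig: "integrable lebesgue (\<lambda>x. indicator {c<..<d} x *\<^sub>R g x)"
    proof -
      have "integrable lebesgue (\<lambda>x. indicator {c<..<d} x *\<^sub>R (indicator {c..d} x *\<^sub>R g x))"
        by (rule integrable_mult_indicator[OF _ i]) auto
      moreover have "(\<lambda>x. indicator {c<..<d} x *\<^sub>R (indicator {c..d} x *\<^sub>R g x)) = (\<lambda>x. indicator {c<..<d} x *\<^sub>R g x)"
        by (auto simp: indicator_def)
      ultimately show ?thesis by (simp only:)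
    qed
    have gi: "indicator {0<..<1} x *\<^sub>R (g x * \<phi> n x) = indicator {c<..<d} x *\<^sub>R g x * \<phi> n x" for n x
      using \<phi>(2,3)[of n x] cd by (auto simp: indicator_def split: if_splits)
    have "(\<lambda>n. \<integral>x. indicator {c<..<d} x *\<^sub>R g x * \<phi> n x \<partial>lebesgue) \<longlonglongrightarrow>
        (\<integral>x. indicator {c<..<d} x *\<^sub>R g x * indicator {c<..<d} x \<partial>lebesgue)"
    proof (rule integral_dominated_convergence[where w="\<lambda>x. \<bar>indicator {c<..<d} x *\<^sub>R g x\<bar>"])
      show "AE x in lebesgue. norm (indicator {c<..<d} x *\<^sub>R g x * \<phi> n x) \<le> \<bar>indicator {c<..<d} x *\<^sub>R g x\<bar>" for n
      proof (rule AE_I2)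
        fix x
        have "\<phi> n x \<le> 1" by (rule order_trans[OF \<phi>(3)]) (simp add: indicator_def)
        then have "\<bar>\<phi> n x\<bar> \<le> 1" using \<phi>(2)[of n x] by simp
        then show "norm (indicator {c<..<d} x *\<^sub>R g x * \<phi> n x) \<le> \<bar>indicator {c<..<d} x *\<^sub>R g x\<bar>"
          unfolding real_norm_def abs_mult[of _ "\<phi> n x"] by (rule mult_left_le) simp
      qed
      show "AE x in lebesgue. (\<lambda>n. indicator {c<..<d} x *\<^sub>R g x * \<phi> n x) \<longlonglongrightarrow> indicator {c<..<d} x *\<^sub>R g x * indicator {c<..<d} x"
        by (intro AE_I2 tendsto_mult tendsto_const \<phi>(4))
      show "(\<lambda>x. indicator {c<..<d} x *\<^sub>R g x * \<phi> n x) \<in> borel_measurable lebesgue" for n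
      proof (rule borel_measurable_times[OF borel_measurable_integrable[OF ig]])
        have "\<phi> n \<in> borel_measurable lborel" using test_fun_borel[OF \<phi>(1)[of n]] by simp
        then show "\<phi> n \<in> borel_measurable lebesgue" by (rule measurable_completion)
      qed
      show "(\<lambda>x. indicator {c<..<d} x *\<^sub>R g x * indicator {c<..<d} x) \<in> borel_measurable lebesgue"
        by (rule borel_measurable_times[OF borel_measurable_integrable[OF ig]])
          (rule borel_measurable_indicator, simp)
    qed (use ig in auto)
    moreover have "(\<integral>x. indicator {c<..<d} x *\<^sub>R g x * \<phi> n x \<partial>lebesgue) = 0" for n
      using z[OF \<phi>(1)[of n]] unfolding L2_inner_def integral_unit_eq set_lebesgue_integral_def gi .
    moreover have "(\<lambda>x. indicator {c<..<d} x *\<^sub>R g x * indicator {c<..<d} x) = (\<lambda>x. indicator {c<..<d} x *\<^sub>R g x)"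
      by (auto simp: indicator_def)
    ultimately show ?thesis
      unfolding set_lebesgue_integral_def by (simp only: LIMSEQ_const_iff)
  qed (simp add: set_lebesgue_integral_def)
  have ae: "AE x in lebesgue. x \<in> {a<..<b} \<longrightarrow> g x = 0" if ab: "0 < a" "a < b" "b < 1" for a b
  proof -
    let ?g = "\<lambda>x. indicator {a<..<b} x *\<^sub>R g x"
    have "set_integrable lebesgue {a..b} g" using g ab by (auto simp: loc_integrable_def)
    then have "set_integrable lebesgue {a<..<b} g" by (rule set_integrable_subset) auto
    then have i: "integrable lebesgue ?g" by (simp add: set_integrable_def)
    obtain g' where g': "g' \<in> borel_measurable lborel" "AE x in lborel. ?g x = g' x"
      using completion_ex_borel_measurable_real[of ?g lborel] i by auto
    have ae': "AE x in lebesgue. ?g x = g' x" using g'(2) by (rule AE_completion)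
    have "integrable lebesgue g'"
      using i ae' by (subst integrable_cong_AE[symmetric, of ?g]) (use g' in \<open>auto intro: measurable_completion\<close>)
    then have i': "integrable lborel g'" by (subst (asm) integrable_completion) (use g' in auto)
    have "AE x in lborel. g' x = 0"
    proof (rule integrable_zero_tails_AE[OF i'])
      fix x
      have "(LINT y:{x<..}|lborel. g' y) = (LINT y|lebesgue. indicator {x<..} y *\<^sub>R g' y)"
        unfolding set_lebesgue_integral_def using g' by (intro integral_completion[symmetric]) auto
      also have "\<dots> = (LINT y|lebesgue. indicator {x<..} y *\<^sub>R ?g y)"
      proof (rule integral_cong_AE)
        have "g' \<in> borel_measurable lebesgue" using g'(1) by (rule measurable_completion)
        then show "(\<lambda>y. indicator {x<..} y *\<^sub>R g' y) \<in> borel_measurable lebesgue"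
          by (intro borel_measurable_scaleR borel_measurable_indicator) simp_all
        show "(\<lambda>y. indicator {x<..} y *\<^sub>R ?g y) \<in> borel_measurable lebesgue"
          by (intro borel_measurable_scaleR[OF _ borel_measurable_integrable[OF i]] borel_measurable_indicator) simp
        show "AE y in lebesgue. indicator {x<..} y *\<^sub>R g' y = indicator {x<..} y *\<^sub>R ?g y"
          using ae' by eventually_elim simp
      qed
      also have "\<dots> = (LINT y:{max a x<..<b}|lebesgue. g y)"
        unfolding set_lebesgue_integral_def
        by (rule Bochner_Integration.integral_cong) (auto simp: indicator_def)
      also have "\<dots> = 0" using ab by (intro int) auto
      finally show "(LINT y:{x<..}|lborel. g' y) = 0" .
    qed
    then have "AE x in lebesgue. g' x = 0" by (rule AE_completion)
    then show ?thesis using ae' by eventually_elim auto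
  qed
  have "AE x in lebesgue. \<forall>n::nat. x \<in> {1 / real (n + 3)<..<1 - 1 / real (n + 3)} \<longrightarrow> g x = 0"
    unfolding AE_all_countable by (intro allI ae) (auto simp: field_simps)
  then show ?thesis unfolding AE_unit_iff
  proof eventually_elim
    case (elim x)
    show ?case
    proof
      assume x: "x \<in> {0<..<1}"
      then have "0 < min x (1 - x)" by auto
      then obtain n where n: "inverse (real (Suc n)) < min x (1 - x)" using reals_Archimedean by blast
      have "1 / real (n + 3) \<le> inverse (real (Suc n))" by (simp add: field_simps)
      then show "g x = 0" using elim[rule_format, of n] n by auto
    qed
  qed
qed

section \<open>Weak derivatives\<close>

lemma loc_integrable_AE_cong:
  assumes "loc_integrable f" "AE x in unit_ivl. f x = g x"
  shows "loc_integrable g"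
  unfolding loc_integrable_def
proof (intro allI impI)
  fix a b :: real assume ab: "0 < a \<and> b < 1"
  let ?i = "indicator {a..b} :: real \<Rightarrow> real"
  have i: "integrable lebesgue (\<lambda>x. ?i x *\<^sub>R f x)"
    using assms(1) ab by (auto simp: loc_integrable_def set_integrable_def)
  have ae: "AE x in lebesgue. ?i x *\<^sub>R f x = ?i x *\<^sub>R g x"
    using assms(2) unfolding AE_unit_iff by (rule eventually_mono) (use ab in \<open>auto simp: indicator_def\<close>)
  have "(\<lambda>x. ?i x *\<^sub>R g x) \<in> borel_measurable lebesgue"
    by (rule borel_measurable_AE[OF _ ae]) (use i in auto)
  then show "set_integrable lebesgue {a..b} g"
    unfolding set_integrable_def using i ae integrable_cong_AE by blast
qed

lemma loc_integrable_cmult: "loc_integrable f \<Longrightarrow> loc_integrable (\<lambda>x. c * f x)"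
  unfolding loc_integrable_def by auto

lemma loc_integrable_diff: "loc_integrable f \<Longrightarrow> loc_integrable g \<Longrightarrow> loc_integrable (\<lambda>x. f x - g x)"
  unfolding loc_integrable_def by (auto intro: set_integral_diff)

lemma L2_inner_AE_cong:
  assumes "loc_integrable f" "AE x in unit_ivl. f x = g x" "\<phi> \<in> test_fun"
  shows "L2_inner f \<phi> = L2_inner g \<phi>"
  unfolding L2_inner_def
proof (rule integral_cong_AE)
  show "AE x in unit_ivl. f x * \<phi> x = g x * \<phi> x"
    using assms(2) by eventually_elim simp
  show "(\<lambda>x. f x * \<phi> x) \<in> borel_measurable unit_ivl"
    using integrable_test_fun_mult[OF assms(1,3)] by auto
  show "(\<lambda>x. g x * \<phi> x) \<in> borel_measurable unit_ivl"
    using integrable_test_fun_mult[OF loc_integrable_AE_cong[OF assms(1,2)] assms(3)] by auto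
qed

lemma has_weak_deriv_AE_cong:
  assumes "has_weak_deriv k w g" "AE x in unit_ivl. w x = w' x" "AE x in unit_ivl. g x = g' x"
  shows "has_weak_deriv k w' g'"
proof -
  have l: "loc_integrable w" "loc_integrable g"
    and eq: "\<And>\<phi>. \<phi> \<in> test_fun \<Longrightarrow> L2_inner w ((deriv ^^ k) \<phi>) = (- 1) ^ k * L2_inner g \<phi>"
    using assms(1) by (auto simp: has_weak_deriv_def)
  show ?thesis
    unfolding has_weak_deriv_def
  proof (intro conjI ballI)
    show "loc_integrable w'" "loc_integrable g'"
      by (rule loc_integrable_AE_cong, rule l, rule assms)+
    fix \<phi> assume \<phi>: "\<phi> \<in> test_fun"
    show "L2_inner w' ((deriv ^^ k) \<phi>) = (- 1) ^ k * L2_inner g' \<phi>"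
      using eq[OF \<phi>] L2_inner_AE_cong[OF l(1) assms(2) test_fun_deriv_pow[OF \<phi>]]
        L2_inner_AE_cong[OF l(2) assms(3) \<phi>] by simp
  qed
qed

lemma L2_inner_diff:
  assumes "loc_integrable f" "loc_integrable g" "\<phi> \<in> test_fun"
  shows "L2_inner (\<lambda>x. f x - g x) \<phi> = L2_inner f \<phi> - L2_inner g \<phi>"
  unfolding L2_inner_def left_diff_distrib
  by (intro Bochner_Integration.integral_diff integrable_test_fun_mult assms)

theorem has_weak_deriv_unique:
  assumes "has_weak_deriv k w g" "has_weak_deriv k w h"
  shows "AE x in unit_ivl. g x = h x"
proof -
  have l: "loc_integrable g" "loc_integrable h" using assms by (auto simp: has_weak_deriv_def)
  have "AE x in unit_ivl. g x - h x = 0"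
  proof (rule fundamental_lemma)
    show "loc_integrable (\<lambda>x. g x - h x)" by (rule loc_integrable_diff[OF l])
    fix \<phi> assume \<phi>: "\<phi> \<in> test_fun"
    have "(- 1) ^ k * L2_inner g \<phi> = (- 1) ^ k * L2_inner h \<phi>"
      using assms \<phi> by (metis has_weak_deriv_def)
    then show "L2_inner (\<lambda>x. g x - h x) \<phi> = 0"
      unfolding L2_inner_diff[OF l \<phi>] by simp
  qed
  then show ?thesis by eventually_elim simp
qed

lemma has_weak_deriv_weak_deriv: "has_weak_deriv k w g \<Longrightarrow> has_weak_deriv k w (weak_deriv k w)"
  unfolding weak_deriv_def by (rule someI[where P="has_weak_deriv k w"])

lemma weak_deriv_AE: "has_weak_deriv k w g \<Longrightarrow> AE x in unit_ivl. g x = weak_deriv k w x"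
  by (metis has_weak_deriv_unique has_weak_deriv_weak_deriv)

lemma L2_norm_weak_deriv:
  assumes "has_weak_deriv k w g" "g \<in> L2"
  shows "weak_deriv k w \<in> L2" "L2_norm (weak_deriv k w) = L2_norm g"
  using assms weak_deriv_AE L2_AE_cong L2_norm_AE_cong by blast+

lemma has_weak_deriv_0: "loc_integrable w \<Longrightarrow> has_weak_deriv 0 w w"
  by (simp add: has_weak_deriv_def)

lemma has_weak_deriv_Suc_iff:
  assumes "has_weak_deriv j w g"
  shows "has_weak_deriv (Suc j) w h \<longleftrightarrow> has_weak_deriv 1 g h"
proof -
  have "L2_inner w ((deriv ^^ Suc j) \<phi>) = (- 1) ^ j * L2_inner g (deriv \<phi>)" if "\<phi> \<in> test_fun" for \<phi>
    using assms test_fun_deriv[OF that] by (simp add: has_weak_deriv_def funpow_Suc_right del: funpow.simps)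
  moreover have "(- 1) ^ j * (a :: real) = (- 1) ^ Suc j * b \<longleftrightarrow> a = - b" for a b
    by (cases "even j") auto
  ultimately show ?thesis
    using assms by (auto simp: has_weak_deriv_def)
qed

definition prim :: "(real \<Rightarrow> real) \<Rightarrow> real \<Rightarrow> real" where
  "prim h x = (\<integral>t. indicator {..<x} t * h t \<partial>unit_ivl)"

lemma prim_bound:
  assumes "integrable unit_ivl h" shows "\<bar>prim h x\<bar> \<le> (\<integral>t. \<bar>h t\<bar> \<partial>unit_ivl)"
proof -
  have "\<bar>prim h x\<bar> \<le> (\<integral>t. \<bar>indicator {..<x} t * h t\<bar> \<partial>unit_ivl)"
    unfolding prim_def by (rule integral_abs_bound)
  also have "\<dots> \<le> (\<integral>t. \<bar>h t\<bar> \<partial>unit_ivl)"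
  proof (rule integral_mono)
    have "integrable unit_ivl (\<lambda>t. h t * indicator {..<x} t)"
      by (rule integrable_unit_mult_bounded[OF assms indicator_unit, of _ 1]) (auto simp: indicator_def)
    then show "integrable unit_ivl (\<lambda>t. \<bar>indicator {..<x} t * h t\<bar>)" by (simp add: mult.commute)
  qed (use assms in \<open>auto simp: indicator_def\<close>)
  finally show ?thesis .
qed

lemma prim_measurable:
  assumes "integrable unit_ivl h" shows "prim h \<in> borel_measurable unit_ivl"
proof -
  note [measurable] = measurable_id_unit
  have [measurable]: "h \<in> borel_measurable unit_ivl" using assms by auto
  have [measurable]: "(\<lambda>p. indicator {..<fst p} (snd p) :: real) \<in> borel_measurable (unit_ivl \<Otimes>\<^sub>M unit_ivl)"
  proof -
    have "Measurable.pred (unit_ivl \<Otimes>\<^sub>M unit_ivl) (\<lambda>p. snd p < fst p)" by measurable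
    then show ?thesis by (simp add: indicator_def of_bool_def)
  qed
  show ?thesis unfolding prim_def
    by (rule U.borel_measurable_lebesgue_integral) (simp add: split_beta')
qed

lemma integral_tail_deriv:
  assumes c: "continuous_on {0..1} \<rho>'"
    and d: "\<And>x. x \<in> {0..1} \<Longrightarrow> (\<rho> has_vector_derivative \<rho>' x) (at x within {0..1})"
    and x: "x \<in> {0..<1}"
  shows "(\<integral>t. indicator {x<..} t * \<rho>' t \<partial>unit_ivl) = \<rho> 1 - (\<rho> x :: real)"
proof -
  have "(\<lambda>t. indicator {x..1} t *\<^sub>R \<rho>' t) \<in> borel_measurable borel"
    by (rule borel_measurable_continuous_on_indicator) (use x in \<open>auto intro: continuous_on_subset[OF c]\<close>)
  then have m: "(\<lambda>t. indicator {x..1} t *\<^sub>R \<rho>' t) \<in> borel_measurable lborel" by simp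
  have "(\<integral>t. indicator {x<..} t * \<rho>' t \<partial>unit_ivl) = (\<integral>t. indicator {x..1} t *\<^sub>R \<rho>' t \<partial>lebesgue)"
    unfolding integral_unit_eq set_lebesgue_integral_def
  proof (rule integral_cong_AE)
    have "AE t in lebesgue. t \<notin> {x, 1}" by (intro AE_not_in) (simp add: finite_imp_null_set_lborel null_sets_completionI)
    then show "AE t in lebesgue. indicator {0<..<1} t *\<^sub>R (indicator {x<..} t * \<rho>' t) = indicator {x..1} t *\<^sub>R \<rho>' t"
      by eventually_elim (use x in \<open>auto simp: indicator_def\<close>)
    have "(\<lambda>t. indicator {x<..<1} t *\<^sub>R (indicator {x..1} t *\<^sub>R \<rho>' t)) \<in> borel_measurable lebesgue"
      by (intro borel_measurable_scaleR[OF _ measurable_completion[OF m]] borel_measurable_indicator) simp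
    moreover have "(\<lambda>t. indicator {x<..<1} t *\<^sub>R (indicator {x..1} t *\<^sub>R \<rho>' t)) =
        (\<lambda>t. indicator {0<..<1} t *\<^sub>R (indicator {x<..} t * \<rho>' t))"
      using x by (auto simp: indicator_def)
    ultimately show "(\<lambda>t. indicator {0<..<1} t *\<^sub>R (indicator {x<..} t * \<rho>' t)) \<in> borel_measurable lebesgue"
      by (simp only:)
    show "(\<lambda>t. indicator {x..1} t *\<^sub>R \<rho>' t) \<in> borel_measurable lebesgue"
      using measurable_completion[OF m] .
  qed
  also have "\<dots> = (\<integral>t. indicator {x..1} t *\<^sub>R \<rho>' t \<partial>lborel)" by (rule integral_completion[OF m])
  also have "\<dots> = \<rho> 1 - \<rho> x"
  proof (rule integral_FTC_atLeastAtMost)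
    show "(\<rho> has_vector_derivative \<rho>' t) (at t within {x..1})" if "x \<le> t" "t \<le> 1" for t
      using that x by (intro has_vector_derivative_within_subset[OF d]) auto
    show "continuous_on {x..1} \<rho>'" using x by (auto intro: continuous_on_subset[OF c])
  qed (use x in auto)
  finally show ?thesis .
qed

text \<open>
  Fubini's theorem on the triangle \<open>t < x\<close>. Besides test functions, \<open>\<rho>\<close> can be the product of a test
  function with a coefficient of finite smoothness.
\<close>

lemma integral_prim_by_parts:
  assumes h: "integrable unit_ivl h"
    and c: "continuous_on {0..1} \<rho>'"
    and d: "\<And>x. x \<in> {0..1} \<Longrightarrow> (\<rho> has_vector_derivative \<rho>' x) (at x within {0..1})"
    and 1: "\<rho> 1 = 0"
  shows "(\<integral>x. prim h x * \<rho>' x \<partial>unit_ivl) = - (\<integral>x. h x * \<rho> x \<partial>unit_ivl)"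
proof -
  note [measurable] = measurable_id_unit
  have [measurable]: "h \<in> borel_measurable unit_ivl" using h by auto
  have [measurable]: "\<rho>' \<in> borel_measurable unit_ivl" by (rule continuous_unit[OF c])
  obtain B where B: "0 \<le> B" "\<And>x. x \<in> {0..1} \<Longrightarrow> \<bar>\<rho>' x\<bar> \<le> B"
    using continuous_unit(2)[OF c] by auto
  have [measurable]: "Measurable.pred (unit_ivl \<Otimes>\<^sub>M unit_ivl) (\<lambda>p. snd p < fst p)" by measurable
  have ind: "indicator {..<x} t = (if t < x then 1 else 0::real)" for x t :: real by auto
  let ?F = "\<lambda>x t. indicator {..<x} t * h t * \<rho>' x"
  have meas: "case_prod ?F \<in> borel_measurable (unit_ivl \<Otimes>\<^sub>M unit_ivl)"
    unfolding split_beta' ind by measurable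
  have i1: "integrable unit_ivl (\<lambda>t. ?F x t)" if "x \<in> {0<..<1}" for x
  proof -
    have "integrable unit_ivl (\<lambda>t. h t * (indicator {..<x} t * \<rho>' x))"
      by (rule integrable_unit_mult_bounded[OF h borel_measurable_times[OF indicator_unit borel_measurable_const], of _ _ B])
        (use B that in \<open>auto simp: indicator_def\<close>)
    then show ?thesis by (simp add: mult_ac)
  qed
  have int: "integrable (unit_ivl \<Otimes>\<^sub>M unit_ivl) (case_prod ?F)"
  proof (rule UU.Fubini_integrable[OF meas])
    show "AE x in unit_ivl. integrable unit_ivl (\<lambda>t. case_prod ?F (x, t))"
      using i1 by (intro AE_I2) simp
    show "integrable unit_ivl (\<lambda>x. \<integral>t. norm (case_prod ?F (x, t)) \<partial>unit_ivl)"
    proof (rule Bochner_Integration.integrable_bound)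
      show "integrable unit_ivl (\<lambda>x. B * (\<integral>t. \<bar>h t\<bar> \<partial>unit_ivl))" by (rule U.integrable_const)
      show "(\<lambda>x. \<integral>t. norm (case_prod ?F (x, t)) \<partial>unit_ivl) \<in> borel_measurable unit_ivl"
        using meas by measurable
      show "AE x in unit_ivl. norm (\<integral>t. norm (case_prod ?F (x, t)) \<partial>unit_ivl) \<le> norm (B * (\<integral>t. \<bar>h t\<bar> \<partial>unit_ivl))"
      proof (rule AE_I2)
        fix x assume x: "x \<in> space unit_ivl"
        have "(\<integral>t. \<bar>?F x t\<bar> \<partial>unit_ivl) \<le> (\<integral>t. B * \<bar>h t\<bar> \<partial>unit_ivl)"
        proof (rule integral_mono)
          show "\<bar>?F x t\<bar> \<le> B * \<bar>h t\<bar>" for t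
            using B x by (auto simp: indicator_def abs_mult mult.commute[of "\<bar>h t\<bar>"] intro!: mult_right_mono)
        qed (use i1 h x in auto)
        then show "norm (\<integral>t. norm (case_prod ?F (x, t)) \<partial>unit_ivl) \<le> norm (B * (\<integral>t. \<bar>h t\<bar> \<partial>unit_ivl))"
          using B by simp
      qed
    qed
  qed
  have "(\<integral>x. prim h x * \<rho>' x \<partial>unit_ivl) = (\<integral>x. (\<integral>t. ?F x t \<partial>unit_ivl) \<partial>unit_ivl)"
    by (simp add: prim_def)
  also have "\<dots> = (\<integral>t. (\<integral>x. ?F x t \<partial>unit_ivl) \<partial>unit_ivl)"
    using UU.Fubini_integral[OF int] by simp
  also have "\<dots> = (\<integral>t. h t * - \<rho> t \<partial>unit_ivl)"
  proof (rule Bochner_Integration.integral_cong[OF refl])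
    fix t assume t: "t \<in> space unit_ivl"
    have "(\<integral>x. ?F x t \<partial>unit_ivl) = (\<integral>x. h t * (indicator {t<..} x * \<rho>' x) \<partial>unit_ivl)"
      by (rule Bochner_Integration.integral_cong) (auto simp: indicator_def)
    also have "\<dots> = h t * (\<rho> 1 - \<rho> t)"
      by (subst integral_mult_right_zero, subst integral_tail_deriv[OF c d]) (use t in auto)
    finally show "(\<integral>x. ?F x t \<partial>unit_ivl) = h t * - \<rho> t" using 1 by simp
  qed
  finally show ?thesis by simp
qed

lemma test_fun_vector_derivative:
  "\<phi> \<in> test_fun \<Longrightarrow> (\<phi> has_vector_derivative deriv \<phi> x) (at x within S)"
  using test_fun_DERIV has_vector_derivative_at_within has_real_derivative_iff_has_vector_derivative by blast

lemma integral_deriv_test_fun: "\<phi> \<in> test_fun \<Longrightarrow> (\<integral>x. deriv \<phi> x \<partial>unit_ivl) = 0"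
proof -
  assume \<phi>: "\<phi> \<in> test_fun"
  have "(\<integral>x. indicator {0<..} x * deriv \<phi> x \<partial>unit_ivl) = \<phi> 1 - \<phi> 0"
    by (rule integral_tail_deriv) (use \<phi> in \<open>auto intro: test_fun_cont test_fun_deriv test_fun_vector_derivative\<close>)
  moreover have "(\<integral>x. indicator {0<..} x * deriv \<phi> x \<partial>unit_ivl) = (\<integral>x. deriv \<phi> x \<partial>unit_ivl)"
    by (rule Bochner_Integration.integral_cong) (auto simp: indicator_def)
  ultimately show ?thesis using test_fun_zero[OF \<phi>, of 1] test_fun_zero[OF \<phi>, of 0] by simp
qed

lemma test_fun_integrable: "\<phi> \<in> test_fun \<Longrightarrow> integrable unit_ivl \<phi>"
  using integrable_test_fun_mult[OF loc_integrable_unit[of "\<lambda>_. 1"]] U.integrable_const by simp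

lemma integrable_prim: "integrable unit_ivl h \<Longrightarrow> integrable unit_ivl (prim h)"
  by (rule Bochner_Integration.integrable_bound[where f="\<lambda>_. \<integral>t. \<bar>h t\<bar> \<partial>unit_ivl"])
    (auto intro: prim_measurable order_trans[OF prim_bound])

lemma has_weak_deriv_prim:
  assumes "integrable unit_ivl h" shows "has_weak_deriv 1 (\<lambda>x. c + prim h x) h"
  unfolding has_weak_deriv_def
proof (intro conjI ballI)
  show "loc_integrable (\<lambda>x. c + prim h x)" using integrable_prim[OF assms] by (intro loc_integrable_unit) auto
  show "loc_integrable h" by (rule loc_integrable_unit[OF assms])
  fix \<phi> assume \<phi>: "\<phi> \<in> test_fun"
  have "L2_inner (\<lambda>x. c + prim h x) (deriv \<phi>) = (\<integral>x. c * deriv \<phi> x + prim h x * deriv \<phi> x \<partial>unit_ivl)"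
    unfolding L2_inner_def by (rule Bochner_Integration.integral_cong) (auto simp: algebra_simps)
  also have "\<dots> = (\<integral>x. prim h x * deriv \<phi> x \<partial>unit_ivl)"
    using integral_deriv_test_fun[OF \<phi>] test_fun_integrable[OF test_fun_deriv[OF \<phi>]]
      integrable_test_fun_mult[OF loc_integrable_unit[OF integrable_prim[OF assms]] test_fun_deriv[OF \<phi>]]
    by simp
  also have "\<dots> = - (\<integral>x. h x * \<phi> x \<partial>unit_ivl)"
    by (rule integral_prim_by_parts[OF assms])
      (use \<phi> in \<open>auto intro: test_fun_cont test_fun_deriv test_fun_vector_derivative test_fun_zero\<close>)
  finally show "L2_inner (\<lambda>x. c + prim h x) ((deriv ^^ 1) \<phi>) = (- 1) ^ 1 * L2_inner h \<phi>"
    by (simp add: L2_inner_def)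
qed

lemma test_fun_primitive:
  assumes \<phi>: "\<phi> \<in> test_fun" and 0: "(\<integral>x. \<phi> x \<partial>unit_ivl) = 0"
  obtains \<xi> where "\<xi> \<in> test_fun" "deriv \<xi> = \<phi>"
proof -
  obtain a b where ab: "0 < a" "a < b" "b < 1" "\<And>x. x \<notin> {a..b} \<Longrightarrow> \<phi> x = 0"
    using test_fun_supp[OF \<phi>] by blast
  obtain F where "\<And>x::real. x \<in> {-1..2} \<Longrightarrow> (F has_vector_derivative \<phi> x) (at x within {-1..2})"
    using antiderivative_continuous[OF test_fun_cont[OF \<phi>, of "{-1..2}"]] by blast
  then have F: "(F has_real_derivative \<phi> x) (at x)" if "x \<in> {-1<..<2}" for x
    using that at_within_Icc_at[of "-1" x 2] unfolding has_real_derivative_iff_has_vector_derivative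
    by (metis atLeastAtMost_iff greaterThanLessThan_iff less_eq_real_def)
  have const: "F y = F x" if z: "\<And>t. x < t \<Longrightarrow> t < y \<Longrightarrow> \<phi> t = 0" and xy: "-1 < x" "x < y" "y < 2" for x y
  proof (rule DERIV_isconst_end[where f=F, OF xy(2)])
    show "continuous_on {x..y} F"
      by (rule DERIV_continuous_on[where D=\<phi>], rule has_field_derivative_at_within, rule F) (use xy in auto)
    show "(F has_real_derivative 0) (at t)" if "x < t" "t < y" for t
      using F[of t] z[of t] that xy by simp
  qed
  have "(\<integral>x. indicator {0<..} x * \<phi> x \<partial>unit_ivl) = F 1 - F 0"
    by (rule integral_tail_deriv[OF test_fun_cont[OF \<phi>]])
      (auto simp: has_real_derivative_iff_has_vector_derivative[symmetric] intro!: has_field_derivative_at_within F)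
  moreover have "(\<integral>x. indicator {0<..} x * \<phi> x \<partial>unit_ivl) = (\<integral>x. \<phi> x \<partial>unit_ivl)"
    by (rule Bochner_Integration.integral_cong) (auto simp: indicator_def)
  ultimately have 01: "F 1 = F 0" using 0 by simp
  \<comment> \<open>The antiderivative \<open>F\<close> is only available on an interval, outside of which it is continued by 0.\<close>
  define \<xi> where "\<xi> x = (if x \<in> {-1<..<2} then F x - F 0 else 0)" for x
  have out: "\<xi> x = 0" if x: "x \<notin> {a..b}" for x
  proof (cases "x \<in> {-1<..<2}")
    case True
    have "F x = F 0" if "x < a"
      by (cases x "0::real" rule: linorder_cases) (use const[of x 0] const[of 0 x] True ab that in force)+
    moreover have "F x = F 1" if "b < x"
      by (cases x "1::real" rule: linorder_cases) (use const[of x 1] const[of 1 x] True ab that in force)+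
    ultimately show ?thesis using x True 01 by (auto simp: \<xi>_def)
  qed (auto simp: \<xi>_def)
  have d: "(\<xi> has_real_derivative \<phi> x) (at x)" for x
  proof (cases "x \<in> {-1<..<2}")
    case True
    have "((\<lambda>x. F x - F 0) has_real_derivative \<phi> x) (at x)"
      using DERIV_diff[OF F[OF True] DERIV_const] by simp
    then show ?thesis
      by (rule has_field_derivative_transform_within_open[where S="{-1<..<2}"]) (use True in \<open>auto simp: \<xi>_def\<close>)
  next
    case False
    have x: "x \<notin> {a..b}" using False ab(1,3) by auto
    have "((\<lambda>_. 0) has_real_derivative \<phi> x) (at x)" by (simp add: ab(4)[OF x])
    then show ?thesis
      by (rule has_field_derivative_transform_within_open[where S="- {a..b}"]) (use x out in auto)
  qed
  then have "deriv \<xi> = \<phi>" by (intro ext DERIV_imp_deriv)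
  moreover have "\<xi> \<in> test_fun"
    by (rule test_funI[OF _ ab(1,3) out], rule ndiff_mono, rule ndiff_SucI[OF d]) (use \<phi> in \<open>simp add: test_fun_iff\<close>)
  ultimately show ?thesis by (rule that[rotated])
qed

text \<open>
  A test function of integral \<open>s\<close> differs from \<open>s\<close> times a fixed test function of integral 1 by the
  derivative of a test function; hence \<open>w\<close> acts on test functions like a constant.
\<close>

lemma weak_deriv_zero_const:
  assumes "has_weak_deriv 1 w (\<lambda>_. 0)"
  obtains c where "AE x in unit_ivl. w x = c"
proof -
  have w: "loc_integrable w" using assms by (simp add: has_weak_deriv_def)
  obtain \<phi> :: "nat \<Rightarrow> real \<Rightarrow> real" where \<phi>: "\<And>n. \<phi> n \<in> test_fun" "\<And>n x. 0 \<le> \<phi> n x"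
    "\<And>n x. \<phi> n x \<le> indicator {1/3<..<2/3} x" "\<And>x. (\<lambda>n. \<phi> n x) \<longlonglongrightarrow> indicator {1/3<..<2/3} x"
    by (rule test_fun_approx_interval[of "1/3" "2/3"]) auto
  have "\<exists>n. (\<integral>x. \<phi> n x \<partial>unit_ivl) \<noteq> 0"
  proof (rule ccontr)
    assume "\<nexists>n. (\<integral>x. \<phi> n x \<partial>unit_ivl) \<noteq> 0"
    then have z: "AE x in unit_ivl. \<phi> n x = 0" for n
      using \<phi>(2)[of n] test_fun_integrable[OF \<phi>(1)[of n]] by (subst integral_nonneg_eq_0_iff_AE[symmetric]) auto
    have "AE x in unit_ivl. \<forall>n. \<phi> n x = 0" unfolding AE_all_countable using z by simp
    then have "AE x in unit_ivl. x \<notin> {1/3<..<2/3}"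
    proof eventually_elim
      case (elim x)
      then have "(\<lambda>n. \<phi> n x) \<longlonglongrightarrow> 0" by simp
      then have "indicator {1/3<..<2/3} x = (0::real)" by (rule LIMSEQ_unique[OF \<phi>(4)])
      then show ?case by (simp add: indicator_def)
    qed
    then have "AE x in lebesgue. x \<notin> {1/3<..<2/3::real}"
      unfolding AE_unit_iff by eventually_elim auto
    then have "{1/3<..<2/3::real} \<in> null_sets lebesgue"
      by (subst AE_iff_null_sets) auto
    then show False by (auto simp: null_sets_def)
  qed
  then obtain n where n: "(\<integral>x. \<phi> n x \<partial>unit_ivl) \<noteq> 0" ..
  define s where "s = (\<integral>x. \<phi> n x \<partial>unit_ivl)"
  define c where "c = L2_inner w (\<phi> n) / s"
  have "AE x in unit_ivl. w x - c = 0"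
  proof (rule fundamental_lemma)
    have 1: "loc_integrable (\<lambda>_. c)" by (rule loc_integrable_unit) (rule U.integrable_const)
    show "loc_integrable (\<lambda>x. w x - c)" by (rule loc_integrable_diff[OF w 1])
    fix \<psi> assume \<psi>: "\<psi> \<in> test_fun"
    define r where "r = (\<integral>x. \<psi> x \<partial>unit_ivl)"
    have t: "(\<lambda>x. 1 * \<psi> x + (- r / s) * \<phi> n x) \<in> test_fun" by (rule test_fun_lincomb[OF \<psi> \<phi>(1)])
    have "(\<integral>x. 1 * \<psi> x + (- r / s) * \<phi> n x \<partial>unit_ivl) = r + (- r / s) * s"
      using test_fun_integrable[OF \<psi>] test_fun_integrable[OF \<phi>(1)[of n]] by (simp add: r_def s_def)
    also have "\<dots> = 0" using n by (simp add: s_def)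
    finally obtain \<xi> where \<xi>: "\<xi> \<in> test_fun" "deriv \<xi> = (\<lambda>x. 1 * \<psi> x + (- r / s) * \<phi> n x)"
      using test_fun_primitive[OF t] by blast
    have "L2_inner w (deriv \<xi>) = 0"
      using assms \<xi>(1) by (auto simp: has_weak_deriv_def L2_inner_def)
    moreover have "L2_inner w (deriv \<xi>) = L2_inner w \<psi> - r / s * L2_inner w (\<phi> n)"
    proof -
      have "L2_inner w (deriv \<xi>) = (\<integral>x. w x * \<psi> x - r / s * (w x * \<phi> n x) \<partial>unit_ivl)"
        unfolding L2_inner_def \<xi>(2) by (rule Bochner_Integration.integral_cong) (auto simp: algebra_simps)
      then show ?thesis
        using integrable_test_fun_mult[OF w \<psi>] integrable_test_fun_mult[OF w \<phi>(1)[of n]]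
        by (simp add: L2_inner_def)
    qed
    ultimately have "L2_inner w \<psi> = r * c" by (simp add: c_def)
    moreover have "L2_inner (\<lambda>_. c) \<psi> = c * r" by (simp add: L2_inner_def r_def)
    ultimately show "L2_inner (\<lambda>x. w x - c) \<psi> = 0" by (subst L2_inner_diff[OF w 1 \<psi>]) simp
  qed
  then have "AE x in unit_ivl. w x = c" by eventually_elim simp
  then show ?thesis by (rule that)
qed

theorem du_Bois_Reymond:
  assumes "has_weak_deriv 1 w h" "integrable unit_ivl h"
  obtains c where "AE x in unit_ivl. w x = c + prim h x"
proof -
  have w: "loc_integrable w" "loc_integrable h" using assms by (auto simp: has_weak_deriv_def)
  have p: "has_weak_deriv 1 (\<lambda>x. 0 + prim h x) h" by (rule has_weak_deriv_prim[OF assms(2)])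
  then have lp: "loc_integrable (prim h)" by (simp add: has_weak_deriv_def)
  have "has_weak_deriv 1 (\<lambda>x. w x - prim h x) (\<lambda>_. 0)"
    unfolding has_weak_deriv_def
  proof (intro conjI ballI)
    show "loc_integrable (\<lambda>x. w x - prim h x)" by (rule loc_integrable_diff[OF w(1) lp])
    show "loc_integrable (\<lambda>_. 0)" by (simp add: loc_integrable_def set_integrable_def)
    fix \<phi> assume \<phi>: "\<phi> \<in> test_fun"
    have "L2_inner w (deriv \<phi>) = L2_inner (prim h) (deriv \<phi>)"
      using assms(1) p \<phi> by (simp add: has_weak_deriv_def)
    then show "L2_inner (\<lambda>x. w x - prim h x) ((deriv ^^ 1) \<phi>) = (- 1) ^ 1 * L2_inner (\<lambda>_. 0) \<phi>"
      using L2_inner_diff[OF w(1) lp test_fun_deriv[OF \<phi>]] by (simp add: L2_inner_def)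
  qed
  then obtain c where "AE x in unit_ivl. w x - prim h x = c" by (rule weak_deriv_zero_const)
  then have "AE x in unit_ivl. w x = c + prim h x" by eventually_elim simp
  then show ?thesis by (rule that)
qed

section \<open>An explicit solution of the generalised Abel equation\<close>

lemma nn_integral_Beta:
  assumes "0 < a" "0 < b"
  shows "(\<integral>\<^sup>+t. ennreal (t powr (a - 1) * (1 - t) powr (b - 1)) * indicator {0..1} t \<partial>lborel) = ennreal (Beta a b)"
  by (rule nn_integral_has_integral_lebesgue'[OF _ has_integral_Beta_real]) (use assms in auto)

lemma Beta_pos: "0 < a \<Longrightarrow> 0 < b \<Longrightarrow> 0 < Beta a (b::real)"
  by (simp add: Beta_def)

lemma continuous_on_Gamma_pos:
  assumes "continuous_on A f" "\<And>x. x \<in> A \<Longrightarrow> 0 < f x"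
  shows "continuous_on A (\<lambda>x. Gamma (f x :: real))"
proof (rule continuous_on_compose2[OF _ assms(1)])
  show "continuous_on {0<..} (Gamma :: real \<Rightarrow> real)"
    by (rule continuous_on_Gamma) (auto dest: nonpos_Ints_nonpos)
qed (use assms in auto)

lemma one_minus_mult_pos:
  assumes "0 \<le> z" "z < 1" "0 \<le> t" "t \<le> (1::real)" shows "0 < 1 - z * t"
  using mult_left_mono[of t 1 z] assms by simp

lemma powr_quotient: "0 \<le> x \<Longrightarrow> 0 < d \<Longrightarrow> (x / d) powr r = x powr r * d powr (- r)" for x d r :: real
  using powr_divide[of x d r] by (simp add: powr_minus_divide)

lemma nn_integral_reflect:
  fixes f :: "real \<Rightarrow> ennreal"
  assumes [measurable]: "f \<in> borel_measurable borel"
  shows "(\<integral>\<^sup>+s. f s * indicator {a..b} s \<partial>lborel) = (\<integral>\<^sup>+s. f (1 - s) * indicator {1 - b..1 - a} s \<partial>lborel)"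
proof -
  have "(\<integral>\<^sup>+s. f s * indicator {a..b} s \<partial>lborel) = (\<integral>\<^sup>+s. f (1 + (-1) * s) * indicator {a..b} (1 + (-1) * s) \<partial>lborel)"
    by (subst nn_integral_real_affine[where c="-1" and t=1]) auto
  also have "\<dots> = (\<integral>\<^sup>+s. f (1 - s) * indicator {1 - b..1 - a} s \<partial>lborel)"
    by (rule nn_integral_cong) (auto simp: indicator_def)
  finally show ?thesis .
qed

lemma AE_lborel_notin_pair: "AE x in lborel. x \<noteq> a \<and> x \<noteq> (b::real)"
  using AE_lborel_singleton[of a] AE_lborel_singleton[of b] by eventually_elim auto

text \<open>
  The Moebius map \<open>t \<mapsto> t (1 - z) / (1 - z t)\<close> maps the unit interval onto itself and turns the
  Beta integral into this one.
\<close>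

lemma nn_integral_Euler_Beta:
  assumes a: "0 < a" and b: "0 < b" and z: "0 < z" "z < 1"
  shows "(\<integral>\<^sup>+t. ennreal (t powr (a - 1) * (1 - t) powr (b - 1) * (1 - z * t) powr (- (a + b))) * indicator {0..1} t \<partial>lborel)
    = ennreal (Beta a b * (1 - z) powr (- a))" (is "?I = _")
proof -
  let ?f = "\<lambda>t. t powr (a - 1) * (1 - t) powr (b - 1)"
  let ?g = "\<lambda>t. t * (1 - z) / (1 - z * t)"
  let ?g' = "\<lambda>t. (1 - z) / (1 - z * t)\<^sup>2"
  have pos: "0 < 1 - z * t" if "t \<in> {0..1}" for t
    using that z by (intro one_minus_mult_pos) auto
  have "(\<integral>\<^sup>+x. ?f x * indicator {?g 0..?g 1} x \<partial>lborel) = (\<integral>\<^sup>+t. ?f (?g t) * ?g' t * indicator {0..1} t \<partial>lborel)"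
  proof (rule nn_integral_substitution)
    show "set_borel_measurable borel {?g 0..?g 1} ?f" by (simp add: set_borel_measurable_def)
    show "(?g has_real_derivative ?g' t) (at t)" if "t \<in> {0..1}" for t
      using pos[OF that] by (auto intro!: derivative_eq_intros simp: power2_eq_square field_simps)
    show "continuous_on {0..1} ?g'"
      by (intro continuous_intros) (use pos in force)
    show "0 \<le> ?g' t" if "t \<in> {0..1}" for t using z by simp
  qed simp
  also have "\<dots> = (\<integral>\<^sup>+t. ennreal (t powr (a - 1) * (1 - t) powr (b - 1) * (1 - z * t) powr (- (a + b)) * (1 - z) powr a) * indicator {0..1} t \<partial>lborel)"
  proof (rule nn_integral_cong_AE)
    have "AE t in lborel. t \<noteq> 0 \<and> t \<noteq> (1::real)" by (rule AE_lborel_notin_pair)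
    then show "AE t in lborel. ennreal (?f (?g t) * ?g' t * indicator {0..1} t) =
       ennreal (t powr (a - 1) * (1 - t) powr (b - 1) * (1 - z * t) powr (- (a + b)) * (1 - z) powr a) * indicator {0..1} t"
    proof eventually_elim
      case (elim t)
      show ?case
      proof (cases "t \<in> {0<..<1}")
        case True
        define D where "D = 1 - z * t"
        have D: "0 < D" unfolding D_def using pos True by auto
        have g: "1 - t * (1 - z) / (1 - z * t) = (1 - t) / (1 - z * t)"
          using D unfolding D_def by (simp add: field_simps)
        have "?f (?g t) * ?g' t = (t * (1 - z) / D) powr (a - 1) * ((1 - t) / D) powr (b - 1) * ((1 - z) / D\<^sup>2)"
          by (simp only: g) (simp only: D_def)
        also have "\<dots> = t powr (a - 1) * (1 - z) powr (a - 1) * D powr (- (a - 1)) * ((1 - t) powr (b - 1) * D powr (- (b - 1))) * ((1 - z) powr 1 * D powr (- 2))"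
        proof -
          have "(1 - z) / D\<^sup>2 = (1 - z) powr 1 * D powr (- 2)"
            using z D by (simp add: powr_minus powr_numeral divide_inverse)
          then show ?thesis using True z D by (simp only: powr_quotient powr_mult) (simp add: powr_quotient powr_mult)
        qed
        also have "\<dots> = t powr (a - 1) * (1 - t) powr (b - 1) * (D powr (- (a - 1)) * D powr (- (b - 1)) * D powr (- 2)) * ((1 - z) powr (a - 1) * (1 - z) powr 1)"
          by (simp add: mult_ac)
        also have "D powr (- (a - 1)) * D powr (- (b - 1)) * D powr (- 2) = D powr (- (a + b))"
          by (simp add: powr_add[symmetric])
        also have "(1 - z) powr (a - 1) * (1 - z) powr 1 = (1 - z) powr a"
          by (simp only: powr_add[symmetric]) simp
        finally show ?thesis using True by (simp add: D_def)
      next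
        case False
        then have "t \<notin> {0..1}" using elim by auto
        then show ?thesis by simp
      qed
    qed
  qed
  also have "\<dots> = (\<integral>\<^sup>+t. ennreal ((1 - z) powr a) * (ennreal (t powr (a - 1) * (1 - t) powr (b - 1) * (1 - z * t) powr (- (a + b))) * indicator {0..1} t) \<partial>lborel)"
    by (rule nn_integral_cong) (auto simp: ennreal_mult'[symmetric] indicator_def mult_ac)
  also have "\<dots> = ennreal ((1 - z) powr a) * (\<integral>\<^sup>+t. ennreal (t powr (a - 1) * (1 - t) powr (b - 1) * (1 - z * t) powr (- (a + b))) * indicator {0..1} t \<partial>lborel)"
    by (rule nn_integral_cmult) measurable
  finally have *: "ennreal ((1 - z) powr a) * (\<integral>\<^sup>+t. ennreal (t powr (a - 1) * (1 - t) powr (b - 1) * (1 - z * t) powr (- (a + b))) * indicator {0..1} t \<partial>lborel)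
      = (\<integral>\<^sup>+x. ?f x * indicator {?g 0..?g 1} x \<partial>lborel)" by simp
  also have "\<dots> = (\<integral>\<^sup>+x. ennreal (?f x) * indicator {0..1} x \<partial>lborel)"
    using z by (intro nn_integral_cong) (auto simp: indicator_def)
  also have "\<dots> = ennreal (Beta a b)" by (rule nn_integral_Beta[OF a b])
  finally have 1: "ennreal ((1 - z) powr a) * ?I = ennreal (Beta a b)" .
  have "?I = (ennreal ((1 - z) powr (-a)) * ennreal ((1 - z) powr a)) * ?I"
    using z by (simp add: ennreal_mult'[symmetric] powr_add[symmetric])
  also have "\<dots> = ennreal ((1 - z) powr (-a)) * ennreal (Beta a b)"
    by (simp only: 1 mult.assoc[of _ _ ?I])
  also have "\<dots> = ennreal (Beta a b * (1 - z) powr (- a))"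
    by (subst ennreal_mult'[symmetric]) (simp_all add: mult.commute)
  finally show ?thesis .
qed

definition left_abel :: "real \<Rightarrow> real \<Rightarrow> real \<Rightarrow> real \<Rightarrow> ennreal" where
  "left_abel \<beta> p q x = (\<integral>\<^sup>+s. ennreal ((x - s) powr (\<beta> - 1) * (s powr (- p) * (1 - s) powr (- q))) * indicator {0..x} s \<partial>lborel)"

text \<open>
  The substitution \<open>s = x t\<close> confines the dependence on \<open>x\<close> to one smooth factor.
\<close>

lemma left_abel_scaled:
  assumes pq: "p + q = \<beta>" and x: "0 < x" "x < 1"
  shows "left_abel \<beta> p q x = (\<integral>\<^sup>+t. ennreal (t powr (- p) * (1 - t) powr (\<beta> - 1) * (x / (1 - x * t)) powr q) * indicator {0..1} t \<partial>lborel)"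
proof -
  have "left_abel \<beta> p q x = (\<integral>\<^sup>+s. ennreal (((x - s) powr (\<beta> - 1) * (s powr (- p) * (1 - s) powr (- q))) * indicator {x * 0..x * 1} s) \<partial>lborel)"
    unfolding left_abel_def by (rule nn_integral_cong) (auto simp: indicator_def)
  also have "\<dots> = (\<integral>\<^sup>+t. ennreal (((x - x * t) powr (\<beta> - 1) * ((x * t) powr (- p) * (1 - x * t) powr (- q))) * x * indicator {0..1} t) \<partial>lborel)"
    by (rule nn_integral_substitution[where g="\<lambda>t. x * t"])
      (use x in \<open>auto intro!: derivative_eq_intros simp: set_borel_measurable_def\<close>)
  also have "\<dots> = (\<integral>\<^sup>+t. ennreal (t powr (- p) * (1 - t) powr (\<beta> - 1) * (x / (1 - x * t)) powr q) * indicator {0..1} t \<partial>lborel)"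
  proof (rule nn_integral_cong)
    fix t :: real
    show "ennreal (((x - x * t) powr (\<beta> - 1) * ((x * t) powr (- p) * (1 - x * t) powr (- q))) * x * indicator {0..1} t) =
      ennreal (t powr (- p) * (1 - t) powr (\<beta> - 1) * (x / (1 - x * t)) powr q) * indicator {0..1} t"
    proof (cases "t \<in> {0..1}")
      case True
      have d: "0 < 1 - x * t" using True x by (intro one_minus_mult_pos) auto
      have e1: "(x - x * t) powr (\<beta> - 1) = x powr (\<beta> - 1) * (1 - t) powr (\<beta> - 1)"
        using True x by (simp add: powr_mult[symmetric] right_diff_distrib)
      have e2: "(x * t) powr (- p) = x powr (- p) * t powr (- p)"
        using True x by (simp add: powr_mult)
      have e3: "(x / (1 - x * t)) powr q = x powr q * (1 - x * t) powr (- q)"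
        using x d by (simp add: powr_quotient)
      have e4: "x powr (\<beta> - 1) * x powr (- p) * x = x powr q"
      proof -
        have "x powr (\<beta> - 1) * x powr (- p) * x powr 1 = x powr q"
          unfolding powr_add[symmetric] by (rule arg_cong2[where f="(powr)"]) (use pq in auto)
        then show ?thesis using x by simp
      qed
      have "((x - x * t) powr (\<beta> - 1) * ((x * t) powr (- p) * (1 - x * t) powr (- q))) * x
        = (x powr (\<beta> - 1) * x powr (- p) * x) * (t powr (- p) * (1 - t) powr (\<beta> - 1) * (1 - x * t) powr (- q))"
        unfolding e1 e2 by (simp only: mult_ac)
      also have "\<dots> = t powr (- p) * (1 - t) powr (\<beta> - 1) * (x / (1 - x * t)) powr q"
        unfolding e4 e3 by (simp only: mult_ac)
      finally have "((x - x * t) powr (\<beta> - 1) * ((x * t) powr (- p) * (1 - x * t) powr (- q))) * x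
        = t powr (- p) * (1 - t) powr (\<beta> - 1) * (x / (1 - x * t)) powr q" .
      then show ?thesis using True by simp
    qed simp
  qed
  finally show ?thesis .
qed

text \<open>
  The factor \<open>(x / (1 - x t)) powr q\<close> of the scaled integral is the integral of its derivative over
  \<open>{0..x}\<close>. After exchanging the integrals the inner one is Euler's Beta integral.
\<close>

lemma left_abel_eq:
  assumes \<beta>: "0 < \<beta>" "\<beta> < 1" and pq: "0 < p" "0 < q" "p + q = \<beta>" and x: "0 < x" "x < 1"
  shows "left_abel \<beta> p q x = (\<integral>\<^sup>+z. ennreal (q * Beta (1 - p) \<beta> * (z powr (q - 1) * (1 - z) powr (p - 1))) * indicator {0..x} z \<partial>lborel)"
proof -
  let ?w = "\<lambda>t. t powr (- p) * (1 - t) powr (\<beta> - 1)"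
  let ?h = "\<lambda>t z. q * z powr (q - 1) * (1 - z * t) powr (- (q + 1))"
  have ftc: "(\<integral>\<^sup>+z. ennreal (?h t z) * indicator {0..x} z \<partial>lborel) = ennreal ((x / (1 - x * t)) powr q)"
    if t: "0 \<le> t" "t \<le> 1" for t
  proof -
    have pos: "0 < 1 - z * t" if "z \<in> {0..x}" for z
      using that t x by (intro one_minus_mult_pos) auto
    have "((?h t) has_integral (x / (1 - x * t)) powr q - (0 / (1 - 0 * t)) powr q) {0..x}"
    proof (rule fundamental_theorem_of_calculus_interior)
      show "continuous_on {0..x} (\<lambda>z. (z / (1 - z * t)) powr q)"
        by (intro continuous_on_powr' continuous_intros) (use pos pq in \<open>auto simp: less_imp_neq[symmetric] less_imp_le intro!: divide_nonneg_nonneg\<close>)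
      show "((\<lambda>z. (z / (1 - z * t)) powr q) has_vector_derivative ?h t z) (at z)" if z: "z \<in> {0<..<x}" for z
      proof -
        define D where "D = 1 - z * t"
        have D: "0 < D" using pos z by (auto simp: D_def)
        have "((\<lambda>z. z / (1 - z * t)) has_real_derivative 1 / D\<^sup>2) (at z)"
          using D unfolding D_def by (auto intro!: derivative_eq_intros simp: power2_eq_square field_simps)
        then have "((\<lambda>z. (z / (1 - z * t)) powr q) has_real_derivative q * (z / (1 - z * t)) powr (q - 1) * (1 / D\<^sup>2)) (at z)"
          by (rule DERIV_fun_powr[where r=q, simplified]) (use z D in \<open>auto simp: D_def\<close>)
        moreover have "q * (z / (1 - z * t)) powr (q - 1) * (1 / D\<^sup>2) = ?h t z"
        proof -
          have "(z / D) powr (q - 1) * (1 / D\<^sup>2) = z powr (q - 1) * (D powr (- (q - 1)) * D powr (- 2))"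
            using z D by (simp add: powr_quotient powr_minus_divide powr_numeral)
          also have "D powr (- (q - 1)) * D powr (- 2) = D powr (- (q + 1))"
            unfolding powr_add[symmetric] by (rule arg_cong2[where f="(powr)"]) auto
          finally show ?thesis unfolding D_def[symmetric] mult.assoc by (simp only:)
        qed
        ultimately show ?thesis by (simp add: has_real_derivative_iff_has_vector_derivative)
      qed
    qed (use x in simp)
    then have "((?h t) has_integral (x / (1 - x * t)) powr q) {0..x}" using pq by simp
    then show ?thesis by (intro nn_integral_has_integral_lebesgue') (use pq in auto)
  qed
  have "left_abel \<beta> p q x = (\<integral>\<^sup>+t. ennreal (?w t * (x / (1 - x * t)) powr q) * indicator {0..1} t \<partial>lborel)"
    by (rule left_abel_scaled) (use pq x in auto)
  also have "\<dots> = (\<integral>\<^sup>+t. (\<integral>\<^sup>+z. ennreal (?w t * ?h t z) * indicator {0..1} t * indicator {0..x} z \<partial>lborel) \<partial>lborel)"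
  proof (rule nn_integral_cong)
    fix t :: real
    show "ennreal (?w t * (x / (1 - x * t)) powr q) * indicator {0..1} t =
        (\<integral>\<^sup>+z. ennreal (?w t * ?h t z) * indicator {0..1} t * indicator {0..x} z \<partial>lborel)"
    proof (cases "t \<in> {0..1}")
      case True
      have "(\<integral>\<^sup>+z. ennreal (?w t * ?h t z) * indicator {0..1} t * indicator {0..x} z \<partial>lborel)
        = (\<integral>\<^sup>+z. ennreal (?w t) * (ennreal (?h t z) * indicator {0..x} z) \<partial>lborel)"
        using True by (intro nn_integral_cong) (auto simp: ennreal_mult' indicator_def)
      also have "\<dots> = ennreal (?w t) * ennreal ((x / (1 - x * t)) powr q)"
      proof (subst nn_integral_cmult)
        show "(\<lambda>z. ennreal (?h t z) * indicator {0..x} z) \<in> borel_measurable lborel" by measurable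
        show "ennreal (?w t) * (\<integral>\<^sup>+z. ennreal (?h t z) * indicator {0..x} z \<partial>lborel) = ennreal (?w t) * ennreal ((x / (1 - x * t)) powr q)"
          by (rule arg_cong[OF ftc]) (use True in auto)
      qed
      finally show ?thesis using True by (simp add: ennreal_mult')
    qed simp
  qed
  also have "\<dots> = (\<integral>\<^sup>+z. (\<integral>\<^sup>+t. ennreal (?w t * ?h t z) * indicator {0..1} t * indicator {0..x} z \<partial>lborel) \<partial>lborel)"
    by (rule lborel_pair.Fubini') measurable
  also have "\<dots> = (\<integral>\<^sup>+z. ennreal (q * Beta (1 - p) \<beta> * (z powr (q - 1) * (1 - z) powr (p - 1))) * indicator {0..x} z \<partial>lborel)"
  proof (rule nn_integral_cong_AE)
    have "AE z in lborel. z \<noteq> 0 \<and> z \<noteq> (0::real)" by (rule AE_lborel_notin_pair)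
    then show "AE z in lborel. (\<integral>\<^sup>+t. ennreal (?w t * ?h t z) * indicator {0..1} t * indicator {0..x} z \<partial>lborel)
      = ennreal (q * Beta (1 - p) \<beta> * (z powr (q - 1) * (1 - z) powr (p - 1))) * indicator {0..x} z"
    proof eventually_elim
      case (elim z)
      show ?case
      proof (cases "z \<in> {0..x}")
        case True
        then have z: "0 < z" "z < 1" using elim x by auto
        have "(\<integral>\<^sup>+t. ennreal (?w t * ?h t z) * indicator {0..1} t * indicator {0..x} z \<partial>lborel)
          = (\<integral>\<^sup>+t. ennreal (q * z powr (q - 1)) * (ennreal (t powr (1 - p - 1) * (1 - t) powr (\<beta> - 1) * (1 - z * t) powr (- (1 - p + \<beta>))) * indicator {0..1} t) \<partial>lborel)"
        proof (rule nn_integral_cong)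
          fix t :: real
          have "1 - p - 1 = - p" "- (1 - p + \<beta>) = - (q + 1)" using pq by auto
          then show "ennreal (?w t * ?h t z) * indicator {0..1} t * indicator {0..x} z =
            ennreal (q * z powr (q - 1)) * (ennreal (t powr (1 - p - 1) * (1 - t) powr (\<beta> - 1) * (1 - z * t) powr (- (1 - p + \<beta>))) * indicator {0..1} t)"
            using True pq by (simp only:) (auto simp: ennreal_mult'[symmetric] indicator_def mult_ac)
        qed
        also have "\<dots> = ennreal (q * z powr (q - 1)) * ennreal (Beta (1 - p) \<beta> * (1 - z) powr (- (1 - p)))"
          by (subst nn_integral_cmult, measurable, subst nn_integral_Euler_Beta) (use pq \<beta> z in auto)
        also have "\<dots> = ennreal (q * Beta (1 - p) \<beta> * (z powr (q - 1) * (1 - z) powr (p - 1)))"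
          using pq by (simp add: ennreal_mult'[symmetric] mult_ac)
        finally show ?thesis using True by simp
      qed simp
    qed
  qed
  finally show ?thesis .
qed

definition right_abel :: "real \<Rightarrow> real \<Rightarrow> real \<Rightarrow> real \<Rightarrow> ennreal" where
  "right_abel \<beta> p q x = (\<integral>\<^sup>+s. ennreal ((s - x) powr (\<beta> - 1) * (s powr (- p) * (1 - s) powr (- q))) * indicator {x..1} s \<partial>lborel)"

lemma right_abel_reflect: "right_abel \<beta> p q x = left_abel \<beta> q p (1 - x)"
  unfolding right_abel_def left_abel_def
  by (subst nn_integral_reflect) (auto intro!: nn_integral_cong simp: indicator_def mult_ac)

lemma right_abel_eq:
  assumes \<beta>: "0 < \<beta>" "\<beta> < 1" and pq: "0 < p" "0 < q" "p + q = \<beta>" and x: "0 < x" "x < 1"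
  shows "right_abel \<beta> p q x = (\<integral>\<^sup>+z. ennreal (p * Beta (1 - q) \<beta> * (z powr (q - 1) * (1 - z) powr (p - 1))) * indicator {x..1} z \<partial>lborel)"
proof -
  have "right_abel \<beta> p q x = (\<integral>\<^sup>+z. ennreal (p * Beta (1 - q) \<beta> * (z powr (p - 1) * (1 - z) powr (q - 1))) * indicator {0..1 - x} z \<partial>lborel)"
    unfolding right_abel_reflect by (rule left_abel_eq) (use assms in auto)
  also have "\<dots> = (\<integral>\<^sup>+z. ennreal (p * Beta (1 - q) \<beta> * ((1 - z) powr (p - 1) * (1 - (1 - z)) powr (q - 1))) * indicator {1 - (1 - x)..1 - 0} z \<partial>lborel)"
    by (rule nn_integral_reflect) measurable
  also have "\<dots> = (\<integral>\<^sup>+z. ennreal (p * Beta (1 - q) \<beta> * (z powr (q - 1) * (1 - z) powr (p - 1))) * indicator {x..1} z \<partial>lborel)"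
    by (rule nn_integral_cong) (simp add: mult_ac)
  finally show ?thesis .
qed

lemma left_abel_edge:
  assumes "0 < \<beta>" "\<beta> < 1" "0 < x" "x < 1"
  shows "left_abel \<beta> \<beta> 0 x = ennreal (Beta (1 - \<beta>) \<beta>)"
proof -
  have d: "0 < 1 - x * t" if "t \<in> {0..1}" for t
    using that assms by (intro one_minus_mult_pos) auto
  have "left_abel \<beta> \<beta> 0 x = (\<integral>\<^sup>+t. ennreal (t powr (1 - \<beta> - 1) * (1 - t) powr (\<beta> - 1)) * indicator {0..1} t \<partial>lborel)"
  proof (subst left_abel_scaled)
    show "(\<integral>\<^sup>+t. ennreal (t powr (- \<beta>) * (1 - t) powr (\<beta> - 1) * (x / (1 - x * t)) powr 0) * indicator {0..1} t \<partial>lborel)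
      = (\<integral>\<^sup>+t. ennreal (t powr (1 - \<beta> - 1) * (1 - t) powr (\<beta> - 1)) * indicator {0..1} t \<partial>lborel)"
    proof (rule nn_integral_cong)
      fix t :: real
      show "ennreal (t powr (- \<beta>) * (1 - t) powr (\<beta> - 1) * (x / (1 - x * t)) powr 0) * indicator {0..1} t
        = ennreal (t powr (1 - \<beta> - 1) * (1 - t) powr (\<beta> - 1)) * indicator {0..1} t"
      proof (cases "t \<in> {0..1}")
        case True
        then have "x / (1 - x * t) \<noteq> 0" using d[OF True] assms by simp
        then show ?thesis by simp
      qed simp
    qed
  qed (use assms in auto)
  also have "\<dots> = ennreal (Beta (1 - \<beta>) \<beta>)" by (rule nn_integral_Beta) (use assms in auto)
  finally show ?thesis .
qed

text \<open>
  For positive \<open>p\<close> and \<open>q\<close> both one-sided integrals are multiples of the integral of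
  \<open>z powr (q - 1) * (1 - z) powr (p - 1)\<close>, over the part of the interval to the left and to the right
  of \<open>x\<close>. Balancing the two factors makes the weighted sum constant, and the intermediate value
  theorem provides the exponents for which they balance. An exponent 0 occurs only if one of the
  weights is 0, and then the other one-sided integral is constant by itself.
\<close>

theorem abel_equation_solution:
  assumes \<beta>: "0 < \<beta>" "\<beta> < 1" and \<theta>: "0 \<le> \<theta>" "\<theta> \<le> 1"
  obtains p q c where "0 \<le> p" "0 \<le> q" "p + q = \<beta>" "0 < c"
    "\<And>x. 0 < x \<Longrightarrow> x < 1 \<Longrightarrow> ennreal (1 - \<theta>) * left_abel \<beta> p q x + ennreal \<theta> * right_abel \<beta> p q x = ennreal c"
proof -
  let ?F = "\<lambda>p. (1 - \<theta>) * ((\<beta> - p) * Beta (1 - p) \<beta>) - \<theta> * (p * Beta (1 - (\<beta> - p)) \<beta>)"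
  have "\<exists>p. 0 \<le> p \<and> p \<le> \<beta> \<and> ?F p = 0"
  proof (rule IVT2')
    show "?F \<beta> \<le> 0" "0 \<le> ?F 0" using \<beta> \<theta> Beta_pos[of 1 \<beta>] by (auto intro!: mult_nonneg_nonneg)
    have G: "Gamma y \<noteq> 0" if "0 < y" for y :: real using Gamma_real_pos[OF that] by simp
    have "Gamma (1 - p + \<beta>) \<noteq> 0" "Gamma (1 - (\<beta> - p) + \<beta>) \<noteq> 0" if "p \<in> {0..\<beta>}" for p
      by (rule G, use that \<beta> in simp)+
    then show "continuous_on {0..\<beta>} ?F"
      unfolding Beta_def
      by (intro continuous_on_diff continuous_on_mult continuous_on_divide continuous_on_const continuous_on_id
          continuous_on_Gamma_pos continuous_on_add) (use \<beta> in auto)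
  qed (use \<beta> in simp)
  then obtain p where p: "0 \<le> p" "p \<le> \<beta>" "?F p = 0" by blast
  define q where "q = \<beta> - p"
  have q: "0 \<le> q" "p + q = \<beta>" using p by (auto simp: q_def)
  have bal: "(1 - \<theta>) * (q * Beta (1 - p) \<beta>) = \<theta> * (p * Beta (1 - q) \<beta>)"
    using p(3) by (simp add: q_def)
  consider "q = 0" | "p = 0" | "0 < p" "0 < q" using p q by linarith
  then show ?thesis
  proof cases
    case 1
    then have "p = \<beta>" using q by simp
    then have "\<theta> = 0" using bal 1 \<beta> Beta_pos[of 1 \<beta>] by simp
    then show ?thesis
      using left_abel_edge[OF \<beta>] 1 \<open>p = \<beta>\<close> \<beta> Beta_pos[of "1 - \<beta>" \<beta>]
      by (intro that[of \<beta> 0 "Beta (1 - \<beta>) \<beta>"]) auto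
  next
    case 2
    then have "q = \<beta>" using q by simp
    then have "\<theta> = 1" using bal 2 \<beta> Beta_pos[of 1 \<beta>] by simp
    then show ?thesis
      using left_abel_edge[OF \<beta>] 2 \<open>q = \<beta>\<close> \<beta> Beta_pos[of "1 - \<beta>" \<beta>]
      by (intro that[of 0 \<beta> "Beta (1 - \<beta>) \<beta>"]) (auto simp: right_abel_reflect)
  next
    case 3
    define k where "k = (1 - \<theta>) * (q * Beta (1 - p) \<beta>)"
    have B: "0 < Beta (1 - p) \<beta>" "0 < Beta (1 - q) \<beta>" "0 < Beta q p" using 3 q \<beta> by (auto intro!: Beta_pos)
    have k: "0 < k"
    proof (cases "\<theta> = 1")
      case True
      then have "k = p * Beta (1 - q) \<beta>" using bal by (simp add: k_def)
      then show ?thesis using 3 B by simp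
    next
      case False
      then show ?thesis unfolding k_def using \<theta> 3 B by simp
    qed
    let ?m = "\<lambda>z. z powr (q - 1) * (1 - z) powr (p - 1)"
    show ?thesis
    proof (rule that[OF p(1) q(1,2)])
      show "0 < k * Beta q p" using k B by simp
      fix x :: real assume x: "0 < x" "x < 1"
      have "ennreal (1 - \<theta>) * left_abel \<beta> p q x = (\<integral>\<^sup>+z. ennreal (k * ?m z) * indicator {0..x} z \<partial>lborel)"
        unfolding left_abel_eq[OF \<beta> 3 q(2) x] using \<theta> 3 B
        by (subst nn_integral_cmult[symmetric])
          (auto intro!: nn_integral_cong simp: k_def ennreal_mult'[symmetric] indicator_def mult_ac)
      moreover have "ennreal \<theta> * right_abel \<beta> p q x = (\<integral>\<^sup>+z. ennreal (k * ?m z) * indicator {x..1} z \<partial>lborel)"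
        unfolding right_abel_eq[OF \<beta> 3 q(2) x] k_def bal using \<theta> 3 B
        by (subst nn_integral_cmult[symmetric])
          (auto intro!: nn_integral_cong simp: ennreal_mult'[symmetric] indicator_def mult_ac)
      ultimately have "ennreal (1 - \<theta>) * left_abel \<beta> p q x + ennreal \<theta> * right_abel \<beta> p q x
          = (\<integral>\<^sup>+z. ennreal (k * ?m z) * indicator {0..x} z + ennreal (k * ?m z) * indicator {x..1} z \<partial>lborel)"
        by (simp add: nn_integral_add)
      also have "\<dots> = (\<integral>\<^sup>+z. ennreal k * (ennreal (?m z) * indicator {0..1} z) \<partial>lborel)"
      proof (rule nn_integral_cong_AE)
        show "AE z in lborel. ennreal (k * ?m z) * indicator {0..x} z + ennreal (k * ?m z) * indicator {x..1} z
          = ennreal k * (ennreal (?m z) * indicator {0..1} z)"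
          using AE_lborel_singleton[of x]
          by eventually_elim (use x k in \<open>auto simp: indicator_def ennreal_mult'\<close>)
      qed
      also have "\<dots> = ennreal k * ennreal (Beta q p)"
        using 3 by (subst nn_integral_cmult) (auto simp: nn_integral_Beta)
      also have "\<dots> = ennreal (k * Beta q p)" using k by (simp add: ennreal_mult')
      finally show "ennreal (1 - \<theta>) * left_abel \<beta> p q x + ennreal \<theta> * right_abel \<beta> p q x = ennreal (k * Beta q p)" .
    qed
  qed
qed

section \<open>A Plancherel inequality\<close>

lemma (in pair_sigma_finite) integrable_product:
  fixes f g :: "_ \<Rightarrow> 'c::{real_normed_field, banach, second_countable_topology}"
  assumes f: "integrable M1 f" and g: "integrable M2 g"
  shows "integrable (M1 \<Otimes>\<^sub>M M2) (\<lambda>(x, y). f x * g y)"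
    and "(\<integral>(x, y). f x * g y \<partial>(M1 \<Otimes>\<^sub>M M2)) = integral\<^sup>L M1 f * integral\<^sup>L M2 g"
proof -
  have [measurable]: "f \<in> borel_measurable M1" "g \<in> borel_measurable M2" using f g by auto
  show i: "integrable (M1 \<Otimes>\<^sub>M M2) (\<lambda>(x, y). f x * g y)"
  proof (rule Fubini_integrable)
    show "integrable M1 (\<lambda>x. \<integral>y. norm (case (x, y) of (x, y) \<Rightarrow> f x * g y) \<partial>M2)"
      using f by (simp add: norm_mult)
  qed (use g in auto)
  have "(\<integral>(x, y). f x * g y \<partial>(M1 \<Otimes>\<^sub>M M2)) = (\<integral>x. (\<integral>y. f x * g y \<partial>M2) \<partial>M1)"
    using integral_fst[OF i] by simp
  then show "(\<integral>(x, y). f x * g y \<partial>(M1 \<Otimes>\<^sub>M M2)) = integral\<^sup>L M1 f * integral\<^sup>L M2 g"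
    by simp
qed

abbreviation normal_dist :: "real measure" where "normal_dist \<equiv> density lborel std_normal_density"

lemma borel_measurable_cis [measurable]: "cis \<in> borel_measurable borel"
  by (intro borel_measurable_continuous_onI continuous_intros)

lemma has_vector_derivative_cis:
  "((\<lambda>x. cis (c * x)) has_vector_derivative \<i> * complex_of_real c * cis (c * x)) (at x within S)"
proof -
  have "((\<lambda>z. exp (\<i> * complex_of_real c * z)) has_field_derivative
      \<i> * complex_of_real c * exp (\<i> * complex_of_real c * complex_of_real x)) (at (complex_of_real x))"
    by (auto intro!: derivative_eq_intros)
  from has_vector_derivative_real_field[OF this, of S] show ?thesis
    by (simp add: cis_conv_exp mult.assoc)
qed

lemma integrable_cis_mult:
  assumes "integrable lborel (f :: real \<Rightarrow> real)"
  shows "integrable lborel (\<lambda>x. cis (c * x) * complex_of_real (f x))"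
proof -
  show ?thesis
    by (rule Bochner_Integration.integrable_bound[OF assms]) (use assms in \<open>auto simp: norm_mult\<close>)
qed

lemma fourier_lborel:
  assumes "w \<in> borel_measurable borel"
  shows "fourier w \<omega> = (\<integral>x. cis (- (\<omega> * x)) * complex_of_real (w x) \<partial>lborel)"
  unfolding fourier_def by (rule integral_completion) (use assms in measurable)

text \<open>
  The form as a double integral admits the exchange with an integral over the frequency \<open>\<omega>\<close>.
\<close>

lemma norm_sq_fourier_integral:
  fixes f :: "real \<Rightarrow> real"
  assumes f: "integrable lborel f"
  shows "(cmod (fourier f \<omega>))\<^sup>2
    = (\<integral>(x, y). f x * f y * cos (\<omega> * (x - y)) \<partial>(lborel \<Otimes>\<^sub>M lborel))"
proof -
  have [measurable]: "f \<in> borel_measurable borel" using f by auto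
  have ic: "integrable lborel (\<lambda>x. cos (\<omega> * x) * f x)" and isn: "integrable lborel (\<lambda>x. sin (\<omega> * x) * f x)"
    by (rule Bochner_Integration.integrable_bound[OF f]; auto simp: abs_mult intro!: mult_left_le_one_le)+
  let ?F = "\<integral>x. cis (- (\<omega> * x)) * complex_of_real (f x) \<partial>lborel"
  have i: "integrable lborel (\<lambda>x. cis (- (\<omega> * x)) * complex_of_real (f x))"
    using integrable_cis_mult[OF f, of "- \<omega>"] by simp
  have "Re ?F = (\<integral>x. cos (\<omega> * x) * f x \<partial>lborel)" "Im ?F = - (\<integral>x. sin (\<omega> * x) * f x \<partial>lborel)"
    using integral_Re[OF i] integral_Im[OF i] by simp_all
  then have "(cmod ?F)\<^sup>2 = (\<integral>x. cos (\<omega> * x) * f x \<partial>lborel) * (\<integral>x. cos (\<omega> * x) * f x \<partial>lborel)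
      + (\<integral>x. sin (\<omega> * x) * f x \<partial>lborel) * (\<integral>x. sin (\<omega> * x) * f x \<partial>lborel)"
    by (simp only: cmod_power2) (simp add: power2_eq_square)
  also have "\<dots> = (\<integral>(x, y). (cos (\<omega> * x) * f x) * (cos (\<omega> * y) * f y) \<partial>(lborel \<Otimes>\<^sub>M lborel))
     + (\<integral>(x, y). (sin (\<omega> * x) * f x) * (sin (\<omega> * y) * f y) \<partial>(lborel \<Otimes>\<^sub>M lborel))"
    by (simp only: lborel_pair.integrable_product[OF ic ic] lborel_pair.integrable_product[OF isn isn])
  also have "\<dots> = (\<integral>p. (case p of (x, y) \<Rightarrow> (cos (\<omega> * x) * f x) * (cos (\<omega> * y) * f y)) +
      (case p of (x, y) \<Rightarrow> (sin (\<omega> * x) * f x) * (sin (\<omega> * y) * f y)) \<partial>(lborel \<Otimes>\<^sub>M lborel))"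
    by (rule Bochner_Integration.integral_add[symmetric])
      (rule lborel_pair.integrable_product[OF ic ic] lborel_pair.integrable_product[OF isn isn])+
  also have "\<dots> = (\<integral>(x, y). f x * f y * cos (\<omega> * (x - y)) \<partial>(lborel \<Otimes>\<^sub>M lborel))"
    by (rule Bochner_Integration.integral_cong) (auto simp: right_diff_distrib cos_diff algebra_simps)
  finally show ?thesis by (simp add: fourier_lborel)
qed

lemma integral_cos_normal: "(\<integral>s. cos (s * t) \<partial>normal_dist) = exp (- (t\<^sup>2) / 2)"
proof -
  have "Re (char normal_dist t) = exp (- (t\<^sup>2) / 2)"
    by (simp add: char_std_normal_distribution)
  moreover have "Re (char normal_dist t) = (\<integral>s. cos (s * t) \<partial>normal_dist)"
  proof -
    interpret N: prob_space normal_dist by (rule prob_space_normal_density) simp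
    have i: "integrable normal_dist (\<lambda>x. iexp (t * x))"
      by (rule N.integrable_const_bound[where B=1]) auto
    have "Re (char normal_dist t) = (\<integral>s. Re (iexp (t * s)) \<partial>normal_dist)"
      unfolding char_def by (rule integral_Re[OF i, symmetric])
    then show ?thesis by (simp add: Re_exp mult.commute)
  qed
  ultimately show ?thesis by simp
qed

text \<open>
  Weighting the squared Fourier transform with a wide Gaussian turns its integral into a double
  integral of \<open>f\<close> against a narrow Gaussian, that is, into \<open>\<integral> f(x) E[f(x + Z / a)] dx\<close> with a
  standard normal variable \<open>Z\<close>.
\<close>

lemma Gauss_Plancherel_le:
  fixes f :: "real \<Rightarrow> real"
  assumes f: "integrable lborel f" and a: "0 < a" and bd: "\<And>x. \<bar>f x\<bar> \<le> B"
    and F: "integrable lborel (\<lambda>\<omega>. (cmod (fourier f \<omega>))\<^sup>2)"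
  shows "2 * pi * (\<integral>x. f x * (\<integral>z. f (x + z / a) \<partial>normal_dist) \<partial>lborel) \<le>
    (\<integral>\<omega>. (cmod (fourier f \<omega>))\<^sup>2 \<partial>lborel)"
proof -
  interpret N: prob_space normal_dist by (rule prob_space_normal_density) simp
  interpret NP: pair_sigma_finite normal_dist "lborel \<Otimes>\<^sub>M lborel :: (real \<times> real) measure"
    unfolding lborel_prod by standard
  have [measurable]: "f \<in> borel_measurable borel" using f by auto
  let ?G = "\<lambda>\<omega>. (cmod (fourier f \<omega>))\<^sup>2"
  let ?P = "lborel \<Otimes>\<^sub>M lborel :: (real \<times> real) measure"
  have iff: "integrable ?P (\<lambda>(x, y). f x * f y)" by (rule lborel_pair.integrable_product[OF f f])
  have int: "integrable (normal_dist \<Otimes>\<^sub>M ?P) (\<lambda>(s, p). f (fst p) * f (snd p) * cos (a * s * (fst p - snd p)))"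
  proof (rule Bochner_Integration.integrable_bound)
    show "integrable (normal_dist \<Otimes>\<^sub>M ?P) (\<lambda>(s, p). 1 * (case p of (x, y) \<Rightarrow> f x * f y))"
      by (rule NP.integrable_product) (use iff in auto)
    show "AE q in normal_dist \<Otimes>\<^sub>M ?P. norm (case q of (s, p) \<Rightarrow> f (fst p) * f (snd p) * cos (a * s * (fst p - snd p)))
      \<le> norm (case q of (s, p) \<Rightarrow> 1 * (case p of (x, y) \<Rightarrow> f x * f y))"
      by (rule AE_I2) (auto simp: abs_mult intro!: mult_left_le)
  qed measurable
  have e: "(\<integral>s. ?G (a * s) \<partial>normal_dist) = (\<integral>p. f (fst p) * f (snd p) * exp (- ((a * (fst p - snd p))\<^sup>2) / 2) \<partial>?P)"
  proof -
    have "(\<integral>s. ?G (a * s) \<partial>normal_dist) = (\<integral>s. (\<integral>p. f (fst p) * f (snd p) * cos (a * s * (fst p - snd p)) \<partial>?P) \<partial>normal_dist)"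
      unfolding norm_sq_fourier_integral[OF f] by (simp add: split_beta')
    also have "\<dots> = (\<integral>p. (\<integral>s. f (fst p) * f (snd p) * cos (a * s * (fst p - snd p)) \<partial>normal_dist) \<partial>?P)"
      using NP.Fubini_integral[OF int] by simp
    also have "\<dots> = (\<integral>p. f (fst p) * f (snd p) * exp (- ((a * (fst p - snd p))\<^sup>2) / 2) \<partial>?P)"
    proof (rule Bochner_Integration.integral_cong[OF refl])
      fix p :: "real \<times> real"
      have "(\<integral>s. cos (a * s * (fst p - snd p)) \<partial>normal_dist) = (\<integral>s. cos (s * (a * (fst p - snd p))) \<partial>normal_dist)"
        by (simp add: mult_ac)
      then show "(\<integral>s. f (fst p) * f (snd p) * cos (a * s * (fst p - snd p)) \<partial>normal_dist) =
        f (fst p) * f (snd p) * exp (- ((a * (fst p - snd p))\<^sup>2) / 2)"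
        using integral_cos_normal[of "a * (fst p - snd p)"] by simp
    qed
    finally show ?thesis .
  qed
  have iexp: "integrable ?P (\<lambda>(x, y). f x * f y * exp (- ((a * (x - y))\<^sup>2) / 2))"
  proof (rule Bochner_Integration.integrable_bound[OF iff])
    show "AE p in ?P. norm (case p of (x, y) \<Rightarrow> f x * f y * exp (- ((a * (x - y))\<^sup>2) / 2)) \<le> norm (case p of (x, y) \<Rightarrow> f x * f y)"
      by (rule AE_I2) (auto simp: abs_mult intro!: mult_left_le)
  qed measurable
  have inner: "a * (\<integral>y. f y * exp (- ((a * (x - y))\<^sup>2) / 2) \<partial>lborel) = sqrt (2 * pi) * (\<integral>z. f (x + z / a) \<partial>normal_dist)" for x
  proof -
    have "(\<integral>y. f y * exp (- ((a * (x - y))\<^sup>2) / 2) \<partial>lborel) =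
      \<bar>1 / a\<bar> *\<^sub>R (\<integral>z. f (x + (1 / a) * z) * exp (- ((a * (x - (x + (1 / a) * z)))\<^sup>2) / 2) \<partial>lborel)"
      by (rule lborel_integral_real_affine) (use a in simp)
    also have "\<dots> = (1 / a) * (\<integral>z. sqrt (2 * pi) * (std_normal_density z *\<^sub>R f (x + z / a)) \<partial>lborel)"
      using a by (auto intro!: Bochner_Integration.integral_cong simp: std_normal_density_def)
    also have "(\<integral>z. sqrt (2 * pi) * (std_normal_density z *\<^sub>R f (x + z / a)) \<partial>lborel) = sqrt (2 * pi) * (\<integral>z. f (x + z / a) \<partial>normal_dist)"
      by (subst integral_density) auto
    finally show ?thesis using a by simp
  qed
  have "a * (\<integral>s. ?G (a * s) \<partial>normal_dist) = a * (\<integral>x. (\<integral>y. f x * f y * exp (- ((a * (x - y))\<^sup>2) / 2) \<partial>lborel) \<partial>lborel)"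
    unfolding e lborel_pair.integral_fst[OF iexp] by (simp add: split_beta')
  also have "\<dots> = (\<integral>x. f x * (a * (\<integral>y. f y * exp (- ((a * (x - y))\<^sup>2) / 2) \<partial>lborel)) \<partial>lborel)"
    by (simp add: mult_ac)
  also have "\<dots> = sqrt (2 * pi) * (\<integral>x. f x * (\<integral>z. f (x + z / a) \<partial>normal_dist) \<partial>lborel)"
    unfolding inner by (subst integral_mult_right_zero[symmetric]) (simp add: mult_ac)
  finally have 1: "sqrt (2 * pi) * (\<integral>x. f x * (\<integral>z. f (x + z / a) \<partial>normal_dist) \<partial>lborel) = a * (\<integral>s. ?G (a * s) \<partial>normal_dist)" by simp
  have [measurable]: "?G \<in> borel_measurable borel" using F by auto
  have Ga: "integrable lborel (\<lambda>s. ?G (a * s))"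
    using lborel_integrable_real_affine[OF F, of a 0] a by simp
  have "(\<integral>s. ?G (a * s) \<partial>normal_dist) = (\<integral>s. std_normal_density s *\<^sub>R ?G (a * s) \<partial>lborel)"
    by (rule integral_density) auto
  also have "\<dots> \<le> (\<integral>s. (1 / sqrt (2 * pi)) * ?G (a * s) \<partial>lborel)"
  proof (rule integral_mono)
    have le: "std_normal_density s \<le> 1 / sqrt (2 * pi)" for s
      by (simp add: std_normal_density_def divide_right_mono)
    show g: "integrable lborel (\<lambda>s. (1 / sqrt (2 * pi)) * ?G (a * s))" using Ga by simp
    show le2: "std_normal_density s *\<^sub>R ?G (a * s) \<le> (1 / sqrt (2 * pi)) * ?G (a * s)" for s
      using mult_right_mono[OF le, of "?G (a * s)" s] by simp
    show "integrable lborel (\<lambda>s. std_normal_density s *\<^sub>R ?G (a * s))"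
      by (rule Bochner_Integration.integrable_bound[OF g]) (use le2 in auto)
  qed
  also have "\<dots> = (1 / sqrt (2 * pi)) * (\<integral>s. ?G (a * s) \<partial>lborel)" by simp
  also have "(\<integral>s. ?G (a * s) \<partial>lborel) = (\<integral>\<omega>. ?G \<omega> \<partial>lborel) / a"
    using lborel_integral_real_affine[of a ?G 0] a by simp
  finally have 2: "a * (\<integral>s. ?G (a * s) \<partial>normal_dist) \<le> (\<integral>\<omega>. ?G \<omega> \<partial>lborel) / sqrt (2 * pi)"
    using a by (simp add: field_simps)
  have "sqrt (2 * pi) * (sqrt (2 * pi) * (\<integral>x. f x * (\<integral>z. f (x + z / a) \<partial>normal_dist) \<partial>lborel)) \<le> (\<integral>\<omega>. ?G \<omega> \<partial>lborel)"
    using mult_left_mono[OF 2, of "sqrt (2 * pi)"] unfolding 1 by simp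
  then show ?thesis by (simp add: mult.assoc[symmetric])
qed

text \<open>
  In \<open>Gauss_Plancherel_le\<close> let \<open>a\<close> tend to infinity: the expectation of \<open>f (x + Z / a)\<close> tends to \<open>f x\<close>.
\<close>

theorem Plancherel_le:
  fixes f :: "real \<Rightarrow> real"
  assumes f: "integrable lborel f" and cont: "continuous_on UNIV f" and bd: "\<And>x. \<bar>f x\<bar> \<le> B"
    and F: "integrable lborel (\<lambda>\<omega>. (cmod (fourier f \<omega>))\<^sup>2)"
  shows "2 * pi * (\<integral>x. (f x)\<^sup>2 \<partial>lborel) \<le>
    (\<integral>\<omega>. (cmod (fourier f \<omega>))\<^sup>2 \<partial>lborel)"
proof -
  interpret N: prob_space normal_dist by (rule prob_space_normal_density) simp
  have [measurable]: "f \<in> borel_measurable borel" using f by auto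
  have B: "0 \<le> B" using bd[of 0] by simp
  let ?m = "\<lambda>n x. \<integral>z. f (x + z / real (Suc n)) \<partial>normal_dist"
  have mb: "\<bar>?m n x\<bar> \<le> B" for n x
  proof -
    have "\<bar>?m n x\<bar> \<le> (\<integral>z. \<bar>f (x + z / real (Suc n))\<bar> \<partial>normal_dist)" by (rule integral_abs_bound)
    also have "\<dots> \<le> (\<integral>z. B \<partial>normal_dist)"
      by (rule integral_mono[OF N.integrable_const_bound[where B=B]]) (auto simp: bd)
    finally show ?thesis using N.prob_space by simp
  qed
  have lim: "(\<lambda>n. ?m n x) \<longlonglongrightarrow> f x" for x
  proof -
    have "(\<lambda>n. ?m n x) \<longlonglongrightarrow> (\<integral>z. f x \<partial>normal_dist)"
    proof (rule integral_dominated_convergence[where w="\<lambda>_. B"])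
      show "AE z in normal_dist. (\<lambda>n. f (x + z / real (Suc n))) \<longlonglongrightarrow> f x"
      proof (rule AE_I2)
        fix z
        have "(\<lambda>n. z / real (Suc n)) \<longlonglongrightarrow> 0"
          using tendsto_mult[OF tendsto_const[of z] LIMSEQ_inverse_real_of_nat] by (simp add: divide_inverse)
        then have "(\<lambda>n. x + z / real (Suc n)) \<longlonglongrightarrow> x + 0" by (intro tendsto_add tendsto_const)
        then show "(\<lambda>n. f (x + z / real (Suc n))) \<longlonglongrightarrow> f x"
          using cont by (intro isCont_tendsto_compose[of x f]) (auto simp: continuous_on_eq_continuous_at)
      qed
    qed (use bd in auto)
    then show ?thesis using N.prob_space by simp
  qed
  have "(\<lambda>n. \<integral>x. f x * ?m n x \<partial>lborel) \<longlonglongrightarrow> (\<integral>x. f x * f x \<partial>lborel)"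
  proof (rule integral_dominated_convergence[where w="\<lambda>x. B * \<bar>f x\<bar>"])
    show "AE x in lborel. norm (f x * ?m n x) \<le> B * \<bar>f x\<bar>" for n
      using mb by (auto simp: abs_mult mult.commute[of B] intro!: mult_left_mono)
    show "AE x in lborel. (\<lambda>n. f x * ?m n x) \<longlonglongrightarrow> f x * f x"
      using lim by (intro AE_I2 tendsto_mult tendsto_const)
    show "(\<lambda>x. f x * ?m n x) \<in> borel_measurable lborel" for n by measurable
  qed (use f in auto)
  then have conv: "(\<lambda>n. 2 * pi * (\<integral>x. f x * ?m n x \<partial>lborel)) \<longlonglongrightarrow> 2 * pi * (\<integral>x. f x * f x \<partial>lborel)"
    by (intro tendsto_mult tendsto_const)
  have le: "2 * pi * (\<integral>x. f x * ?m n x \<partial>lborel) \<le>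
      (\<integral>\<omega>. (cmod (fourier f \<omega>))\<^sup>2 \<partial>lborel)" for n
    by (rule Gauss_Plancherel_le[OF f _ bd F]) simp
  have "2 * pi * (\<integral>x. f x * f x \<partial>lborel) \<le>
      (\<integral>\<omega>. (cmod (fourier f \<omega>))\<^sup>2 \<partial>lborel)"
    by (rule LIMSEQ_le_const2[OF conv]) (use le in blast)
  then show ?thesis by (simp add: power2_eq_square)
qed

section \<open>The fractional kernel and its Fourier transform\<close>

definition one_sided :: "real \<Rightarrow> real \<Rightarrow> real" where
  "one_sided \<beta> x = indicator {0..1} x * x powr (\<beta> - 1)"

lemma one_sided_measurable [measurable]: "one_sided \<beta> \<in> borel_measurable borel"
  unfolding one_sided_def by measurable

lemma one_sided_nonneg: "0 \<le> one_sided \<beta> x"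
  by (simp add: one_sided_def)

lemma nn_integral_powr_0:
  assumes "0 < \<beta>" "0 \<le> b"
  shows "(\<integral>\<^sup>+x. ennreal (x powr (\<beta> - 1)) * indicator {0..b} x \<partial>lborel) = ennreal (b powr \<beta> / \<beta>)"
proof -
  have "((\<lambda>x. x powr (\<beta> - 1)) has_integral b powr \<beta> / \<beta> - 0 powr \<beta> / \<beta>) {0..b}"
  proof (rule fundamental_theorem_of_calculus_interior)
    show "continuous_on {0..b} (\<lambda>x. x powr \<beta> / \<beta>)"
      by (intro continuous_intros continuous_on_powr') (use assms in auto)
    show "((\<lambda>x. x powr \<beta> / \<beta>) has_vector_derivative x powr (\<beta> - 1)) (at x)" if "x \<in> {0<..<b}" for x
      unfolding has_real_derivative_iff_has_vector_derivative[symmetric]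
      using that assms by (auto intro!: derivative_eq_intros)
  qed fact
  then have "((\<lambda>x. x powr (\<beta> - 1)) has_integral b powr \<beta> / \<beta>) {0..b}" by simp
  then show ?thesis by (intro nn_integral_has_integral_lebesgue') auto
qed

lemma integrable_one_sided:
  assumes "0 < \<beta>" shows "integrable lborel (one_sided \<beta>)"
proof (rule integrableI_nonneg)
  have "(\<integral>\<^sup>+x. ennreal (one_sided \<beta> x) \<partial>lborel) = (\<integral>\<^sup>+x. ennreal (x powr (\<beta> - 1)) * indicator {0..1} x \<partial>lborel)"
    by (rule nn_integral_cong) (auto simp: one_sided_def indicator_def)
  then show "(\<integral>\<^sup>+x. ennreal (one_sided \<beta> x) \<partial>lborel) < \<infinity>"
    using nn_integral_powr_0[of \<beta> 1] assms by simp
qed (auto simp: one_sided_nonneg)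

text \<open>
  The mass below \<open>1 / |\<omega>|\<close> is integrated absolutely, on the rest one integration by parts gains the
  factor \<open>1 / |\<omega>|\<close>.
\<close>

lemma fourier_one_sided_le:
  assumes \<beta>: "0 < \<beta>" "\<beta> < 1" and \<omega>: "\<omega> \<noteq> 0"
  shows "cmod (\<integral>x. cis (\<omega> * x) * complex_of_real (one_sided \<beta> x) \<partial>lborel) \<le> (1 / \<beta> + 2) * \<bar>\<omega>\<bar> powr (- \<beta>)"
proof -
  \<comment> \<open>Low frequencies, \<open>\<bar>\<omega>\<bar> \<le> 1\<close>, give \<open>b = 1\<close> and leave nothing for the integration by parts.\<close>
  define b where "b = min 1 (1 / \<bar>\<omega>\<bar>)"
  have b: "0 < b" "b \<le> 1" "b \<le> 1 / \<bar>\<omega>\<bar>" using \<omega> by (auto simp: b_def)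
  let ?h = "\<lambda>x. cis (\<omega> * x) * complex_of_real (one_sided \<beta> x)"
  have i: "integrable lborel ?h" by (rule integrable_cis_mult[OF integrable_one_sided[OF \<beta>(1)]])
  have split: "?h x = indicator {0..b} x *\<^sub>R ?h x + indicator {b<..1} x *\<^sub>R ?h x" for x
    using b by (auto simp: indicator_def one_sided_def)
  have i1: "integrable lborel (\<lambda>x. indicator {0..b} x *\<^sub>R ?h x)" "integrable lborel (\<lambda>x. indicator {b<..1} x *\<^sub>R ?h x)"
    by (rule integrable_mult_indicator[OF _ i]; simp)+
  have bpow: "b powr \<beta> \<le> \<bar>\<omega>\<bar> powr (- \<beta>)"
  proof -
    have "b powr \<beta> \<le> (1 / \<bar>\<omega>\<bar>) powr \<beta>" using b \<beta> by (intro powr_mono2) auto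
    then show ?thesis by (simp add: powr_divide powr_minus_divide)
  qed
  have 1: "cmod (\<integral>x. indicator {0..b} x *\<^sub>R ?h x \<partial>lborel) \<le> \<bar>\<omega>\<bar> powr (- \<beta>) / \<beta>"
  proof -
    have "cmod (\<integral>x. indicator {0..b} x *\<^sub>R ?h x \<partial>lborel) \<le> (\<integral>x. cmod (indicator {0..b} x *\<^sub>R ?h x) \<partial>lborel)"
      by (rule integral_norm_bound)
    also have "\<dots> = enn2real (\<integral>\<^sup>+x. ennreal (x powr (\<beta> - 1)) * indicator {0..b} x \<partial>lborel)"
      by (subst integral_eq_nn_integral)
        (use b in \<open>auto intro!: arg_cong[where f=enn2real] nn_integral_cong simp: norm_mult one_sided_def indicator_def\<close>)
    also have "\<dots> = b powr \<beta> / \<beta>" using b \<beta> by (subst nn_integral_powr_0) auto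
    also have "\<dots> \<le> \<bar>\<omega>\<bar> powr (- \<beta>) / \<beta>" using bpow \<beta> by (simp add: divide_right_mono)
    finally show ?thesis .
  qed
  have 2: "cmod (\<integral>x. indicator {b<..1} x *\<^sub>R ?h x \<partial>lborel) \<le> 2 * \<bar>\<omega>\<bar> powr (- \<beta>)"
  proof (cases "\<bar>\<omega>\<bar> \<le> 1")
    case True
    then have "b = 1" using \<omega> by (simp add: b_def)
    then show ?thesis by simp
  next
    case False
    then have bw: "b = 1 / \<bar>\<omega>\<bar>" by (simp add: b_def)
    let ?F = "\<lambda>x. cis (\<omega> * x) / (\<i> * complex_of_real \<omega>) * complex_of_real (x powr (\<beta> - 1))"
    let ?r = "\<lambda>x. cis (\<omega> * x) / (\<i> * complex_of_real \<omega>) * complex_of_real ((\<beta> - 1) * x powr (\<beta> - 2))"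
    let ?c = "\<lambda>x. cis (\<omega> * x) * complex_of_real (x powr (\<beta> - 1))"
    have dF: "(?F has_vector_derivative (?c x + ?r x)) (at x within {b..1})" if "b \<le> x" for x
    proof -
      have x: "0 < x" using b that by simp
      have "((\<lambda>x. x powr (\<beta> - 1)) has_real_derivative (\<beta> - 1) * x powr (\<beta> - 2)) (at x within {b..1})"
        using x by (auto intro!: derivative_eq_intros)
      then have p: "((\<lambda>x. complex_of_real (x powr (\<beta> - 1))) has_vector_derivative complex_of_real ((\<beta> - 1) * x powr (\<beta> - 2))) (at x within {b..1})"
        by (rule has_vector_derivative_of_real)
      have q: "((\<lambda>x. cis (\<omega> * x) / (\<i> * complex_of_real \<omega>)) has_vector_derivative cis (\<omega> * x)) (at x within {b..1})"
        using has_vector_derivative_divide[OF has_vector_derivative_cis[of \<omega> x "{b..1}"], of "\<i> * complex_of_real \<omega>"] \<omega> by simp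
      show ?thesis
        using has_vector_derivative_mult[OF q p] by (simp add: add.commute)
    qed
    have cpow: "continuous_on {b..1} (\<lambda>x. x powr e)" for e :: real
      by (intro continuous_on_powr continuous_intros) (use b in auto)
    have i0: "\<i> * complex_of_real \<omega> \<noteq> 0" using \<omega> by simp
    have ccis: "continuous_on {b..1} (\<lambda>x. cis (\<omega> * x))" by (intro continuous_intros)
    have c1: "continuous_on {b..1} ?c" by (intro continuous_on_mult ccis continuous_on_of_real cpow)
    have "continuous_on {b..1} (\<lambda>x. (\<beta> - 1) * x powr (\<beta> - 2))" by (intro continuous_on_mult continuous_on_const cpow)
    then have "continuous_on {b..1} ?r"
      using i0 by (intro continuous_on_mult continuous_on_divide ccis continuous_on_const continuous_on_of_real) (auto intro: cpow)
    note cc = c1 this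
    have cint: "integrable lborel (\<lambda>x. indicator {b..1} x *\<^sub>R ?c x)" "integrable lborel (\<lambda>x. indicator {b..1} x *\<^sub>R ?r x)"
      by (rule borel_integrable_compact[OF compact_Icc cc(1)], rule borel_integrable_compact[OF compact_Icc cc(2)])
    have "(\<integral>x. indicator {b..1} x *\<^sub>R (?c x + ?r x) \<partial>lborel) = ?F 1 - ?F b"
      by (rule integral_FTC_atLeastAtMost[OF b(2) dF]) (assumption, rule continuous_on_add[OF cc])
    then have eq: "(\<integral>x. indicator {b..1} x *\<^sub>R ?c x \<partial>lborel) = ?F 1 - ?F b - (\<integral>x. indicator {b..1} x *\<^sub>R ?r x \<partial>lborel)"
      unfolding scaleR_add_right Bochner_Integration.integral_add[OF cint] by (simp only: eq_diff_eq)
    have nF: "cmod (?F x) = x powr (\<beta> - 1) / \<bar>\<omega>\<bar>" for x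
      by (simp add: norm_mult norm_divide)
    have "cmod (\<integral>x. indicator {b..1} x *\<^sub>R ?r x \<partial>lborel) \<le> (\<integral>x. indicator {b..1} x *\<^sub>R ((1 - \<beta>) * x powr (\<beta> - 2) / \<bar>\<omega>\<bar>) \<partial>lborel)"
    proof -
      have "cmod (\<integral>x. indicator {b..1} x *\<^sub>R ?r x \<partial>lborel) \<le> (\<integral>x. cmod (indicator {b..1} x *\<^sub>R ?r x) \<partial>lborel)"
        by (rule integral_norm_bound)
      also have "\<dots> = (\<integral>x. indicator {b..1} x *\<^sub>R ((1 - \<beta>) * x powr (\<beta> - 2) / \<bar>\<omega>\<bar>) \<partial>lborel)"
      proof (rule Bochner_Integration.integral_cong[OF refl])
        fix x
        have "cmod (?r x) = (1 - \<beta>) * x powr (\<beta> - 2) / \<bar>\<omega>\<bar>"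
          by (simp only: norm_mult norm_divide norm_of_real norm_cis abs_mult) (use \<beta> in simp)
        then show "cmod (indicator {b..1} x *\<^sub>R ?r x) = indicator {b..1} x *\<^sub>R ((1 - \<beta>) * x powr (\<beta> - 2) / \<bar>\<omega>\<bar>)"
          by (simp only: norm_scaleR) simp
      qed
      finally show ?thesis .
    qed
    also have "\<dots> = - (1 powr (\<beta> - 1) / \<bar>\<omega>\<bar>) - (- (b powr (\<beta> - 1) / \<bar>\<omega>\<bar>))"
    proof (rule integral_FTC_atLeastAtMost[OF b(2)])
      show "((\<lambda>x. - (x powr (\<beta> - 1) / \<bar>\<omega>\<bar>)) has_vector_derivative (1 - \<beta>) * x powr (\<beta> - 2) / \<bar>\<omega>\<bar>) (at x within {b..1})" if "b \<le> x" for x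
        unfolding has_real_derivative_iff_has_vector_derivative[symmetric]
        using b that \<omega> by (auto intro!: derivative_eq_intros simp: field_simps)
      show "continuous_on {b..1} (\<lambda>x. (1 - \<beta>) * x powr (\<beta> - 2) / \<bar>\<omega>\<bar>)"
        by (intro continuous_intros cpow) (use \<omega> in simp)
    qed
    finally have r: "cmod (\<integral>x. indicator {b..1} x *\<^sub>R ?r x \<partial>lborel) \<le> b powr (\<beta> - 1) / \<bar>\<omega>\<bar> - 1 / \<bar>\<omega>\<bar>" by simp
    have "(\<integral>x. indicator {b<..1} x *\<^sub>R ?h x \<partial>lborel) = (\<integral>x. indicator {b..1} x *\<^sub>R ?c x \<partial>lborel)"
    proof (rule integral_cong_AE)
      show "AE x in lborel. indicator {b<..1} x *\<^sub>R ?h x = indicator {b..1} x *\<^sub>R ?c x"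
        using AE_lborel_singleton[of b] by eventually_elim (use b in \<open>auto simp: indicator_def one_sided_def\<close>)
    qed measurable
    moreover have ab3: "cmod (x - y - z) \<le> cmod x + cmod y + cmod z" for x y z :: complex
      using norm_triangle_ineq4[of "x - y" z] norm_triangle_ineq4[of x y] by linarith
    ultimately have "cmod (\<integral>x. indicator {b<..1} x *\<^sub>R ?h x \<partial>lborel) \<le> cmod (?F 1) + cmod (?F b) + cmod (\<integral>x. indicator {b..1} x *\<^sub>R ?r x \<partial>lborel)"
      unfolding eq by (simp only: ab3)
    also have "\<dots> \<le> 2 * (b powr (\<beta> - 1) / \<bar>\<omega>\<bar>)"
      using r unfolding nF by simp
    also have "b powr (\<beta> - 1) / \<bar>\<omega>\<bar> = b powr \<beta>"
      using b by (simp add: powr_diff bw)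
    also have "2 * b powr \<beta> \<le> 2 * \<bar>\<omega>\<bar> powr (- \<beta>)" using bpow by simp
    finally show ?thesis .
  qed
  have "(\<integral>x. ?h x \<partial>lborel) = (\<integral>x. indicator {0..b} x *\<^sub>R ?h x + indicator {b<..1} x *\<^sub>R ?h x \<partial>lborel)"
    by (rule Bochner_Integration.integral_cong[OF refl split])
  also have "\<dots> = (\<integral>x. indicator {0..b} x *\<^sub>R ?h x \<partial>lborel) + (\<integral>x. indicator {b<..1} x *\<^sub>R ?h x \<partial>lborel)"
    by (rule Bochner_Integration.integral_add[OF i1])
  finally have "cmod (\<integral>x. ?h x \<partial>lborel) \<le> \<bar>\<omega>\<bar> powr (- \<beta>) / \<beta> + 2 * \<bar>\<omega>\<bar> powr (- \<beta>)"
    using norm_triangle_mono[OF 1 2] by (simp only:)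
  then show ?thesis by (simp add: algebra_simps)
qed

text \<open>The kernel of the two-sided fractional integral, up to the factor \<open>1 / Gamma \<beta>\<close>.\<close>

definition ker :: "real \<Rightarrow> real \<Rightarrow> real \<Rightarrow> real" where
  "ker \<beta> \<theta> z = (if 0 < z then \<theta> else 1 - \<theta>) * \<bar>z\<bar> powr (\<beta> - 1)"

text \<open>
  Points of the unit interval have a distance below 1, so the kernel may be cut off there; unlike
  the full kernel the result is integrable.
\<close>

definition cut_ker :: "real \<Rightarrow> real \<Rightarrow> real \<Rightarrow> real" where
  "cut_ker \<beta> \<theta> z = \<theta> * one_sided \<beta> z + (1 - \<theta>) * one_sided \<beta> (- z)"

lemma ker_measurable [measurable]: "ker \<beta> \<theta> \<in> borel_measurable borel"
  unfolding ker_def by measurable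

lemma cut_ker_measurable [measurable]: "cut_ker \<beta> \<theta> \<in> borel_measurable borel"
  unfolding cut_ker_def by measurable

lemma ker_nonneg: "0 \<le> \<theta> \<Longrightarrow> \<theta> \<le> 1 \<Longrightarrow> 0 \<le> ker \<beta> \<theta> z"
  by (simp add: ker_def)

lemma cut_ker_eq: "\<bar>z\<bar> \<le> 1 \<Longrightarrow> cut_ker \<beta> \<theta> z = ker \<beta> \<theta> z"
  by (auto simp: cut_ker_def ker_def one_sided_def indicator_def)

lemma integrable_one_sided_minus:
  assumes "0 < \<beta>" shows "integrable lborel (\<lambda>z. one_sided \<beta> (- z))"
  using lborel_integrable_real_affine[OF integrable_one_sided[OF assms], of "-1" 0] by simp

lemma integrable_cut_ker: "0 < \<beta> \<Longrightarrow> integrable lborel (cut_ker \<beta> \<theta>)"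
  unfolding cut_ker_def
  by (intro Bochner_Integration.integrable_add integrable_mult_right integrable_one_sided integrable_one_sided_minus)

lemma fourier_cut_ker_le:
  assumes \<beta>: "0 < \<beta>" "\<beta> < 1" and \<theta>: "0 \<le> \<theta>" "\<theta> \<le> 1" and \<omega>: "\<omega> \<noteq> 0"
  shows "cmod (fourier (cut_ker \<beta> \<theta>) \<omega>) \<le> (1 / \<beta> + 2) * \<bar>\<omega>\<bar> powr (- \<beta>)"
proof -
  let ?I = "\<lambda>\<omega>. \<integral>x. cis (\<omega> * x) * complex_of_real (one_sided \<beta> x) \<partial>lborel"
  have i1: "integrable lborel (\<lambda>x. cis (- \<omega> * x) * complex_of_real (one_sided \<beta> x))"
    by (rule integrable_cis_mult[OF integrable_one_sided[OF \<beta>(1)]])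
  have i2: "integrable lborel (\<lambda>x. cis (- \<omega> * x) * complex_of_real (one_sided \<beta> (- x)))"
    by (rule integrable_cis_mult[OF integrable_one_sided_minus[OF \<beta>(1)]])
  have r: "(\<integral>x. cis (- \<omega> * x) * complex_of_real (one_sided \<beta> (- x)) \<partial>lborel) = ?I \<omega>"
    using lborel_integral_real_affine[of "-1" "\<lambda>x. cis (\<omega> * x) * complex_of_real (one_sided \<beta> x)" 0] by simp
  have "fourier (cut_ker \<beta> \<theta>) \<omega>
    = (\<integral>z. complex_of_real \<theta> * (cis (- \<omega> * z) * complex_of_real (one_sided \<beta> z)) + complex_of_real (1 - \<theta>) * (cis (- \<omega> * z) * complex_of_real (one_sided \<beta> (- z))) \<partial>lborel)"
    unfolding fourier_lborel[OF cut_ker_measurable]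
    by (rule Bochner_Integration.integral_cong) (auto simp: cut_ker_def algebra_simps)
  also have "\<dots> = complex_of_real \<theta> * ?I (- \<omega>) + complex_of_real (1 - \<theta>) * ?I \<omega>"
    using i1 i2 r by simp
  finally have "cmod (fourier (cut_ker \<beta> \<theta>) \<omega>) \<le>
      cmod (complex_of_real \<theta> * ?I (- \<omega>)) + cmod (complex_of_real (1 - \<theta>) * ?I \<omega>)"
    by (simp only: norm_triangle_ineq)
  also have "\<dots> = \<theta> * cmod (?I (- \<omega>)) + (1 - \<theta>) * cmod (?I \<omega>)"
    using \<theta> by (simp only: norm_mult norm_of_real)
  also have "\<dots> \<le> \<theta> * ((1 / \<beta> + 2) * \<bar>\<omega>\<bar> powr (- \<beta>)) + (1 - \<theta>) * ((1 / \<beta> + 2) * \<bar>\<omega>\<bar> powr (- \<beta>))"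
    using fourier_one_sided_le[OF \<beta>, of \<omega>] fourier_one_sided_le[OF \<beta>, of "- \<omega>"] \<omega> \<theta>
    by (intro add_mono mult_left_mono) auto
  also have "\<dots> = (1 / \<beta> + 2) * \<bar>\<omega>\<bar> powr (- \<beta>)" unfolding distrib_right[symmetric] by simp
  finally show ?thesis .
qed

section \<open>Fourier transforms of test functions\<close>

lemma test_fun_integrable_lborel:
  assumes "\<phi> \<in> test_fun" shows "integrable lborel \<phi>"
proof -
  obtain B where B: "0 \<le> B" "\<And>x. \<bar>\<phi> x\<bar> \<le> B" using test_fun_bounded[OF assms] by blast
  show ?thesis
  proof (rule Bochner_Integration.integrable_bound)
    show "integrable lborel (\<lambda>x. B * indicator {0..1::real} x)" by simp
    show "\<phi> \<in> borel_measurable lborel" using test_fun_borel[OF assms] by simp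
    show "AE x in lborel. norm (\<phi> x) \<le> norm (B * indicator {0..1} x)"
    proof (rule AE_I2)
      fix x show "norm (\<phi> x) \<le> norm (B * indicator {0..1} x)"
        using B test_fun_zero[OF assms, of x] by (cases "x \<in> {0<..<1}") auto
    qed
  qed
qed

lemma integrable_fourier:
  assumes "integrable lebesgue w"
  shows "integrable lebesgue (\<lambda>x. cis (c * x) * complex_of_real (w x))"
proof (rule Bochner_Integration.integrable_bound[OF assms])
  have "(\<lambda>x. cis (c * x)) \<in> borel_measurable lborel" by measurable
  then have "(\<lambda>x. cis (c * x)) \<in> borel_measurable lebesgue" by (rule measurable_completion)
  then show "(\<lambda>x. cis (c * x) * complex_of_real (w x)) \<in> borel_measurable lebesgue"
    using assms by (intro borel_measurable_times) auto
qed (simp add: norm_mult)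

lemma fourier_le: "integrable lebesgue w \<Longrightarrow> cmod (fourier w \<omega>) \<le> (\<integral>x. \<bar>w x\<bar> \<partial>lebesgue)"
  unfolding fourier_def by (rule order_trans[OF integral_norm_bound]) (simp add: norm_mult)

lemma fourier_diff:
  assumes "integrable lebesgue v" "integrable lebesgue w"
  shows "fourier (\<lambda>x. v x - w x) \<omega> = fourier v \<omega> - fourier w \<omega>"
  using integrable_fourier[OF assms(1), of "- \<omega>"] integrable_fourier[OF assms(2), of "- \<omega>"]
  by (simp add: fourier_def right_diff_distrib)

lemma fourier_measurable:
  assumes w: "integrable lebesgue w" shows "fourier w \<in> borel_measurable borel"
proof (rule borel_measurable_continuous_onI)
  show "continuous_on UNIV (fourier w)"
    unfolding continuous_on_sequentially
  proof safe
    fix X and a :: real assume X: "X \<longlonglongrightarrow> a"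
    have "(\<lambda>n. \<integral>x. cis (- (X n * x)) * complex_of_real (w x) \<partial>lebesgue) \<longlonglongrightarrow>
      (\<integral>x. cis (- (a * x)) * complex_of_real (w x) \<partial>lebesgue)"
    proof (rule integral_dominated_convergence[where w="\<lambda>x. \<bar>w x\<bar>"])
      show "(\<lambda>x. cis (- (a * x)) * complex_of_real (w x)) \<in> borel_measurable lebesgue"
        using integrable_fourier[OF w, of "- a"] by simp
      show "(\<lambda>x. cis (- (X n * x)) * complex_of_real (w x)) \<in> borel_measurable lebesgue" for n
        using integrable_fourier[OF w, of "- X n"] by simp
      show "AE x in lebesgue. (\<lambda>n. cis (- (X n * x)) * complex_of_real (w x)) \<longlonglongrightarrow> cis (- (a * x)) * complex_of_real (w x)"
      proof (rule AE_I2)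
        fix x
        have "(\<lambda>n. cis (- (X n * x))) \<longlonglongrightarrow> cis (- (a * x))"
          by (intro tendsto_intros X)
        then show "(\<lambda>n. cis (- (X n * x)) * complex_of_real (w x)) \<longlonglongrightarrow> cis (- (a * x)) * complex_of_real (w x)"
          by (rule tendsto_mult_right)
      qed
    qed (use w in \<open>auto simp: norm_mult\<close>)
    then show "(fourier w \<circ> X) \<longlonglongrightarrow> fourier w a" by (simp add: fourier_def o_def)
  qed
qed

lemma test_fun_integrable_lebesgue: "\<phi> \<in> test_fun \<Longrightarrow> integrable lebesgue \<phi>"
  using test_fun_integrable_lborel[of \<phi>] test_fun_borel[of \<phi>] by (subst integrable_completion) auto

lemma fourier_deriv:
  assumes \<phi>: "\<phi> \<in> test_fun"
  shows "fourier (deriv \<phi>) \<omega> = \<i> * complex_of_real \<omega> * fourier \<phi> \<omega>"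
proof -
  note d = test_fun_deriv[OF \<phi>]
  let ?a = "\<lambda>x. cis (- \<omega> * x) * complex_of_real (\<phi> x)"
  let ?b = "\<lambda>x. cis (- \<omega> * x) * complex_of_real (deriv \<phi> x)"
  have dF: "(?a has_vector_derivative ?b x - \<i> * complex_of_real \<omega> * ?a x) (at x within {0..1})" for x
  proof -
    have "((\<lambda>x. complex_of_real (\<phi> x)) has_vector_derivative complex_of_real (deriv \<phi> x)) (at x within {0..1})"
      by (rule has_vector_derivative_of_real[OF has_field_derivative_at_within[OF test_fun_DERIV[OF \<phi>]]])
    from has_vector_derivative_mult[OF has_vector_derivative_cis[of "- \<omega>"] this] show ?thesis by (simp add: algebra_simps)
  qed
  have "(\<integral>x. indicator {0..1} x *\<^sub>R (?b x - \<i> * complex_of_real \<omega> * ?a x) \<partial>lborel) = ?a 1 - ?a 0"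
    by (rule integral_FTC_atLeastAtMost[OF _ dF])
      (auto intro!: continuous_intros test_fun_cont[OF \<phi>] test_fun_cont[OF d])
  also have "\<dots> = 0" using test_fun_zero[OF \<phi>, of 0] test_fun_zero[OF \<phi>, of 1] by simp
  also have "(\<lambda>x. indicator {0..1} x *\<^sub>R (?b x - \<i> * complex_of_real \<omega> * ?a x)) = (\<lambda>x. ?b x - \<i> * complex_of_real \<omega> * ?a x)"
  proof
    fix x show "indicator {0..1} x *\<^sub>R (?b x - \<i> * complex_of_real \<omega> * ?a x) = ?b x - \<i> * complex_of_real \<omega> * ?a x"
      using test_fun_zero[OF \<phi>, of x] test_fun_zero[OF d, of x] by (cases "x \<in> {0..1}") auto
  qed
  finally have "(\<integral>x. ?b x \<partial>lborel) = \<i> * complex_of_real \<omega> * (\<integral>x. ?a x \<partial>lborel)"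
    using integrable_cis_mult[OF test_fun_integrable_lborel[OF \<phi>], of "- \<omega>"]
      integrable_cis_mult[OF test_fun_integrable_lborel[OF d], of "- \<omega>"] by simp
  then show ?thesis
    by (simp add: fourier_lborel test_fun_borel \<phi> d)
qed

text \<open>The integral over all frequencies is the square of the homogeneous part of the Sobolev norm.\<close>

abbreviation hom_density :: "real \<Rightarrow> (real \<Rightarrow> real) \<Rightarrow> real \<Rightarrow> real" where
  "hom_density \<mu> w \<omega> \<equiv> (\<bar>\<omega>\<bar> powr \<mu> * cmod (fourier w \<omega>))\<^sup>2"

text \<open>
  Both the transform of \<open>\<phi>\<close> and, as that of a second derivative, its product with \<open>\<omega>\<^sup>2\<close> are bounded.
\<close>

lemma fourier_test_fun_square_integrable:
  assumes \<phi>: "\<phi> \<in> test_fun" and \<mu>: "0 \<le> \<mu>" "\<mu> \<le> 1"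
  shows "integrable lebesgue (\<lambda>\<omega>. hom_density \<mu> \<phi> \<omega>)"
proof -
  define A where "A = (\<integral>x. \<bar>\<phi> x\<bar> \<partial>lebesgue)"
  define B where "B = (\<integral>x. \<bar>deriv (deriv \<phi>) x\<bar> \<partial>lebesgue)"
  have A: "cmod (fourier \<phi> \<omega>) \<le> A" for \<omega>
    unfolding A_def by (rule fourier_le[OF test_fun_integrable_lebesgue[OF \<phi>]])
  have B: "\<omega>\<^sup>2 * cmod (fourier \<phi> \<omega>) \<le> B" for \<omega>
  proof -
    have "cmod (fourier (deriv (deriv \<phi>)) \<omega>) = \<omega>\<^sup>2 * cmod (fourier \<phi> \<omega>)"
      unfolding fourier_deriv[OF test_fun_deriv[OF \<phi>]] fourier_deriv[OF \<phi>]
      by (simp add: norm_mult power2_eq_square)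
    then show ?thesis
      using fourier_le[OF test_fun_integrable_lebesgue[OF test_fun_deriv[OF test_fun_deriv[OF \<phi>]]], of \<omega>] by (simp add: B_def)
  qed
  have le: "hom_density \<mu> \<phi> \<omega> \<le> 2 * (A\<^sup>2 + B\<^sup>2) * inverse (1 + \<omega>\<^sup>2)" for \<omega>
  proof -
    have "hom_density \<mu> \<phi> \<omega> * (1 + \<omega>\<^sup>2) \<le> 2 * (A\<^sup>2 + B\<^sup>2)"
    proof (cases "\<bar>\<omega>\<bar> \<le> 1")
      case True
      have "\<bar>\<omega>\<bar> powr \<mu> * cmod (fourier \<phi> \<omega>) \<le> 1 * A"
        using True \<mu> A by (intro mult_mono powr_le1) auto
      then have "hom_density \<mu> \<phi> \<omega> \<le> A\<^sup>2" by (intro power_mono) auto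
      moreover have "1 + \<omega>\<^sup>2 \<le> 2" using True by (simp add: abs_square_le_1)
      ultimately have "hom_density \<mu> \<phi> \<omega> * (1 + \<omega>\<^sup>2) \<le> A\<^sup>2 * 2"
        by (intro mult_mono) auto
      then show ?thesis using zero_le_power2[of B] unfolding distrib_left by linarith
    next
      case False
      then have 1: "1 \<le> \<bar>\<omega>\<bar>" by simp
      have "\<bar>\<omega>\<bar> powr \<mu> \<le> \<bar>\<omega>\<bar> powr 1" using 1 \<mu> by (intro powr_mono) auto
      then have "\<bar>\<omega>\<bar> powr \<mu> \<le> \<bar>\<omega>\<bar>" using 1 by simp
      then have "hom_density \<mu> \<phi> \<omega> \<le> (\<bar>\<omega>\<bar> * cmod (fourier \<phi> \<omega>))\<^sup>2"
        by (intro power_mono mult_right_mono) auto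
      moreover have "1 + \<omega>\<^sup>2 \<le> 2 * \<omega>\<^sup>2" using one_le_power[OF 1, of 2] by simp
      ultimately have "hom_density \<mu> \<phi> \<omega> * (1 + \<omega>\<^sup>2) \<le> (\<bar>\<omega>\<bar> * cmod (fourier \<phi> \<omega>))\<^sup>2 * (2 * \<omega>\<^sup>2)"
        by (intro mult_mono) auto
      also have "\<dots> = 2 * (\<omega>\<^sup>2 * cmod (fourier \<phi> \<omega>))\<^sup>2" by (simp add: power_mult_distrib power2_eq_square mult_ac)
      also have "\<dots> \<le> 2 * B\<^sup>2" using B[of \<omega>] by (intro mult_left_mono power_mono) auto
      finally show ?thesis using zero_le_power2[of A] unfolding distrib_left by linarith
    qed
    moreover have "0 < 1 + \<omega>\<^sup>2" by (simp add: add_pos_nonneg)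
    ultimately show ?thesis by (simp add: field_simps)
  qed
  have fm: "fourier \<phi> \<in> borel_measurable borel" by (rule fourier_measurable[OF test_fun_integrable_lebesgue[OF \<phi>]])
  have "integrable lborel (\<lambda>\<omega>. hom_density \<mu> \<phi> \<omega>)"
  proof (rule Bochner_Integration.integrable_bound)
    have "integrable lborel (\<lambda>x::real. inverse (1 + x\<^sup>2))"
      using integrable_inverse_1_plus_square by (simp add: set_integrable_def)
    then show "integrable lborel (\<lambda>\<omega>. 2 * (A\<^sup>2 + B\<^sup>2) * inverse (1 + \<omega>\<^sup>2))" by simp
    show "(\<lambda>\<omega>. hom_density \<mu> \<phi> \<omega>) \<in> borel_measurable lborel" using fm by measurable
    show "AE \<omega> in lborel. norm (hom_density \<mu> \<phi> \<omega>) \<le> norm (2 * (A\<^sup>2 + B\<^sup>2) * inverse (1 + \<omega>\<^sup>2))"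
      by (intro AE_I2) (metis abs_ge_self abs_power2 le order_trans real_norm_def)
  qed
  then show ?thesis
    by (subst integrable_completion) (use fm in auto)
qed

lemma test_fun_L2: "\<phi> \<in> test_fun \<Longrightarrow> \<phi> \<in> L2"
  by (metis L2_bounded(1) AE_I2 measurable_unit test_fun_borel test_fun_bounded)

lemma test_fun_H0:
  assumes \<phi>: "\<phi> \<in> test_fun" and \<mu>: "0 \<le> \<mu>" "\<mu> \<le> 1" shows "\<phi> \<in> H0 \<mu>"
proof -
  have z: "zero_ext \<phi> = \<phi>" using test_fun_zero[OF \<phi>] by (auto simp: zero_ext_def)
  show ?thesis
    using test_fun_L2[OF \<phi>] fourier_test_fun_square_integrable[OF \<phi> \<mu>] \<phi>
    by (auto simp: H0_def z Hmu_norm_def fourier_def[of "\<lambda>x. 0"] intro!: exI[of _ "\<lambda>_. \<phi>"])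
qed

section \<open>Fractional integrals of derivatives of test functions\<close>

lemma ker_integral_cut:
  assumes g: "g \<in> test_fun" and x: "x \<in> {0<..<1}"
  shows "(\<integral>s. ker \<beta> \<theta> (x - s) * g s \<partial>unit_ivl) = (\<integral>z. cut_ker \<beta> \<theta> z * g (x - z) \<partial>lborel)"
proof -
  have [measurable]: "g \<in> borel_measurable borel" by (rule test_fun_borel[OF g])
  have "(\<integral>s. ker \<beta> \<theta> (x - s) * g s \<partial>unit_ivl) = (\<integral>s. indicator {0<..<1} s *\<^sub>R (ker \<beta> \<theta> (x - s) * g s) \<partial>lborel)"
    unfolding set_lebesgue_integral_def[symmetric] by (rule integral_unit_lborel) measurable
  also have "\<dots> = (\<integral>s. cut_ker \<beta> \<theta> (x - s) * g s \<partial>lborel)"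
  proof (rule Bochner_Integration.integral_cong[OF refl])
    fix s
    show "indicator {0<..<1} s *\<^sub>R (ker \<beta> \<theta> (x - s) * g s) = cut_ker \<beta> \<theta> (x - s) * g s"
    proof (cases "s \<in> {0<..<1}")
      case True
      then have "\<bar>x - s\<bar> \<le> 1" using x by auto
      then show ?thesis using True by (simp add: cut_ker_eq)
    next
      case False
      then show ?thesis using test_fun_zero[OF g, of s] by simp
    qed
  qed
  also have "\<dots> = (\<integral>z. cut_ker \<beta> \<theta> z * g (x - z) \<partial>lborel)"
    using lborel_integral_real_affine[of "-1" "\<lambda>s. cut_ker \<beta> \<theta> (x - s) * g s" x] by simp
  finally show ?thesis .
qed

text \<open>
  On the unit interval the left hand side is the convolution of \<open>deriv \<phi>\<close> with the cut off kernel.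
  Its Fourier transform is at most a multiple of \<open>\<bar>\<omega>\<bar> powr (- \<beta>)\<close>, from the kernel, times \<open>\<bar>\<omega>\<bar>\<close>, from the
  derivative, times the transform of \<open>\<phi>\<close>.
\<close>

lemma frac_deriv_L2_le:
  assumes \<beta>: "0 < \<beta>" "\<beta> < 1" and \<theta>: "0 \<le> \<theta>" "\<theta> \<le> 1" and \<phi>: "\<phi> \<in> test_fun"
  shows "(\<integral>x. (\<integral>s. ker \<beta> \<theta> (x - s) * deriv \<phi> s \<partial>unit_ivl)\<^sup>2 \<partial>unit_ivl) \<le>
    (1 / \<beta> + 2)\<^sup>2 / (2 * pi) * (\<integral>\<omega>. hom_density (1 - \<beta>) \<phi> \<omega> \<partial>lebesgue)"
proof -
  define g where "g = deriv \<phi>"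
  have g: "g \<in> test_fun" unfolding g_def by (rule test_fun_deriv[OF \<phi>])
  have [measurable]: "g \<in> borel_measurable borel" by (rule test_fun_borel[OF g])
  have gi: "integrable lborel g" by (rule test_fun_integrable_lborel[OF g])
  obtain B where B: "0 \<le> B" "\<And>x. \<bar>g x\<bar> \<le> B" using test_fun_bounded[OF g] by blast
  let ?k = "cut_ker \<beta> \<theta>"
  have ki: "integrable lborel ?k" by (rule integrable_cut_ker[OF \<beta>(1)])
  define f where "f x = (\<integral>z. ?k z * g (x - z) \<partial>lborel)" for x
  have kg: "integrable lborel (\<lambda>z. ?k z * g (x - z))" for x
    by (rule Bochner_Integration.integrable_bound[where f="\<lambda>z. ?k z * B"])
      (use ki B in \<open>auto simp: abs_mult intro!: mult_left_mono\<close>)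
  have f_eq: "(\<integral>s. ker \<beta> \<theta> (x - s) * g s \<partial>unit_ivl) = f x" if "x \<in> {0<..<1}" for x
    unfolding f_def by (rule ker_integral_cut[OF g that])
  have fb: "\<bar>f x\<bar> \<le> B * (\<integral>z. \<bar>?k z\<bar> \<partial>lborel)" for x
  proof -
    have "\<bar>f x\<bar> \<le> (\<integral>z. \<bar>?k z * g (x - z)\<bar> \<partial>lborel)" unfolding f_def by (rule integral_abs_bound)
    also have "\<dots> \<le> (\<integral>z. B * \<bar>?k z\<bar> \<partial>lborel)"
      by (rule integral_mono[OF integrable_abs[OF kg]])
        (use ki B in \<open>auto simp: abs_mult mult.commute[of B] intro!: mult_left_mono\<close>)
    finally show ?thesis by simp
  qed
  have fc: "continuous_on UNIV f"
    unfolding continuous_on_sequentially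
  proof safe
    fix X and a :: real assume X: "X \<longlonglongrightarrow> a"
    have "(\<lambda>n. \<integral>z. ?k z * g (X n - z) \<partial>lborel) \<longlonglongrightarrow> (\<integral>z. ?k z * g (a - z) \<partial>lborel)"
    proof (rule integral_dominated_convergence[where w="\<lambda>z. B * \<bar>?k z\<bar>"])
      show "AE z in lborel. (\<lambda>n. ?k z * g (X n - z)) \<longlonglongrightarrow> ?k z * g (a - z)"
      proof (rule AE_I2)
        fix z
        have "isCont g (a - z)" using test_fun_cont[OF g, of UNIV] by (simp add: continuous_on_eq_continuous_at)
        then have "(\<lambda>n. g (X n - z)) \<longlonglongrightarrow> g (a - z)"
          by (rule isCont_tendsto_compose) (intro tendsto_diff X tendsto_const)
        then show "(\<lambda>n. ?k z * g (X n - z)) \<longlonglongrightarrow> ?k z * g (a - z)" by (rule tendsto_mult_left)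
      qed
      show "AE z in lborel. norm (?k z * g (X n - z)) \<le> B * \<bar>?k z\<bar>" for n
        using B by (auto simp: abs_mult mult.commute[of B] intro!: mult_left_mono)
    qed (use ki in auto)
    then show "(f \<circ> X) \<longlonglongrightarrow> f a" by (simp add: f_def o_def)
  qed
  let ?H = "\<lambda>z x. ?k z * g (x - z)"
  have gshift: "integrable lborel (\<lambda>x. g (x - z))" "(\<integral>x. \<bar>g (x - z)\<bar> \<partial>lborel) = (\<integral>x. \<bar>g x\<bar> \<partial>lborel)" for z
    using lborel_integrable_real_affine[OF gi, of 1 "- z"] lborel_integral_real_affine[of 1 "\<lambda>x. \<bar>g x\<bar>" "- z"]
    by (simp_all add: add.commute)
  have Hi: "integrable (lborel \<Otimes>\<^sub>M lborel) (case_prod ?H)"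
  proof (rule lborel_pair.Fubini_integrable)
    have "(\<integral>x. norm (case (z, x) of (z, x) \<Rightarrow> ?H z x) \<partial>lborel) = \<bar>?k z\<bar> * (\<integral>x. \<bar>g x\<bar> \<partial>lborel)" for z
      by (simp add: abs_mult gshift)
    then show "integrable lborel (\<lambda>z. \<integral>x. norm (case (z, x) of (z, x) \<Rightarrow> ?H z x) \<partial>lborel)"
      using ki by simp
    show "AE z in lborel. integrable lborel (\<lambda>x. case (z, x) of (z, x) \<Rightarrow> ?H z x)"
      using gshift by simp
  qed measurable
  have fi: "integrable lborel f"
    unfolding f_def by (rule lborel_pair.integrable_snd[OF Hi])
  have fb0: "f \<in> borel_measurable borel" using fi by auto
  have fhat: "fourier f \<omega> = fourier ?k \<omega> * fourier g \<omega>" for \<omega>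
  proof -
    let ?C = "\<lambda>z x. cis (- (\<omega> * x)) * complex_of_real (?H z x)"
    have Ci: "integrable (lborel \<Otimes>\<^sub>M lborel) (case_prod ?C)"
    proof (rule Bochner_Integration.integrable_bound[OF Hi])
      show "AE p in lborel \<Otimes>\<^sub>M lborel. norm (case_prod ?C p) \<le> norm (case_prod ?H p)"
        by (rule AE_I2) (auto simp: norm_mult)
    qed measurable
    have "fourier f \<omega> = (\<integral>x. (\<integral>z. ?C z x \<partial>lborel) \<partial>lborel)"
      unfolding fourier_lborel[OF fb0]
    proof (rule Bochner_Integration.integral_cong[OF refl])
      fix x
      have "complex_of_real (f x) = (\<integral>z. complex_of_real (?H z x) \<partial>lborel)"
        unfolding f_def by (rule integral_complex_of_real[symmetric])
      then show "cis (- (\<omega> * x)) * complex_of_real (f x) = (\<integral>z. ?C z x \<partial>lborel)"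
        by simp
    qed
    also have "\<dots> = (\<integral>z. (\<integral>x. ?C z x \<partial>lborel) \<partial>lborel)"
      using lborel_pair.Fubini_integral[OF Ci] by simp
    also have "\<dots> = (\<integral>z. cis (- (\<omega> * z)) * complex_of_real (?k z) * fourier g \<omega> \<partial>lborel)"
    proof (rule Bochner_Integration.integral_cong[OF refl])
      fix z
      have "(\<integral>x. ?C z x \<partial>lborel) = (\<integral>y. ?C z (z + 1 * y) \<partial>lborel)"
        using lborel_integral_real_affine[of 1 "?C z" z] by simp
      also have "\<dots> = (\<integral>y. (cis (- (\<omega> * z)) * complex_of_real (?k z)) * (cis (- (\<omega> * y)) * complex_of_real (g y)) \<partial>lborel)"
      proof (rule Bochner_Integration.integral_cong[OF refl])
        fix y
        have "cis (- (\<omega> * (z + 1 * y))) = cis (- (\<omega> * z)) * cis (- (\<omega> * y))"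
          by (simp add: cis_mult distrib_left)
        then show "?C z (z + 1 * y) = (cis (- (\<omega> * z)) * complex_of_real (?k z)) * (cis (- (\<omega> * y)) * complex_of_real (g y))"
          by simp
      qed
      also have "\<dots> = cis (- (\<omega> * z)) * complex_of_real (?k z) * fourier g \<omega>"
        by (simp add: fourier_lborel)
      finally show "(\<integral>x. ?C z x \<partial>lborel) = cis (- (\<omega> * z)) * complex_of_real (?k z) * fourier g \<omega>" .
    qed
    also have "\<dots> = fourier ?k \<omega> * fourier g \<omega>" by (simp add: fourier_lborel)
    finally show ?thesis .
  qed
  define c where "c = 1 / \<beta> + 2"
  have c: "0 \<le> c" using \<beta> by (simp add: c_def)
  let ?w = "\<lambda>\<omega>. hom_density (1 - \<beta>) \<phi> \<omega>"
  have le: "(cmod (fourier f \<omega>))\<^sup>2 \<le> c\<^sup>2 * ?w \<omega>" for \<omega>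
  proof (cases "\<omega> = 0")
    case True
    then show ?thesis unfolding fhat g_def fourier_deriv[OF \<phi>] by simp
  next
    case False
    have "cmod (fourier f \<omega>) \<le> (c * \<bar>\<omega>\<bar> powr (- \<beta>)) * (\<bar>\<omega>\<bar> * cmod (fourier \<phi> \<omega>))"
      unfolding fhat g_def fourier_deriv[OF \<phi>] norm_mult
      using fourier_cut_ker_le[OF \<beta> \<theta> False, folded c_def] c by (intro mult_mono) auto
    also have "\<dots> = c * (\<bar>\<omega>\<bar> powr (1 - \<beta>) * cmod (fourier \<phi> \<omega>))"
      using False by (simp add: powr_diff powr_minus_divide)
    finally have "(cmod (fourier f \<omega>))\<^sup>2 \<le> (c * (\<bar>\<omega>\<bar> powr (1 - \<beta>) * cmod (fourier \<phi> \<omega>)))\<^sup>2"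
      by (rule power_mono) simp
    then show ?thesis by (simp add: power_mult_distrib)
  qed
  have fm: "fourier \<phi> \<in> borel_measurable borel" by (rule fourier_measurable[OF test_fun_integrable_lebesgue[OF \<phi>]])
  have wm: "?w \<in> borel_measurable borel" using fm by measurable
  have "integrable lebesgue ?w"
    using \<beta> by (intro fourier_test_fun_square_integrable[OF \<phi>]) auto
  then have wi: "integrable lborel ?w" by (subst (asm) integrable_completion) (use wm in simp_all)
  have Fi: "integrable lborel (\<lambda>\<omega>. (cmod (fourier f \<omega>))\<^sup>2)"
  proof (rule Bochner_Integration.integrable_bound)
    show "integrable lborel (\<lambda>\<omega>. c\<^sup>2 * ?w \<omega>)" using wi by simp
    have "integrable lebesgue f" using fi fb0 by (subst integrable_completion) simp_all
    then have "fourier f \<in> borel_measurable borel" by (rule fourier_measurable)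
    then show "(\<lambda>\<omega>. (cmod (fourier f \<omega>))\<^sup>2) \<in> borel_measurable lborel"
      by measurable
    show "AE \<omega> in lborel. norm ((cmod (fourier f \<omega>))\<^sup>2) \<le> norm (c\<^sup>2 * ?w \<omega>)"
      using le by (intro AE_I2) simp
  qed
  have f2: "integrable lborel (\<lambda>x. (f x)\<^sup>2)"
  proof (rule Bochner_Integration.integrable_bound[where f="\<lambda>x. B * (\<integral>z. \<bar>?k z\<bar> \<partial>lborel) * f x"])
    show "AE x in lborel. norm ((f x)\<^sup>2) \<le> norm (B * (\<integral>z. \<bar>?k z\<bar> \<partial>lborel) * f x)"
    proof (rule AE_I2)
      fix x
      have "\<bar>f x\<bar> * \<bar>f x\<bar> \<le> \<bar>B * (\<integral>z. \<bar>?k z\<bar> \<partial>lborel)\<bar> * \<bar>f x\<bar>"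
        using fb[of x] by (intro mult_right_mono) auto
      then show "norm ((f x)\<^sup>2) \<le> norm (B * (\<integral>z. \<bar>?k z\<bar> \<partial>lborel) * f x)"
        by (simp add: power2_eq_square abs_mult)
    qed
  qed (use fi in auto)
  have "(\<integral>x. (\<integral>s. ker \<beta> \<theta> (x - s) * g s \<partial>unit_ivl)\<^sup>2 \<partial>unit_ivl) = (\<integral>x. (f x)\<^sup>2 \<partial>unit_ivl)"
    by (rule Bochner_Integration.integral_cong) (auto simp: f_eq)
  also have "\<dots> = (\<integral>x. indicator {0<..<1} x *\<^sub>R (f x)\<^sup>2 \<partial>lborel)"
    unfolding set_lebesgue_integral_def[symmetric] by (rule integral_unit_lborel) (use f2 in auto)
  also have "\<dots> \<le> (\<integral>x. (f x)\<^sup>2 \<partial>lborel)"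
    by (rule integral_mono[OF integrable_mult_indicator[OF _ f2] f2]) (auto simp: indicator_def)
  also have "\<dots> \<le> (\<integral>\<omega>. (cmod (fourier f \<omega>))\<^sup>2 \<partial>lborel) / (2 * pi)"
    using Plancherel_le[OF fi fc fb Fi] by (simp add: field_simps)
  also have "\<dots> \<le> (\<integral>\<omega>. c\<^sup>2 * ?w \<omega> \<partial>lborel) / (2 * pi)"
    using wi le by (intro divide_right_mono integral_mono[OF Fi]) auto
  also have "\<dots> = c\<^sup>2 / (2 * pi) * (\<integral>\<omega>. ?w \<omega> \<partial>lborel)" by simp
  also have "(\<integral>\<omega>. ?w \<omega> \<partial>lborel) = (\<integral>\<omega>. ?w \<omega> \<partial>lebesgue)"
    by (rule integral_completion[symmetric]) (use wm in simp)
  finally show ?thesis by (simp add: g_def c_def)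
qed

section \<open>Pairing fractional integrals with the solution of the Abel equation\<close>

text \<open>
  One integral in place of the two in \<open>frac_int\<close>; for integrable \<open>g\<close> they agree almost everywhere up to
  the factor \<open>Gamma \<beta>\<close>, see \<open>frac_int_AE\<close>.
\<close>

definition frac_conv :: "real \<Rightarrow> real \<Rightarrow> (real \<Rightarrow> real) \<Rightarrow> real \<Rightarrow> real" where
  "frac_conv \<beta> \<theta> g x = (\<integral>s. ker \<beta> \<theta> (x - s) * g s \<partial>unit_ivl)"

text \<open>
  The function \<open>\<psi>\<close> is a solution of the generalised Abel equation for the adjoint of the fractional
  integral: its kernel is integrated over \<open>x\<close>, that of \<open>frac_conv\<close> over \<open>s\<close>. The lower bound 1 lets
  weighted integrals control unweighted ones.
\<close>

locale abel_kernel =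
  fixes \<beta> \<theta> c :: real and \<psi> :: "real \<Rightarrow> real"
  assumes \<beta>: "0 < \<beta>" "\<beta> < 1" and \<theta>: "0 \<le> \<theta>" "\<theta> \<le> 1" and c: "0 < c"
    and \<psi>_borel [measurable]: "\<psi> \<in> borel_measurable borel"
    and \<psi>_ge: "\<And>x. x \<in> {0<..<1} \<Longrightarrow> 1 \<le> \<psi> x"
    and \<psi>_L2: "\<psi> \<in> L2"
    and abel: "\<And>s. s \<in> {0<..<1} \<Longrightarrow> (\<integral>\<^sup>+x. ennreal (ker \<beta> \<theta> (x - s) * \<psi> x) \<partial>unit_ivl) = ennreal c"

lemma abel_kernel_exists:
  assumes \<beta>: "0 < \<beta>" "\<beta> < 1 / 2" and \<theta>: "0 \<le> \<theta>" "\<theta> \<le> 1"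
  shows "\<exists>c \<psi>. abel_kernel \<beta> \<theta> c \<psi>"
proof -
  have \<beta>1: "\<beta> < 1" using \<beta> by simp
  obtain p q c where pq: "0 \<le> p" "0 \<le> q" "p + q = \<beta>" and c: "0 < c"
    and eq: "\<And>x. 0 < x \<Longrightarrow> x < 1 \<Longrightarrow> ennreal (1 - \<theta>) * left_abel \<beta> p q x + ennreal \<theta> * right_abel \<beta> p q x = ennreal c"
    by (rule abel_equation_solution[OF \<beta>(1) \<beta>1 \<theta>]) blast
  define \<psi> where "\<psi> s = s powr (- p) * (1 - s) powr (- q)" for s :: real
  have m: "\<psi> \<in> borel_measurable borel" unfolding \<psi>_def by measurable
  have ge: "1 \<le> \<psi> x" if "x \<in> {0<..<1}" for x
  proof -
    have "1 \<le> y powr (- r)" if "0 < y" "y < 1" "0 \<le> r" for y r :: real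
      using powr_mono'[of "- r" 0 y] that by simp
    then have "1 * 1 \<le> \<psi> x" unfolding \<psi>_def using that pq by (intro mult_mono) auto
    then show ?thesis by simp
  qed
  \<comment> \<open>The squares have the exponents \<open>- 2 p\<close> and \<open>- 2 q\<close>, which are above \<open>-1\<close> because \<open>p + q < 1 / 2\<close>.\<close>
  have L2: "\<psi> \<in> L2"
    unfolding L2_def
  proof (safe intro!: measurable_unit m)
    show "integrable unit_ivl (\<lambda>x. (\<psi> x)\<^sup>2)"
    proof (rule integrableI_nonneg)
      show "(\<lambda>x. (\<psi> x)\<^sup>2) \<in> borel_measurable unit_ivl" using m by (intro measurable_unit) measurable
      have "(\<integral>\<^sup>+x. ennreal ((\<psi> x)\<^sup>2) \<partial>unit_ivl) \<le> (\<integral>\<^sup>+t. ennreal (t powr (1 - 2 * p - 1) * (1 - t) powr (1 - 2 * q - 1)) * indicator {0..1} t \<partial>lborel)"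
        unfolding nn_integral_unit
      proof (rule nn_integral_mono)
        fix x :: real
        show "ennreal ((\<psi> x)\<^sup>2) * indicator {0<..<1} x \<le> ennreal (x powr (1 - 2 * p - 1) * (1 - x) powr (1 - 2 * q - 1)) * indicator {0..1} x"
        proof (cases "x \<in> {0<..<1}")
          case True
          have "(y powr (- r))\<^sup>2 = y powr (1 - 2 * r - 1)" if "0 < y" for y r :: real
            using that by (simp add: power2_eq_square powr_add[symmetric])
          then have "(\<psi> x)\<^sup>2 = x powr (1 - 2 * p - 1) * (1 - x) powr (1 - 2 * q - 1)"
            using True by (simp add: \<psi>_def power_mult_distrib)
          then show ?thesis using True by simp
        qed simp
      qed
      also have "\<dots> = ennreal (Beta (1 - 2 * p) (1 - 2 * q))"
        by (rule nn_integral_Beta) (use pq \<beta> in auto)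
      finally show "(\<integral>\<^sup>+x. ennreal ((\<psi> x)\<^sup>2) \<partial>unit_ivl) < \<infinity>" by (simp add: le_less_trans)
    qed simp
  qed
  have ab: "(\<integral>\<^sup>+x. ennreal (ker \<beta> \<theta> (x - s) * \<psi> x) \<partial>unit_ivl) = ennreal c" if s: "s \<in> {0<..<1}" for s
  proof -
    have "(\<integral>\<^sup>+x. ennreal (ker \<beta> \<theta> (x - s) * \<psi> x) \<partial>unit_ivl) =
      (\<integral>\<^sup>+x. ennreal (1 - \<theta>) * (ennreal ((s - x) powr (\<beta> - 1) * \<psi> x) * indicator {0..s} x) +
        ennreal \<theta> * (ennreal ((x - s) powr (\<beta> - 1) * \<psi> x) * indicator {s..1} x) \<partial>lborel)"
      unfolding nn_integral_unit
    proof (rule nn_integral_cong_AE)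
      have "AE x in lborel. x \<noteq> s \<and> x \<noteq> 0 \<and> x \<noteq> (1::real)"
        using AE_lborel_singleton[of s] AE_lborel_singleton[of 0] AE_lborel_singleton[of 1] by eventually_elim simp
      then show "AE x in lborel. ennreal (ker \<beta> \<theta> (x - s) * \<psi> x) * indicator {0<..<1} x =
        ennreal (1 - \<theta>) * (ennreal ((s - x) powr (\<beta> - 1) * \<psi> x) * indicator {0..s} x) +
        ennreal \<theta> * (ennreal ((x - s) powr (\<beta> - 1) * \<psi> x) * indicator {s..1} x)"
        by eventually_elim
          (use s \<theta> in \<open>auto simp: indicator_def ker_def ennreal_mult'[symmetric] mult.assoc abs_if split: if_splits\<close>)
    qed
    also have "\<dots> = ennreal (1 - \<theta>) * left_abel \<beta> p q s + ennreal \<theta> * right_abel \<beta> p q s"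
      unfolding left_abel_def right_abel_def \<psi>_def
      by (subst nn_integral_add, measurable, subst (1 2) nn_integral_cmult, measurable)
    also have "\<dots> = ennreal c" using s by (intro eq) auto
    finally show ?thesis .
  qed
  have "abel_kernel \<beta> \<theta> c \<psi>"
    by unfold_locales (fact \<beta> \<beta>1 \<theta> c m L2 | rule ge ab; assumption)+
  then show ?thesis by blast
qed

context abel_kernel
begin

lemma ker_pair_measurable:
  assumes [measurable]: "g \<in> borel_measurable unit_ivl"
  shows "(\<lambda>(x, s). ker \<beta> \<theta> (x - s) * g s) \<in> borel_measurable (unit_ivl \<Otimes>\<^sub>M unit_ivl)"
proof -
  note [measurable] = measurable_id_unit
  show ?thesis by measurable
qed

lemma integrable_pairing:
  assumes g: "integrable unit_ivl g"
  shows "integrable (unit_ivl \<Otimes>\<^sub>M unit_ivl) (\<lambda>(x, s). ker \<beta> \<theta> (x - s) * g s * \<psi> x)"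
proof (rule integrableI_bounded)
  note [measurable] = measurable_id_unit
  have [measurable]: "g \<in> borel_measurable unit_ivl" using g by auto
  show m: "(\<lambda>(x, s). ker \<beta> \<theta> (x - s) * g s * \<psi> x) \<in> borel_measurable (unit_ivl \<Otimes>\<^sub>M unit_ivl)"
    by measurable
  have "(\<integral>\<^sup>+p. ennreal (norm (case p of (x, s) \<Rightarrow> ker \<beta> \<theta> (x - s) * g s * \<psi> x)) \<partial>(unit_ivl \<Otimes>\<^sub>M unit_ivl)) =
    (\<integral>\<^sup>+s. (\<integral>\<^sup>+x. ennreal \<bar>ker \<beta> \<theta> (x - s) * g s * \<psi> x\<bar> \<partial>unit_ivl) \<partial>unit_ivl)"
    by (subst UU.nn_integral_snd[symmetric]) (use m in auto)
  also have "\<dots> = (\<integral>\<^sup>+s. ennreal c * ennreal \<bar>g s\<bar> \<partial>unit_ivl)"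
  proof (rule nn_integral_cong)
    fix s assume s: "s \<in> space unit_ivl"
    have "(\<integral>\<^sup>+x. ennreal \<bar>ker \<beta> \<theta> (x - s) * g s * \<psi> x\<bar> \<partial>unit_ivl) = (\<integral>\<^sup>+x. ennreal \<bar>g s\<bar> * ennreal (ker \<beta> \<theta> (x - s) * \<psi> x) \<partial>unit_ivl)"
    proof (rule nn_integral_cong)
      fix x assume "x \<in> space unit_ivl"
      then have "0 \<le> \<psi> x" using \<psi>_ge[of x] by auto
      then have "\<bar>ker \<beta> \<theta> (x - s) * g s * \<psi> x\<bar> = \<bar>g s\<bar> * (ker \<beta> \<theta> (x - s) * \<psi> x)"
        using ker_nonneg[OF \<theta>, of \<beta> "x - s"] by (simp add: abs_mult)
      then show "ennreal \<bar>ker \<beta> \<theta> (x - s) * g s * \<psi> x\<bar> = ennreal \<bar>g s\<bar> * ennreal (ker \<beta> \<theta> (x - s) * \<psi> x)"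
        by (simp add: ennreal_mult')
    qed
    also have "\<dots> = ennreal \<bar>g s\<bar> * ennreal c"
      using s by (subst nn_integral_cmult) (auto simp: abel intro!: measurable_unit)
    finally show "(\<integral>\<^sup>+x. ennreal \<bar>ker \<beta> \<theta> (x - s) * g s * \<psi> x\<bar> \<partial>unit_ivl) = ennreal c * ennreal \<bar>g s\<bar>"
      by (simp add: mult.commute)
  qed
  also have "\<dots> = ennreal c * (\<integral>\<^sup>+s. ennreal \<bar>g s\<bar> \<partial>unit_ivl)" by (rule nn_integral_cmult) measurable
  also have "\<dots> < \<infinity>" using g by (auto simp: integrable_iff_bounded ennreal_mult_less_top)
  finally show "(\<integral>\<^sup>+p. ennreal (norm (case p of (x, s) \<Rightarrow> ker \<beta> \<theta> (x - s) * g s * \<psi> x)) \<partial>(unit_ivl \<Otimes>\<^sub>M unit_ivl)) < \<infinity>" .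
qed

text \<open>
  Fubini's theorem moves the fractional integral from \<open>g\<close> to \<open>\<psi>\<close>, where it gives the constant \<open>c\<close>.
\<close>

lemma frac_conv_pairing:
  assumes g: "integrable unit_ivl g"
  shows "integrable unit_ivl (\<lambda>x. frac_conv \<beta> \<theta> g x * \<psi> x)"
    and "(\<integral>x. frac_conv \<beta> \<theta> g x * \<psi> x \<partial>unit_ivl) = c * (\<integral>s. g s \<partial>unit_ivl)"
proof -
  note [measurable] = measurable_id_unit
  have [measurable]: "g \<in> borel_measurable unit_ivl" using g by auto
  let ?H = "\<lambda>x s. ker \<beta> \<theta> (x - s) * g s * \<psi> x"
  have i: "integrable (unit_ivl \<Otimes>\<^sub>M unit_ivl) (case_prod ?H)" by (rule integrable_pairing[OF g])
  have eq: "frac_conv \<beta> \<theta> g x * \<psi> x = (\<integral>s. ?H x s \<partial>unit_ivl)" for x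
    by (simp add: frac_conv_def)
  show "integrable unit_ivl (\<lambda>x. frac_conv \<beta> \<theta> g x * \<psi> x)"
    unfolding eq by (rule UU.integrable_fst[OF i])
  have "(\<integral>x. frac_conv \<beta> \<theta> g x * \<psi> x \<partial>unit_ivl) = (\<integral>s. (\<integral>x. ?H x s \<partial>unit_ivl) \<partial>unit_ivl)"
    unfolding eq by (rule UU.Fubini_integral[OF i, symmetric])
  also have "\<dots> = (\<integral>s. c * g s \<partial>unit_ivl)"
  proof (rule Bochner_Integration.integral_cong[OF refl])
    fix s assume s: "s \<in> space unit_ivl"
    have "(\<integral>x. ker \<beta> \<theta> (x - s) * \<psi> x \<partial>unit_ivl) = enn2real (\<integral>\<^sup>+x. ennreal (ker \<beta> \<theta> (x - s) * \<psi> x) \<partial>unit_ivl)"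
    proof (rule integral_eq_nn_integral)
      show "(\<lambda>x. ker \<beta> \<theta> (x - s) * \<psi> x) \<in> borel_measurable unit_ivl" by (rule measurable_unit) measurable
      show "AE x in unit_ivl. 0 \<le> ker \<beta> \<theta> (x - s) * \<psi> x"
      proof (rule AE_I2)
        fix x assume "x \<in> space unit_ivl"
        then have "0 \<le> \<psi> x" using \<psi>_ge[of x] by auto
        then show "0 \<le> ker \<beta> \<theta> (x - s) * \<psi> x" using ker_nonneg[OF \<theta>] by simp
      qed
    qed
    also have "\<dots> = c" using s c by (simp add: abel)
    finally have "(\<integral>x. ker \<beta> \<theta> (x - s) * \<psi> x \<partial>unit_ivl) = c" .
    moreover have "(\<integral>x. ?H x s \<partial>unit_ivl) = (\<integral>x. g s * (ker \<beta> \<theta> (x - s) * \<psi> x) \<partial>unit_ivl)"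
      by (rule Bochner_Integration.integral_cong) (auto simp: mult_ac)
    ultimately show "(\<integral>x. ?H x s \<partial>unit_ivl) = c * g s" by simp
  qed
  finally show "(\<integral>x. frac_conv \<beta> \<theta> g x * \<psi> x \<partial>unit_ivl) = c * (\<integral>s. g s \<partial>unit_ivl)" by simp
qed

lemma AE_integrable_ker:
  assumes g: "integrable unit_ivl g"
  shows "AE x in unit_ivl. integrable unit_ivl (\<lambda>s. ker \<beta> \<theta> (x - s) * g s)"
proof -
  have "AE x in unit_ivl. integrable unit_ivl (\<lambda>s. ker \<beta> \<theta> (x - s) * g s * \<psi> x)"
    using UU.AE_integrable_fst[OF integrable_pairing[OF g]] .
  moreover have "AE x in unit_ivl. x \<in> {0<..<1}" by (rule AE_I2) simp
  ultimately show ?thesis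
  proof eventually_elim
    case (elim x)
    then have "\<psi> x \<noteq> 0" using \<psi>_ge[of x] by auto
    then show ?case using elim by simp
  qed
qed

lemma frac_conv_measurable:
  assumes g: "integrable unit_ivl g" shows "frac_conv \<beta> \<theta> g \<in> borel_measurable unit_ivl"
proof -
  have "(\<lambda>(x, s). ker \<beta> \<theta> (x - s) * g s) \<in> borel_measurable (unit_ivl \<Otimes>\<^sub>M unit_ivl)"
    by (rule ker_pair_measurable) (use g in auto)
  then show ?thesis unfolding frac_conv_def by (rule U.borel_measurable_lebesgue_integral)
qed

lemma abs_frac_conv_le: "\<bar>frac_conv \<beta> \<theta> g x\<bar> \<le> frac_conv \<beta> \<theta> (\<lambda>s. \<bar>g s\<bar>) x"
  unfolding frac_conv_def using integral_abs_bound[of unit_ivl "\<lambda>s. ker \<beta> \<theta> (x - s) * g s"]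
  by (simp add: abs_mult abs_of_nonneg[OF ker_nonneg[OF \<theta>]])

lemma frac_conv_L1:
  assumes g: "integrable unit_ivl g"
  shows "integrable unit_ivl (frac_conv \<beta> \<theta> g)"
    and "(\<integral>x. \<bar>frac_conv \<beta> \<theta> g x\<bar> \<partial>unit_ivl) \<le> c * (\<integral>s. \<bar>g s\<bar> \<partial>unit_ivl)"
proof -
  have ga: "integrable unit_ivl (\<lambda>s. \<bar>g s\<bar>)" using g by simp
  have le: "\<bar>frac_conv \<beta> \<theta> g x\<bar> \<le> frac_conv \<beta> \<theta> (\<lambda>s. \<bar>g s\<bar>) x * \<psi> x" if "x \<in> space unit_ivl" for x
  proof -
    have "frac_conv \<beta> \<theta> (\<lambda>s. \<bar>g s\<bar>) x * 1 \<le> frac_conv \<beta> \<theta> (\<lambda>s. \<bar>g s\<bar>) x * \<psi> x"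
      using abs_frac_conv_le[of g x] \<psi>_ge[of x] that by (intro mult_left_mono) auto
    then show ?thesis using abs_frac_conv_le[of g x] by simp
  qed
  note i = frac_conv_pairing(1)[OF ga]
  show fi: "integrable unit_ivl (frac_conv \<beta> \<theta> g)"
  proof (rule Bochner_Integration.integrable_bound[OF i frac_conv_measurable[OF g]])
    show "AE x in unit_ivl. norm (frac_conv \<beta> \<theta> g x) \<le> norm (frac_conv \<beta> \<theta> (\<lambda>s. \<bar>g s\<bar>) x * \<psi> x)"
      by (rule AE_I2) (use le in force)
  qed
  have "(\<integral>x. \<bar>frac_conv \<beta> \<theta> g x\<bar> \<partial>unit_ivl) \<le> (\<integral>x. frac_conv \<beta> \<theta> (\<lambda>s. \<bar>g s\<bar>) x * \<psi> x \<partial>unit_ivl)"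
    by (rule integral_mono[OF integrable_abs[OF fi] i le])
  then show "(\<integral>x. \<bar>frac_conv \<beta> \<theta> g x\<bar> \<partial>unit_ivl) \<le> c * (\<integral>s. \<bar>g s\<bar> \<partial>unit_ivl)"
    by (simp add: frac_conv_pairing(2)[OF ga])
qed

lemma frac_conv_diff_AE:
  assumes f: "integrable unit_ivl f" and g: "integrable unit_ivl g"
  shows "AE x in unit_ivl. frac_conv \<beta> \<theta> (\<lambda>s. f s - g s) x = frac_conv \<beta> \<theta> f x - frac_conv \<beta> \<theta> g x"
  using AE_integrable_ker[OF f] AE_integrable_ker[OF g]
  by eventually_elim (simp add: frac_conv_def right_diff_distrib)

lemma frac_int_AE:
  assumes g: "integrable unit_ivl g"
  shows "AE x in unit_ivl. frac_int \<beta> \<theta> g x = frac_conv \<beta> \<theta> g x / Gamma \<beta>"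
proof -
  have "AE x in unit_ivl. x \<in> {0<..<1}" by (rule AE_I2) simp
  with AE_integrable_ker[OF g] show ?thesis
  proof eventually_elim
    case (elim x)
    let ?k = "\<lambda>s. ker \<beta> \<theta> (x - s) * g s"
    have i: "integrable unit_ivl (\<lambda>s. ?k s * indicator {..<x} s)" "integrable unit_ivl (\<lambda>s. ?k s * indicator {x..} s)"
      by (rule integrable_unit_mult_bounded[OF elim(1) indicator_unit, where B=1]; simp)+
    have l: "\<theta> * left_int \<beta> g x = 1 / Gamma \<beta> * (\<integral>s. ?k s * indicator {..<x} s \<partial>unit_ivl)"
    proof -
      have "\<theta> * (LINT s:{0<..<x}|lebesgue. g s / (x - s) powr (1 - \<beta>)) = (\<integral>s. ?k s * indicator {..<x} s \<partial>unit_ivl)"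
        unfolding integral_unit_eq set_lebesgue_integral_def integral_mult_right_zero[symmetric]
      proof (rule Bochner_Integration.integral_cong[OF refl])
        fix s
        have "\<theta> * (g s / (x - s) powr (1 - \<beta>)) = ?k s" if "s < x"
        proof -
          have "1 / (x - s) powr (1 - \<beta>) = (x - s) powr (\<beta> - 1)"
            using powr_minus_divide[of "x - s" "1 - \<beta>"] by simp
          then show ?thesis using that by (simp add: ker_def divide_inverse mult_ac)
        qed
        then show "\<theta> * (indicator {0<..<x} s *\<^sub>R (g s / (x - s) powr (1 - \<beta>))) =
          indicator {0<..<1} s *\<^sub>R (?k s * indicator {..<x} s)"
          using elim(2) by (auto simp: indicator_def)
      qed
      then show ?thesis by (simp add: left_int_def)
    qed
    have r: "(1 - \<theta>) * right_int \<beta> g x = 1 / Gamma \<beta> * (\<integral>s. ?k s * indicator {x..} s \<partial>unit_ivl)"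
    proof -
      have "(1 - \<theta>) * (LINT s:{x<..<1}|lebesgue. g s / (s - x) powr (1 - \<beta>)) = (\<integral>s. ?k s * indicator {x..} s \<partial>unit_ivl)"
        unfolding integral_unit_eq set_lebesgue_integral_def integral_mult_right_zero[symmetric]
      proof (rule Bochner_Integration.integral_cong[OF refl])
        fix s
        have "(1 - \<theta>) * (g s / (s - x) powr (1 - \<beta>)) = ?k s" if "x < s"
        proof -
          have "1 / (s - x) powr (1 - \<beta>) = (s - x) powr (\<beta> - 1)"
            using powr_minus_divide[of "s - x" "1 - \<beta>"] by simp
          then show ?thesis using that by (simp add: ker_def divide_inverse mult_ac abs_minus_commute)
        qed
        moreover have "?k s = 0" if "s = x" using that by (simp add: ker_def)
        ultimately show "(1 - \<theta>) * (indicator {x<..<1} s *\<^sub>R (g s / (s - x) powr (1 - \<beta>))) =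
          indicator {0<..<1} s *\<^sub>R (?k s * indicator {x..} s)"
          using elim(2) by (auto simp: indicator_def)
      qed
      then show ?thesis by (simp add: right_int_def)
    qed
    have "frac_conv \<beta> \<theta> g x = (\<integral>s. ?k s * indicator {..<x} s + ?k s * indicator {x..} s \<partial>unit_ivl)"
      unfolding frac_conv_def by (rule Bochner_Integration.integral_cong) (auto simp: indicator_def)
    then show ?case
      unfolding frac_int_def l r using i by (simp add: add_divide_distrib)
  qed
qed

end

section \<open>Weak derivatives of two-sided fractional integrals\<close>

lemma ker_integral_test_bounded:
  assumes "0 < \<beta>" "g \<in> test_fun"
  obtains B where "0 \<le> B" "\<And>x. x \<in> {0<..<1} \<Longrightarrow> \<bar>frac_conv \<beta> \<theta> g x\<bar> \<le> B"
proof -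
  obtain B where B: "0 \<le> B" "\<And>x. \<bar>g x\<bar> \<le> B" using test_fun_bounded[OF assms(2)] by blast
  let ?k = "cut_ker \<beta> \<theta>"
  have ki: "integrable lborel ?k" by (rule integrable_cut_ker[OF assms(1)])
  have [measurable]: "g \<in> borel_measurable borel" by (rule test_fun_borel[OF assms(2)])
  have "\<bar>frac_conv \<beta> \<theta> g x\<bar> \<le> (\<integral>z. \<bar>?k z\<bar> * B \<partial>lborel)" if x: "x \<in> {0<..<1}" for x
  proof -
    have le: "\<bar>?k z * g (x - z)\<bar> \<le> \<bar>?k z\<bar> * B" for z
      unfolding abs_mult by (rule mult_left_mono[OF B(2)]) simp
    have i: "integrable lborel (\<lambda>z. \<bar>?k z\<bar> * B)" using ki by simp
    have "\<bar>frac_conv \<beta> \<theta> g x\<bar> \<le> (\<integral>z. \<bar>?k z * g (x - z)\<bar> \<partial>lborel)"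
      unfolding frac_conv_def ker_integral_cut[OF assms(2) x] by (rule integral_abs_bound)
    also have "\<dots> \<le> (\<integral>z. \<bar>?k z\<bar> * B \<partial>lborel)"
    proof (rule integral_mono[OF _ i le])
      show "integrable lborel (\<lambda>z. \<bar>?k z * g (x - z)\<bar>)"
        by (rule Bochner_Integration.integrable_bound[OF i]) (use le B in auto)
    qed
    finally show ?thesis .
  qed
  then show ?thesis using B by (intro that[of "\<integral>z. \<bar>?k z\<bar> * B \<partial>lborel"]) auto
qed

lemma integral_parts_shift:
  assumes \<phi>: "\<phi> \<in> test_fun" and \<zeta>: "\<zeta> \<in> test_fun"
  shows "(\<integral>x. \<phi> (x - z) * deriv \<zeta> x \<partial>lborel) = - (\<integral>x. deriv \<phi> (x - z) * \<zeta> x \<partial>lborel)"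
proof -
  have shift: "continuous_on S (\<lambda>x. f (x - z))" if "f \<in> test_fun" for f :: "real \<Rightarrow> real" and S
    by (rule continuous_on_compose2[OF test_fun_cont[OF that, of UNIV]]) (auto intro!: continuous_intros)
  have bd: "integrable lborel (\<lambda>x. f (x - z) * g x)" if f: "f \<in> test_fun" and g: "g \<in> test_fun" for f g
  proof -
    obtain B where B: "0 \<le> B" "\<And>x. \<bar>f x\<bar> \<le> B" using test_fun_bounded[OF f] by blast
    have [measurable]: "f \<in> borel_measurable borel" "g \<in> borel_measurable borel" using f g test_fun_borel by auto
    show ?thesis
    proof (rule Bochner_Integration.integrable_bound)
      show "integrable lborel (\<lambda>x. B * g x)" using test_fun_integrable_lborel[OF g] by simp
      show "AE x in lborel. norm (f (x - z) * g x) \<le> norm (B * g x)"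
        using B by (intro AE_I2) (simp add: abs_mult mult_right_mono)
    qed measurable
  qed
  note i = bd[OF \<phi> test_fun_deriv[OF \<zeta>]] bd[OF test_fun_deriv[OF \<phi>] \<zeta>]
  have d: "((\<lambda>x. \<phi> (x - z) * \<zeta> x) has_vector_derivative \<phi> (x - z) * deriv \<zeta> x + deriv \<phi> (x - z) * \<zeta> x) (at x within S)" for x S
  proof -
    have "((\<lambda>x. \<phi> (x - z)) has_real_derivative deriv \<phi> (x - z)) (at x within S)"
    proof -
      have "((\<lambda>x. x - z) has_real_derivative 1) (at x within S)" by (auto intro!: derivative_eq_intros)
      from DERIV_chain2[OF test_fun_DERIV[OF \<phi>] this] show ?thesis by simp
    qed
    from DERIV_mult'[OF this has_field_derivative_at_within[OF test_fun_DERIV[OF \<zeta>]]] show ?thesis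
      by (simp add: has_real_derivative_iff_has_vector_derivative)
  qed
  have "(\<integral>x. indicator {0..1} x *\<^sub>R (\<phi> (x - z) * deriv \<zeta> x + deriv \<phi> (x - z) * \<zeta> x) \<partial>lborel) = \<phi> (1 - z) * \<zeta> 1 - \<phi> (0 - z) * \<zeta> 0"
    by (rule integral_FTC_atLeastAtMost[OF _ d])
      (simp, intro continuous_on_add continuous_on_mult shift[OF \<phi>] shift[OF test_fun_deriv[OF \<phi>]]
        test_fun_cont[OF \<zeta>] test_fun_cont[OF test_fun_deriv[OF \<zeta>]])
  also have "(\<lambda>x. indicator {0..1} x *\<^sub>R (\<phi> (x - z) * deriv \<zeta> x + deriv \<phi> (x - z) * \<zeta> x)) = (\<lambda>x. \<phi> (x - z) * deriv \<zeta> x + deriv \<phi> (x - z) * \<zeta> x)"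
  proof
    fix x show "indicator {0..1} x *\<^sub>R (\<phi> (x - z) * deriv \<zeta> x + deriv \<phi> (x - z) * \<zeta> x) = \<phi> (x - z) * deriv \<zeta> x + deriv \<phi> (x - z) * \<zeta> x"
      using test_fun_zero[OF \<zeta>, of x] test_fun_zero[OF test_fun_deriv[OF \<zeta>], of x] by (cases "x \<in> {0..1}") auto
  qed
  finally have "(\<integral>x. \<phi> (x - z) * deriv \<zeta> x + deriv \<phi> (x - z) * \<zeta> x \<partial>lborel) = 0"
    using test_fun_zero[OF \<zeta>, of 0] test_fun_zero[OF \<zeta>, of 1] by simp
  then show ?thesis unfolding Bochner_Integration.integral_add[OF i] by simp
qed

text \<open>
  With the difference \<open>z = x - s\<close> as a variable the singular kernel is separated from the smooth
  functions, and derivatives can be moved between the latter.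
\<close>

lemma frac_conv_inner:
  assumes \<beta>: "0 < \<beta>" and \<phi>: "\<phi> \<in> test_fun" and \<zeta>: "\<zeta> \<in> test_fun"
  shows "L2_inner (frac_conv \<beta> \<theta> \<phi>) \<zeta> = (\<integral>z. cut_ker \<beta> \<theta> z * (\<integral>x. \<phi> (x - z) * \<zeta> x \<partial>lborel) \<partial>lborel)"
proof -
  have [measurable]: "\<phi> \<in> borel_measurable borel" "\<zeta> \<in> borel_measurable borel" using \<phi> \<zeta> test_fun_borel by auto
  obtain B where B: "0 \<le> B" "\<And>x. \<bar>\<phi> x\<bar> \<le> B" using test_fun_bounded[OF \<phi>] by blast
  let ?k = "cut_ker \<beta> \<theta>"
  let ?f = "\<lambda>x. \<integral>z. ?k z * \<phi> (x - z) \<partial>lborel"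
  let ?H = "\<lambda>z x. ?k z * \<phi> (x - z) * \<zeta> x"
  have Hi: "integrable (lborel \<Otimes>\<^sub>M lborel) (case_prod ?H)"
  proof (rule Bochner_Integration.integrable_bound)
    show "integrable (lborel \<Otimes>\<^sub>M lborel) (\<lambda>(z, x). ?k z * B * \<zeta> x)"
      by (rule lborel_pair.integrable_product) (use integrable_cut_ker[OF \<beta>] test_fun_integrable_lborel[OF \<zeta>] in auto)
    show "AE p in lborel \<Otimes>\<^sub>M lborel. norm (case_prod ?H p) \<le> norm (case p of (z, x) \<Rightarrow> ?k z * B * \<zeta> x)"
      using B by (intro AE_I2) (auto simp: abs_mult intro!: mult_right_mono mult_left_mono)
  qed measurable
  have "L2_inner (frac_conv \<beta> \<theta> \<phi>) \<zeta> = (\<integral>x. ?f x * \<zeta> x \<partial>unit_ivl)"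
    unfolding L2_inner_def frac_conv_def
    by (rule Bochner_Integration.integral_cong) (auto simp: ker_integral_cut[OF \<phi>])
  also have "\<dots> = (\<integral>x. indicator {0<..<1} x *\<^sub>R (?f x * \<zeta> x) \<partial>lborel)"
    unfolding set_lebesgue_integral_def[symmetric] by (rule integral_unit_lborel) measurable
  also have "\<dots> = (\<integral>x. (\<integral>z. ?H z x \<partial>lborel) \<partial>lborel)"
  proof (rule Bochner_Integration.integral_cong[OF refl])
    fix x
    show "indicator {0<..<1} x *\<^sub>R (?f x * \<zeta> x) = (\<integral>z. ?H z x \<partial>lborel)"
      using test_fun_zero[OF \<zeta>, of x] by (cases "x \<in> {0<..<1}") auto
  qed
  also have "\<dots> = (\<integral>z. (\<integral>x. ?H z x \<partial>lborel) \<partial>lborel)"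
    using lborel_pair.Fubini_integral[OF Hi] by simp
  also have "\<dots> = (\<integral>z. ?k z * (\<integral>x. \<phi> (x - z) * \<zeta> x \<partial>lborel) \<partial>lborel)"
    by (simp add: mult.assoc)
  finally show ?thesis .
qed

lemma (in abel_kernel) frac_conv_test_weak_deriv:
  assumes \<phi>: "\<phi> \<in> test_fun"
  shows "has_weak_deriv 1 (frac_conv \<beta> \<theta> \<phi>) (frac_conv \<beta> \<theta> (deriv \<phi>))"
  unfolding has_weak_deriv_def
proof (intro conjI ballI)
  show "loc_integrable (frac_conv \<beta> \<theta> \<phi>)" "loc_integrable (frac_conv \<beta> \<theta> (deriv \<phi>))"
    by (rule loc_integrable_unit, rule frac_conv_L1(1), rule test_fun_integrable, rule test_fun_deriv \<phi>, (rule \<phi>)?)+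
  fix \<zeta> assume \<zeta>: "\<zeta> \<in> test_fun"
  show "L2_inner (frac_conv \<beta> \<theta> \<phi>) ((deriv ^^ 1) \<zeta>) = (- 1) ^ 1 * L2_inner (frac_conv \<beta> \<theta> (deriv \<phi>)) \<zeta>"
    by (simp add: frac_conv_inner[OF \<beta>(1)] \<phi> \<zeta> test_fun_deriv integral_parts_shift)
qed

lemma integrable_ker:
  assumes \<beta>: "0 < \<beta>" and x: "x \<in> {0<..<1}"
  shows "integrable unit_ivl (\<lambda>s. ker \<beta> \<theta> (x - s))"
proof -
  have "integrable lborel (\<lambda>s. cut_ker \<beta> \<theta> (x + (-1) * s))"
    using lborel_integrable_real_affine[OF integrable_cut_ker[OF \<beta>, of \<theta>], of "-1" x] by simp
  then have "integrable lborel (\<lambda>s. indicator {0<..<1} s *\<^sub>R cut_ker \<beta> \<theta> (x - s))"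
    by (intro integrable_mult_indicator) auto
  moreover have "(\<lambda>s. indicator {0<..<1} s *\<^sub>R cut_ker \<beta> \<theta> (x - s)) = (\<lambda>s. indicator {0<..<1} s *\<^sub>R ker \<beta> \<theta> (x - s))"
  proof
    fix s show "indicator {0<..<1} s *\<^sub>R cut_ker \<beta> \<theta> (x - s) = indicator {0<..<1} s *\<^sub>R ker \<beta> \<theta> (x - s)"
      using x by (cases "s \<in> {0<..<1}") (auto intro!: cut_ker_eq)
  qed
  ultimately show ?thesis by (subst integrable_unit_lborel) (auto simp: set_integrable_def)
qed

text \<open>
  The function \<open>z \<mapsto> z ker z\<close> is continuous and has the derivative \<open>\<beta> ker z\<close> off 0; hence the
  commutator of the fractional integral with the multiplication by \<open>x\<close> integrates by parts.
\<close>

lemma frac_conv_commutator: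
  assumes \<beta>: "0 < \<beta>" "\<beta> < 1" and \<phi>: "\<phi> \<in> test_fun" and x: "x \<in> {0<..<1}"
  shows "x * frac_conv \<beta> \<theta> (deriv \<phi>) x = frac_conv \<beta> \<theta> (\<lambda>s. s * deriv \<phi> s) x + \<beta> * frac_conv \<beta> \<theta> \<phi> x"
proof -
  note d = test_fun_deriv[OF \<phi>]
  define m where "m z = \<theta> * max 0 z powr \<beta> - (1 - \<theta>) * max 0 (- z) powr \<beta>" for z
  have m_eq: "m z = z * ker \<beta> \<theta> z" for z
  proof -
    have "y powr \<beta> = y * y powr (\<beta> - 1)" if "0 < y" for y
      using that powr_mult_base[of y "\<beta> - 1"] by simp
    then show ?thesis using \<beta> by (auto simp: m_def ker_def max_def abs_if)
  qed
  have mc: "continuous_on S m" for S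
    unfolding m_def by (intro continuous_intros continuous_on_powr') (use \<beta> in auto)
  have md: "(m has_real_derivative \<beta> * ker \<beta> \<theta> z) (at z)" if "z \<noteq> 0" for z
  proof (cases "0 < z")
    case True
    have "((\<lambda>z. \<theta> * z powr \<beta>) has_real_derivative \<beta> * ker \<beta> \<theta> z) (at z)"
      using True by (auto intro!: derivative_eq_intros simp: ker_def)
    then show ?thesis
      by (rule has_field_derivative_transform_within_open[where S="{0<..}"]) (use True \<beta> in \<open>auto simp: m_def max_def\<close>)
  next
    case False
    then have z: "z < 0" using that by simp
    have "((\<lambda>z. - (1 - \<theta>) * (- z) powr \<beta>) has_real_derivative \<beta> * ker \<beta> \<theta> z) (at z)"
      using z by (auto intro!: derivative_eq_intros simp: ker_def algebra_simps)
    then show ?thesis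
      by (rule has_field_derivative_transform_within_open[where S="{..<0}"]) (use z \<beta> in \<open>auto simp: m_def max_def algebra_simps\<close>)
  qed
  note k = integrable_ker[OF \<beta>(1) x, of \<theta>]
  have ik: "integrable unit_ivl (\<lambda>s. ker \<beta> \<theta> (x - s) * g s)" if "continuous_on {0..1} g" for g
    by (rule integrable_unit_mult_continuous[OF k that])
  have i1: "integrable unit_ivl (\<lambda>s. ker \<beta> \<theta> (x - s) * \<phi> s)" by (rule ik[OF test_fun_cont[OF \<phi>]])
  have i2: "integrable unit_ivl (\<lambda>s. ker \<beta> \<theta> (x - s) * deriv \<phi> s)" by (rule ik[OF test_fun_cont[OF d]])
  have i3: "integrable unit_ivl (\<lambda>s. ker \<beta> \<theta> (x - s) * (s * deriv \<phi> s))"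
    by (rule ik) (intro continuous_intros test_fun_cont[OF d])
  let ?q = "\<lambda>s. m (x - s) * deriv \<phi> s - \<beta> * (ker \<beta> \<theta> (x - s) * \<phi> s)"
  have q_eq: "?q s = x * (ker \<beta> \<theta> (x - s) * deriv \<phi> s) - ker \<beta> \<theta> (x - s) * (s * deriv \<phi> s) - \<beta> * (ker \<beta> \<theta> (x - s) * \<phi> s)" for s
    by (simp add: m_eq algebra_simps)
  have iq: "integrable unit_ivl ?q" unfolding q_eq using i1 i2 i3 by simp
  have "(?q has_integral m (x - 1) * \<phi> 1 - m (x - 0) * \<phi> 0) {0..1}"
  proof (rule fundamental_theorem_of_calculus_interior_strong[where S="{x}"])
    show "continuous_on {0..1} (\<lambda>s. m (x - s) * \<phi> s)"
      by (intro continuous_on_mult test_fun_cont[OF \<phi>] continuous_on_compose2[OF mc[of UNIV]] continuous_intros) auto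
    show "((\<lambda>s. m (x - s) * \<phi> s) has_vector_derivative ?q s) (at s)" if "s \<in> {0<..<1} - {x}" for s
    proof -
      have "((\<lambda>s. m (x - s)) has_real_derivative \<beta> * ker \<beta> \<theta> (x - s) * - 1) (at s)"
        by (rule DERIV_chain2[OF md]) (use that in \<open>auto intro!: derivative_eq_intros\<close>)
      from DERIV_mult'[OF this test_fun_DERIV[OF \<phi>]] show ?thesis
        by (simp add: has_real_derivative_iff_has_vector_derivative mult.assoc)
    qed
  qed auto
  then have hk: "(?q has_integral 0) {0..1}"
    using test_fun_zero[OF \<phi>, of 0] test_fun_zero[OF \<phi>, of 1] by simp
  have "(?q has_integral (\<integral>s. ?q s \<partial>unit_ivl)) {0<..<1}"
    by (rule has_integral_integral_lebesgue_on[OF iq]) simp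
  then have "(?q has_integral (\<integral>s. ?q s \<partial>unit_ivl)) {0..1}"
    by (simp add: has_integral_Icc_iff_Ioo)
  then have "(\<integral>s. ?q s \<partial>unit_ivl) = 0" using hk has_integral_unique by blast
  moreover have "(\<integral>s. ?q s \<partial>unit_ivl) = x * frac_conv \<beta> \<theta> (deriv \<phi>) x - frac_conv \<beta> \<theta> (\<lambda>s. s * deriv \<phi> s) x - \<beta> * frac_conv \<beta> \<theta> \<phi> x"
    unfolding q_eq frac_conv_def using i1 i2 i3 by simp
  ultimately show ?thesis by simp
qed

lemma integral_id_deriv_test_fun:
  assumes \<phi>: "\<phi> \<in> test_fun"
  shows "(\<integral>s. s * deriv \<phi> s \<partial>unit_ivl) = - (\<integral>s. \<phi> s \<partial>unit_ivl)"
proof -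
  have id: "ndiff n (\<lambda>x. x)" for n
    by (cases n) (auto intro!: ndiff_SucI[where f'="\<lambda>_. 1", OF _ ndiff_const] simp del: ndiff.simps(2))
  obtain a b where ab: "0 < a" "a < b" "b < 1" "\<And>x. x \<notin> {a..b} \<Longrightarrow> \<phi> x = 0"
    using test_fun_supp[OF \<phi>] by blast
  have t: "(\<lambda>s. s * \<phi> s) \<in> test_fun"
    by (rule test_funI[OF ndiff_mult[OF id] ab(1,3)]) (use \<phi> ab(4) in \<open>auto simp: test_fun_iff\<close>)
  have "((\<lambda>s. s * \<phi> s) has_real_derivative s * deriv \<phi> s + \<phi> s) (at s)" for s
    using DERIV_mult'[OF DERIV_ident test_fun_DERIV[OF \<phi>]] by simp
  then have "deriv (\<lambda>s. s * \<phi> s) = (\<lambda>s. s * deriv \<phi> s + \<phi> s)" by (intro ext DERIV_imp_deriv)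
  then have "(\<integral>s. s * deriv \<phi> s + \<phi> s \<partial>unit_ivl) = 0"
    using integral_deriv_test_fun[OF t] by simp
  moreover have "integrable unit_ivl (\<lambda>s. deriv \<phi> s * s)"
    by (rule integrable_unit_mult_continuous[OF test_fun_integrable[OF test_fun_deriv[OF \<phi>]]]) (intro continuous_intros)
  ultimately show ?thesis using test_fun_integrable[OF \<phi>] by (simp add: mult.commute)
qed

text \<open>
  Integrals of derivatives of test functions vanish. For the second moment the factor \<open>x\<close> is first
  moved inside the fractional integral.
\<close>

lemma (in abel_kernel) frac_conv_deriv_moments:
  assumes \<phi>: "\<phi> \<in> test_fun"
  shows "(\<integral>x. frac_conv \<beta> \<theta> (deriv \<phi>) x * \<psi> x \<partial>unit_ivl) = 0"
    and "(\<integral>x. frac_conv \<beta> \<theta> (deriv \<phi>) x * (x * \<psi> x) \<partial>unit_ivl) = - ((1 - \<beta>) * c * (\<integral>s. \<phi> s \<partial>unit_ivl))"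
proof -
  note d = test_fun_integrable[OF test_fun_deriv[OF \<phi>]]
  show "(\<integral>x. frac_conv \<beta> \<theta> (deriv \<phi>) x * \<psi> x \<partial>unit_ivl) = 0"
    using frac_conv_pairing(2)[OF d] integral_deriv_test_fun[OF \<phi>] by simp
  have sd: "integrable unit_ivl (\<lambda>s. s * deriv \<phi> s)"
    using integrable_unit_mult_continuous[OF d, of "\<lambda>s. s"] by (simp add: mult.commute continuous_on_id)
  have "(\<integral>x. frac_conv \<beta> \<theta> (deriv \<phi>) x * (x * \<psi> x) \<partial>unit_ivl) =
    (\<integral>x. frac_conv \<beta> \<theta> (\<lambda>s. s * deriv \<phi> s) x * \<psi> x + \<beta> * (frac_conv \<beta> \<theta> \<phi> x * \<psi> x) \<partial>unit_ivl)"
  proof (rule Bochner_Integration.integral_cong[OF refl])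
    fix x assume "x \<in> space unit_ivl"
    then have "x * frac_conv \<beta> \<theta> (deriv \<phi>) x = frac_conv \<beta> \<theta> (\<lambda>s. s * deriv \<phi> s) x + \<beta> * frac_conv \<beta> \<theta> \<phi> x"
      by (intro frac_conv_commutator[OF \<beta> \<phi>]) simp
    then have "(x * frac_conv \<beta> \<theta> (deriv \<phi>) x) * \<psi> x = (frac_conv \<beta> \<theta> (\<lambda>s. s * deriv \<phi> s) x + \<beta> * frac_conv \<beta> \<theta> \<phi> x) * \<psi> x"
      by (rule arg_cong)
    then show "frac_conv \<beta> \<theta> (deriv \<phi>) x * (x * \<psi> x) =
        frac_conv \<beta> \<theta> (\<lambda>s. s * deriv \<phi> s) x * \<psi> x + \<beta> * (frac_conv \<beta> \<theta> \<phi> x * \<psi> x)"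
      by (simp add: algebra_simps)
  qed
  also have "\<dots> = c * (\<integral>s. s * deriv \<phi> s \<partial>unit_ivl) + \<beta> * (c * (\<integral>s. \<phi> s \<partial>unit_ivl))"
    using frac_conv_pairing[OF sd] frac_conv_pairing[OF test_fun_integrable[OF \<phi>]] by simp
  also have "\<dots> = - ((1 - \<beta>) * c * (\<integral>s. \<phi> s \<partial>unit_ivl))"
    unfolding integral_id_deriv_test_fun[OF \<phi>] by (simp add: algebra_simps)
  finally show "(\<integral>x. frac_conv \<beta> \<theta> (deriv \<phi>) x * (x * \<psi> x) \<partial>unit_ivl) = - ((1 - \<beta>) * c * (\<integral>s. \<phi> s \<partial>unit_ivl))" .
qed

lemma Hmu_norm_ge:
  assumes u: "u \<in> L2" and \<phi>: "\<phi> \<in> test_fun"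
  shows "L2_norm (\<lambda>x. u x - \<phi> x) \<le> Hmu_norm \<mu> (\<lambda>x. zero_ext u x - \<phi> x)"
    and "(\<integral>\<omega>. hom_density \<mu> (\<lambda>x. zero_ext u x - \<phi> x) \<omega> \<partial>lebesgue) \<le> (Hmu_norm \<mu> (\<lambda>x. zero_ext u x - \<phi> x))\<^sup>2"
proof -
  have "(L2_norm (\<lambda>x. u x - \<phi> x))\<^sup>2 = (\<integral>x. (zero_ext u x - \<phi> x)\<^sup>2 \<partial>lebesgue)"
    unfolding L2_norm_sq integral_unit_eq set_lebesgue_integral_def
    by (rule Bochner_Integration.integral_cong) (auto simp: zero_ext_def test_fun_zero[OF \<phi>] indicator_def)
  then have *: "(Hmu_norm \<mu> (\<lambda>x. zero_ext u x - \<phi> x))\<^sup>2 = (L2_norm (\<lambda>x. u x - \<phi> x))\<^sup>2 +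
      (\<integral>\<omega>. hom_density \<mu> (\<lambda>x. zero_ext u x - \<phi> x) \<omega> \<partial>lebesgue)"
    by (simp add: Hmu_norm_def)
  have p: "0 \<le> (\<integral>\<omega>. hom_density \<mu> (\<lambda>x. zero_ext u x - \<phi> x) \<omega> \<partial>lebesgue)" by simp
  have "(L2_norm (\<lambda>x. u x - \<phi> x))\<^sup>2 \<le> (Hmu_norm \<mu> (\<lambda>x. zero_ext u x - \<phi> x))\<^sup>2" using * p by linarith
  then show "L2_norm (\<lambda>x. u x - \<phi> x) \<le> Hmu_norm \<mu> (\<lambda>x. zero_ext u x - \<phi> x)"
    by (rule power2_le_imp_le) (simp add: Hmu_norm_def)
  show "(\<integral>\<omega>. hom_density \<mu> (\<lambda>x. zero_ext u x - \<phi> x) \<omega> \<partial>lebesgue) \<le> (Hmu_norm \<mu> (\<lambda>x. zero_ext u x - \<phi> x))\<^sup>2"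
    unfolding * by simp
qed

lemma Hmu_seminorm_diff_le:
  assumes w: "integrable lebesgue w" "integrable lebesgue (\<lambda>\<omega>. hom_density \<mu> w \<omega>)"
    and \<mu>: "0 \<le> \<mu>" "\<mu> \<le> 1" and \<phi>: "\<phi> \<in> test_fun" and \<zeta>: "\<zeta> \<in> test_fun"
  shows "(\<integral>\<omega>. hom_density \<mu> (\<lambda>x. \<phi> x - \<zeta> x) \<omega> \<partial>lebesgue) \<le>
    2 * (\<integral>\<omega>. hom_density \<mu> (\<lambda>x. w x - \<phi> x) \<omega> \<partial>lebesgue) +
    2 * (\<integral>\<omega>. hom_density \<mu> (\<lambda>x. w x - \<zeta> x) \<omega> \<partial>lebesgue)"
proof -
  have sq: "(a * cmod (x - y))\<^sup>2 \<le> 2 * (a * cmod x)\<^sup>2 + 2 * (a * cmod y)\<^sup>2" if "0 \<le> a" for a x y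
  proof -
    have "(a * cmod (x - y))\<^sup>2 \<le> (a * cmod x + a * cmod y)\<^sup>2"
      using mult_left_mono[OF norm_triangle_ineq4 that, of x y] that by (intro power_mono) (auto simp: distrib_left)
    also have "\<dots> \<le> 2 * (a * cmod x)\<^sup>2 + 2 * (a * cmod y)\<^sup>2"
      using sum_squares_bound[of "a * cmod x" "a * cmod y"] by (simp add: power2_sum)
    finally show ?thesis .
  qed
  have meas: "(\<lambda>\<omega>. hom_density \<mu> v \<omega>) \<in> borel_measurable lebesgue" if "integrable lebesgue v" for v
  proof -
    have "(\<lambda>\<omega>. hom_density \<mu> v \<omega>) \<in> borel_measurable lborel"
      using fourier_measurable[OF that] by measurable
    then show ?thesis by (rule measurable_completion)
  qed
  have int: "integrable lebesgue (\<lambda>\<omega>. hom_density \<mu> (\<lambda>x. w x - f x) \<omega>)" if f: "f \<in> test_fun" for f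
  proof (rule Bochner_Integration.integrable_bound)
    note fi = test_fun_integrable_lebesgue[OF f]
    show "integrable lebesgue (\<lambda>\<omega>. 2 * hom_density \<mu> w \<omega> + 2 * hom_density \<mu> f \<omega>)"
      using w(2) fourier_test_fun_square_integrable[OF f \<mu>] by simp
    show "(\<lambda>\<omega>. hom_density \<mu> (\<lambda>x. w x - f x) \<omega>) \<in> borel_measurable lebesgue"
      by (rule meas) (use w fi in simp)
    show "AE \<omega> in lebesgue. norm (hom_density \<mu> (\<lambda>x. w x - f x) \<omega>) \<le>
        norm (2 * hom_density \<mu> w \<omega> + 2 * hom_density \<mu> f \<omega>)"
      unfolding fourier_diff[OF w(1) fi] by (intro AE_I2) (use sq in simp)
  qed
  have "fourier (\<lambda>x. \<phi> x - \<zeta> x) \<omega> = fourier (\<lambda>x. w x - \<zeta> x) \<omega> - fourier (\<lambda>x. w x - \<phi> x) \<omega>" for \<omega>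
    by (simp add: fourier_diff w test_fun_integrable_lebesgue \<phi> \<zeta>)
  then have le: "hom_density \<mu> (\<lambda>x. \<phi> x - \<zeta> x) \<omega> \<le>
      2 * hom_density \<mu> (\<lambda>x. w x - \<phi> x) \<omega> + 2 * hom_density \<mu> (\<lambda>x. w x - \<zeta> x) \<omega>" for \<omega>
    using sq[of "\<bar>\<omega>\<bar> powr \<mu>" "fourier (\<lambda>x. w x - \<zeta> x) \<omega>" "fourier (\<lambda>x. w x - \<phi> x) \<omega>"] by simp
  have "(\<integral>\<omega>. hom_density \<mu> (\<lambda>x. \<phi> x - \<zeta> x) \<omega> \<partial>lebesgue) \<le>
    (\<integral>\<omega>. 2 * hom_density \<mu> (\<lambda>x. w x - \<phi> x) \<omega> + 2 * hom_density \<mu> (\<lambda>x. w x - \<zeta> x) \<omega> \<partial>lebesgue)"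
    by (rule integral_mono[OF fourier_test_fun_square_integrable[OF test_fun_diff[OF \<phi> \<zeta>] \<mu>] _ le])
      (use int[OF \<phi>] int[OF \<zeta>] in simp)
  then show ?thesis using int[OF \<phi>] int[OF \<zeta>] by simp
qed

lemma integrable_zero_ext: assumes "u \<in> L2" shows "integrable lebesgue (zero_ext u)"
proof -
  have "(\<lambda>x. indicator {0<..<1} x *\<^sub>R u x) = zero_ext u" by (auto simp: zero_ext_def)
  then show ?thesis using L2_integrable[OF assms] by (simp only: integrable_unit_iff set_integrable_def)
qed

text \<open>
  Test functions \<open>\<phi> n\<close> that approximate \<open>u\<close> have fractional integrals whose derivatives form a Cauchy
  sequence in \<open>L2\<close>. Its limit is the weak derivative, and it inherits both moments.
\<close>

theorem (in abel_kernel) frac_conv_weak_deriv: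
  assumes u: "u \<in> H0 (1 - \<beta>)"
  obtains h where "h \<in> L2" "has_weak_deriv 1 (frac_conv \<beta> \<theta> u) h"
    "(\<integral>x. h x * \<psi> x \<partial>unit_ivl) = 0"
    "(\<integral>x. h x * (x * \<psi> x) \<partial>unit_ivl) = - ((1 - \<beta>) * c * (\<integral>s. u s \<partial>unit_ivl))"
proof -
  define \<mu> where "\<mu> = 1 - \<beta>"
  have \<mu>: "0 \<le> \<mu>" "\<mu> \<le> 1" using \<beta> by (auto simp: \<mu>_def)
  obtain \<phi> where uL2: "u \<in> L2" and ui: "integrable lebesgue (\<lambda>\<omega>. hom_density \<mu> (zero_ext u) \<omega>)"
    and \<phi>: "\<And>n. \<phi> n \<in> test_fun" and lim: "(\<lambda>n. Hmu_norm \<mu> (\<lambda>x. zero_ext u x - \<phi> n x)) \<longlonglongrightarrow> 0"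
    using u by (auto simp: H0_def \<mu>_def)
  define d where "d n = Hmu_norm \<mu> (\<lambda>x. zero_ext u x - \<phi> n x)" for n
  have d0: "0 \<le> d n" for n by (simp add: d_def Hmu_norm_def)
  have "d = (\<lambda>n. Hmu_norm \<mu> (\<lambda>x. zero_ext u x - \<phi> n x))" by (rule ext) (rule d_def)
  then have dlim: "d \<longlonglongrightarrow> 0" using lim by simp
  have ud: "L2_norm (\<lambda>x. u x - \<phi> n x) \<le> d n" for n unfolding d_def by (rule Hmu_norm_ge(1)[OF uL2 \<phi>])
  define h where "h n = frac_conv \<beta> \<theta> (deriv (\<phi> n))" for n
  define C where "C = (1 / \<beta> + 2)\<^sup>2 / (2 * pi)"
  have C: "0 \<le> C" by (simp add: C_def)
  have hint: "integrable unit_ivl (h n)" for n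
    unfolding h_def by (rule frac_conv_L1(1)[OF test_fun_integrable[OF test_fun_deriv[OF \<phi>]]])
  have hL2: "h n \<in> L2" for n
  proof -
    obtain B where B: "0 \<le> B" "\<And>x. x \<in> {0<..<1} \<Longrightarrow> \<bar>h n x\<bar> \<le> B"
      unfolding h_def using ker_integral_test_bounded[OF \<beta>(1) test_fun_deriv[OF \<phi>[of n]], of \<theta>] by blast
    show ?thesis
      by (rule L2_bounded(1)[OF borel_measurable_integrable[OF hint] _ B(1)]) (rule AE_I2, use B(2) in simp)
  qed
  have hd: "L2_norm (\<lambda>x. h n x - h m x) \<le> sqrt (2 * C) * (d n + d m)" for n m
  proof -
    let ?\<delta> = "\<lambda>x. \<phi> n x - \<phi> m x"
    have t: "?\<delta> \<in> test_fun" by (rule test_fun_diff[OF \<phi> \<phi>])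
    have dd: "deriv ?\<delta> = (\<lambda>x. deriv (\<phi> n) x - deriv (\<phi> m) x)"
      by (intro ext DERIV_imp_deriv DERIV_diff test_fun_DERIV \<phi>)
    have ae: "AE x in unit_ivl. frac_conv \<beta> \<theta> (deriv ?\<delta>) x = h n x - h m x"
      unfolding dd h_def by (rule frac_conv_diff_AE) (rule test_fun_integrable[OF test_fun_deriv[OF \<phi>]])+
    have "(L2_norm (\<lambda>x. h n x - h m x))\<^sup>2 = (\<integral>x. (frac_conv \<beta> \<theta> (deriv ?\<delta>) x)\<^sup>2 \<partial>unit_ivl)"
      unfolding L2_norm_sq
    proof (rule integral_cong_AE)
      show "AE x in unit_ivl. (h n x - h m x)\<^sup>2 = (frac_conv \<beta> \<theta> (deriv ?\<delta>) x)\<^sup>2"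
        using ae by eventually_elim simp
      show "(\<lambda>x. (h n x - h m x)\<^sup>2) \<in> borel_measurable unit_ivl"
        using hint[of n] hint[of m] by (intro borel_measurable_power borel_measurable_diff) auto
      show "(\<lambda>x. (frac_conv \<beta> \<theta> (deriv ?\<delta>) x)\<^sup>2) \<in> borel_measurable unit_ivl"
        by (intro borel_measurable_power frac_conv_measurable test_fun_integrable test_fun_deriv t)
    qed
    also have "\<dots> \<le> C * (\<integral>\<omega>. hom_density \<mu> ?\<delta> \<omega> \<partial>lebesgue)"
      unfolding C_def \<mu>_def frac_conv_def by (rule frac_deriv_L2_le[OF \<beta> \<theta> t])
    also have "\<dots> \<le> C * (2 * (d n)\<^sup>2 + 2 * (d m)\<^sup>2)"
    proof (rule mult_left_mono[OF _ C])
      show "(\<integral>\<omega>. hom_density \<mu> ?\<delta> \<omega> \<partial>lebesgue) \<le> 2 * (d n)\<^sup>2 + 2 * (d m)\<^sup>2"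
        using Hmu_seminorm_diff_le[OF integrable_zero_ext[OF uL2] ui \<mu> \<phi>[of n] \<phi>[of m]]
          Hmu_norm_ge(2)[OF uL2 \<phi>[of n], of \<mu>] Hmu_norm_ge(2)[OF uL2 \<phi>[of m], of \<mu>] unfolding d_def by linarith
    qed
    also have "\<dots> \<le> (2 * C) * (d n + d m)\<^sup>2"
      using C d0[of n] d0[of m] by (simp add: power2_sum algebra_simps)
    also have "\<dots> = (sqrt (2 * C) * (d n + d m))\<^sup>2" using C by (simp add: power_mult_distrib)
    finally show ?thesis by (rule power2_le_imp_le) (use C d0[of n] d0[of m] in simp)
  qed
  obtain g where g: "g \<in> L2" "\<And>n. L2_norm (\<lambda>x. g x - h n x) \<le> sqrt (2 * C) * d n"
    by (rule L2_complete[OF hL2 dlim _ d0 hd]) (use C in auto)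
  have Clim: "(\<lambda>n. sqrt (2 * C) * d n) \<longlonglongrightarrow> 0" using tendsto_mult_left[OF dlim, of "sqrt (2 * C)"] by simp
  have hk: "(\<lambda>n. \<integral>x. h n x * k x \<partial>unit_ivl) \<longlonglongrightarrow> (\<integral>x. g x * k x \<partial>unit_ivl)" if "k \<in> L2" for k
    by (rule L2_pairing_tendsto[OF g(1) hL2 that Clim g(2)])
  have uint: "integrable unit_ivl u" by (rule L2_integrable[OF uL2])
  have \<phi>int: "integrable unit_ivl (\<phi> n)" for n by (rule test_fun_integrable[OF \<phi>])
  have "has_weak_deriv 1 (frac_conv \<beta> \<theta> u) g"
    unfolding has_weak_deriv_def
  proof (intro conjI ballI)
    show "loc_integrable (frac_conv \<beta> \<theta> u)" by (rule loc_integrable_unit[OF frac_conv_L1(1)[OF uint]])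
    show "loc_integrable g" by (rule loc_integrable_unit[OF L2_integrable[OF g(1)]])
    fix \<zeta> assume \<zeta>: "\<zeta> \<in> test_fun"
    obtain B where B: "0 \<le> B" "\<And>x. \<bar>deriv \<zeta> x\<bar> \<le> B" using test_fun_bounded[OF test_fun_deriv[OF \<zeta>]] by blast
    have "(\<lambda>n. L2_inner (frac_conv \<beta> \<theta> (\<phi> n)) (deriv \<zeta>)) \<longlonglongrightarrow> L2_inner (frac_conv \<beta> \<theta> u) (deriv \<zeta>)"
    proof (rule LIM_zero_cancel, rule Lim_null_comparison)
      show "(\<lambda>n. B * c * d n) \<longlonglongrightarrow> 0" using tendsto_mult_left[OF dlim, of "B * c"] by simp
      show "\<forall>\<^sub>F n in sequentially. norm (L2_inner (frac_conv \<beta> \<theta> (\<phi> n)) (deriv \<zeta>) - L2_inner (frac_conv \<beta> \<theta> u) (deriv \<zeta>)) \<le> B * c * d n"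
      proof (rule always_eventually, rule allI)
        fix n
        let ?v = "\<lambda>x. u x - \<phi> n x"
        have vint: "integrable unit_ivl ?v" using uint \<phi>int by simp
        note l = loc_integrable_unit[OF frac_conv_L1(1)[OF uint]] loc_integrable_unit[OF frac_conv_L1(1)[OF \<phi>int[of n]]]
        have "L2_inner (frac_conv \<beta> \<theta> u) (deriv \<zeta>) - L2_inner (frac_conv \<beta> \<theta> (\<phi> n)) (deriv \<zeta>) = L2_inner (\<lambda>x. frac_conv \<beta> \<theta> u x - frac_conv \<beta> \<theta> (\<phi> n) x) (deriv \<zeta>)"
          by (rule L2_inner_diff[OF l test_fun_deriv[OF \<zeta>], symmetric])
        also have "\<dots> = L2_inner (frac_conv \<beta> \<theta> ?v) (deriv \<zeta>)"
          by (rule L2_inner_AE_cong[symmetric, OF loc_integrable_unit[OF frac_conv_L1(1)[OF vint]] frac_conv_diff_AE[OF uint \<phi>int] test_fun_deriv[OF \<zeta>]])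
        finally have "norm (L2_inner (frac_conv \<beta> \<theta> (\<phi> n)) (deriv \<zeta>) - L2_inner (frac_conv \<beta> \<theta> u) (deriv \<zeta>)) = \<bar>\<integral>x. frac_conv \<beta> \<theta> ?v x * deriv \<zeta> x \<partial>unit_ivl\<bar>"
          unfolding L2_inner_def by (simp add: abs_minus_commute)
        also have "\<dots> \<le> (\<integral>x. \<bar>frac_conv \<beta> \<theta> ?v x * deriv \<zeta> x\<bar> \<partial>unit_ivl)" by (rule integral_abs_bound)
        also have "\<dots> \<le> (\<integral>x. B * \<bar>frac_conv \<beta> \<theta> ?v x\<bar> \<partial>unit_ivl)"
        proof (rule integral_mono)
          show "integrable unit_ivl (\<lambda>x. \<bar>frac_conv \<beta> \<theta> ?v x * deriv \<zeta> x\<bar>)"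
            by (rule integrable_abs[OF integrable_test_fun_mult[OF loc_integrable_unit[OF frac_conv_L1(1)[OF vint]] test_fun_deriv[OF \<zeta>]]])
          show "integrable unit_ivl (\<lambda>x. B * \<bar>frac_conv \<beta> \<theta> ?v x\<bar>)" using frac_conv_L1(1)[OF vint] by simp
          show "\<bar>frac_conv \<beta> \<theta> ?v x * deriv \<zeta> x\<bar> \<le> B * \<bar>frac_conv \<beta> \<theta> ?v x\<bar>" for x
            unfolding abs_mult mult.commute[of B] by (rule mult_left_mono[OF B(2)]) simp
        qed
        also have "\<dots> \<le> B * (c * (\<integral>s. \<bar>?v s\<bar> \<partial>unit_ivl))"
          using mult_left_mono[OF frac_conv_L1(2)[OF vint] B(1)] by simp
        also have "\<dots> \<le> B * (c * d n)"
          using order_trans[OF integral_abs_le_L2_norm[OF L2_diff[OF uL2 test_fun_L2[OF \<phi>[of n]]]] ud] B c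
          by (intro mult_left_mono) auto
        finally show "norm (L2_inner (frac_conv \<beta> \<theta> (\<phi> n)) (deriv \<zeta>) - L2_inner (frac_conv \<beta> \<theta> u) (deriv \<zeta>)) \<le> B * c * d n"
          by simp
      qed
    qed
    moreover have "L2_inner (frac_conv \<beta> \<theta> (\<phi> n)) (deriv \<zeta>) = - (\<integral>x. h n x * \<zeta> x \<partial>unit_ivl)" for n
      using frac_conv_test_weak_deriv[OF \<phi>[of n]] \<zeta> by (simp add: has_weak_deriv_def L2_inner_def h_def)
    ultimately have "(\<lambda>n. - (\<integral>x. h n x * \<zeta> x \<partial>unit_ivl)) \<longlonglongrightarrow> L2_inner (frac_conv \<beta> \<theta> u) (deriv \<zeta>)" by simp
    moreover have "(\<lambda>n. - (\<integral>x. h n x * \<zeta> x \<partial>unit_ivl)) \<longlonglongrightarrow> - (\<integral>x. g x * \<zeta> x \<partial>unit_ivl)"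
      by (intro tendsto_minus hk test_fun_L2 \<zeta>)
    ultimately show "L2_inner (frac_conv \<beta> \<theta> u) ((deriv ^^ 1) \<zeta>) = (- 1) ^ 1 * L2_inner g \<zeta>"
      using LIMSEQ_unique by (fastforce simp: L2_inner_def)
  qed
  moreover have "(\<integral>x. g x * \<psi> x \<partial>unit_ivl) = 0"
    using hk[OF \<psi>_L2] frac_conv_deriv_moments(1)[OF \<phi>] by (simp add: h_def LIMSEQ_const_iff)
  moreover have "(\<integral>x. g x * (x * \<psi> x) \<partial>unit_ivl) = - ((1 - \<beta>) * c * (\<integral>s. u s \<partial>unit_ivl))"
  proof (rule LIMSEQ_unique)
    have x\<psi>: "(\<lambda>x. x * \<psi> x) \<in> L2"
      by (rule L2_mult_bounded(1)[OF \<psi>_L2 measurable_id_unit, of 1]) auto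
    show "(\<lambda>n. \<integral>x. h n x * (x * \<psi> x) \<partial>unit_ivl) \<longlonglongrightarrow> (\<integral>x. g x * (x * \<psi> x) \<partial>unit_ivl)" by (rule hk[OF x\<psi>])
    have one: "(\<lambda>_. 1) \<in> L2" by (rule L2_bounded(1)[of _ 1]) auto
    have "(\<lambda>n. \<integral>s. \<phi> n s * 1 \<partial>unit_ivl) \<longlonglongrightarrow> (\<integral>s. u s * 1 \<partial>unit_ivl)"
      by (rule L2_pairing_tendsto[OF uL2 test_fun_L2[OF \<phi>] one dlim ud])
    then have "(\<lambda>n. - ((1 - \<beta>) * c * (\<integral>s. \<phi> n s \<partial>unit_ivl))) \<longlonglongrightarrow> - ((1 - \<beta>) * c * (\<integral>s. u s \<partial>unit_ivl))"
      by (intro tendsto_minus tendsto_mult tendsto_const) simp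
    then show "(\<lambda>n. \<integral>x. h n x * (x * \<psi> x) \<partial>unit_ivl) \<longlonglongrightarrow> - ((1 - \<beta>) * c * (\<integral>s. u s \<partial>unit_ivl))"
      unfolding h_def frac_conv_deriv_moments(2)[OF \<phi>] .
  qed
  ultimately show ?thesis by (intro that[OF g(1)])
qed

section \<open>Products in integer order Sobolev spaces\<close>

text \<open>
  Bounding one weak derivative of first order after the other suits inductions over the order better
  than the list of derivatives in the definition of \<open>Sobolev\<close>; \<open>sob_le_imp_Sobolev\<close> and
  \<open>Sobolev_imp_sob_le\<close> translate between the two.
\<close>

fun sob_le :: "nat \<Rightarrow> (real \<Rightarrow> real) \<Rightarrow> real \<Rightarrow> bool" where
  "sob_le 0 g N \<longleftrightarrow> g \<in> L2 \<and> L2_norm g \<le> N"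
| "sob_le (Suc n) g N \<longleftrightarrow> g \<in> L2 \<and> L2_norm g \<le> N \<and> (\<exists>g'. has_weak_deriv 1 g g' \<and> sob_le n g' N)"

lemma sob_le_L2: "sob_le n g N \<Longrightarrow> g \<in> L2" "sob_le n g N \<Longrightarrow> L2_norm g \<le> N"
  by (cases n; simp)+

lemma sob_le_mono: "sob_le n g N \<Longrightarrow> N \<le> M \<Longrightarrow> sob_le n g M"
  by (induction n arbitrary: g) (auto intro: order_trans)

lemma sob_le_lower: "sob_le (Suc n) g N \<Longrightarrow> sob_le n g N"
  by (induction n arbitrary: g) (auto)

lemma sob_le_AE_cong:
  assumes "sob_le n g N" "AE x in unit_ivl. g x = f x" shows "sob_le n f N"
proof -
  have "f \<in> L2" "L2_norm f \<le> N"
    using sob_le_L2[OF assms(1)] L2_AE_cong[OF _ assms(2)] L2_norm_AE_cong[OF _ assms(2)] by auto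
  moreover have "has_weak_deriv 1 f g'" if "has_weak_deriv 1 g g'" for g'
    using has_weak_deriv_AE_cong[OF that assms(2)] by simp
  ultimately show ?thesis using assms(1) by (cases n) auto
qed

lemma has_weak_deriv_add:
  assumes "has_weak_deriv k f f'" "has_weak_deriv k g g'"
  shows "has_weak_deriv k (\<lambda>x. f x + g x) (\<lambda>x. f' x + g' x)"
proof -
  have la: "loc_integrable (\<lambda>x. a x + b x)" if "loc_integrable a" "loc_integrable b" for a b :: "real \<Rightarrow> real"
    using that unfolding loc_integrable_def by (auto intro: set_integral_add)
  have add: "L2_inner (\<lambda>x. a x + b x) \<phi> = L2_inner a \<phi> + L2_inner b \<phi>"
    if "loc_integrable a" "loc_integrable b" "\<phi> \<in> test_fun" for a b \<phi>
    unfolding L2_inner_def distrib_right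
    by (intro Bochner_Integration.integral_add integrable_test_fun_mult that)
  show ?thesis
    using assms la add test_fun_deriv_pow unfolding has_weak_deriv_def by (simp add: distrib_left)
qed

lemma sob_le_add:
  "sob_le n f N \<Longrightarrow> sob_le n g M \<Longrightarrow> sob_le n (\<lambda>x. f x + g x) (2 * (N + M))"
proof (induction n arbitrary: f g)
  case 0
  then show ?case using L2_add[of f g] by force
next
  case (Suc n)
  then obtain f' g' where "has_weak_deriv 1 f f'" "sob_le n f' N" "has_weak_deriv 1 g g'" "sob_le n g' M" by auto
  then have "has_weak_deriv 1 (\<lambda>x. f x + g x) (\<lambda>x. f' x + g' x)" "sob_le n (\<lambda>x. f' x + g' x) (2 * (N + M))"
    using has_weak_deriv_add Suc.IH by auto
  then show ?case using Suc.prems L2_add[of f g] by fastforce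
qed

lemma has_weak_deriv_trans:
  assumes "has_weak_deriv 1 g g'" "has_weak_deriv i g' h"
  shows "has_weak_deriv (Suc i) g h"
  using assms test_fun_deriv_pow unfolding has_weak_deriv_def by simp

lemma sob_le_derivs:
  "sob_le n g N \<Longrightarrow> j \<le> n \<Longrightarrow> \<exists>h\<in>L2. has_weak_deriv j g h \<and> L2_norm h \<le> N"
proof (induction n arbitrary: g j)
  case 0
  then show ?case
    using has_weak_deriv_0[OF loc_integrable_unit[OF L2_integrable[of g]]] by auto
next
  case (Suc n)
  show ?case
  proof (cases j)
    case 0
    then show ?thesis
      using has_weak_deriv_0[OF loc_integrable_unit[OF L2_integrable[of g]]] Suc.prems by auto
  next
    case (Suc i)
    obtain g' where "has_weak_deriv 1 g g'" "sob_le n g' N" using Suc.prems by auto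
    then show ?thesis using Suc.IH[of g' i] Suc Suc.prems has_weak_deriv_trans by fastforce
  qed
qed

lemma sob_le_imp_Sobolev:
  assumes "sob_le n g N" "0 \<le> N"
  shows "g \<in> Sobolev n" "Sobolev_norm n g \<le> real (Suc n) * N"
proof -
  show "g \<in> Sobolev n"
    using sob_le_derivs[OF assms(1)] sob_le_L2[OF assms(1)] by (auto simp: Sobolev_def)
  have le: "(L2_norm (weak_deriv j g))\<^sup>2 \<le> N\<^sup>2" if j: "j \<le> n" for j
  proof -
    obtain h where h: "h \<in> L2" "has_weak_deriv j g h" "L2_norm h \<le> N"
      using sob_le_derivs[OF assms(1) j] by auto
    then have "L2_norm (weak_deriv j g) \<le> N" using L2_norm_weak_deriv by simp
    then show ?thesis by (intro power_mono) auto
  qed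
  have "(\<Sum>j\<le>n. (L2_norm (weak_deriv j g))\<^sup>2) \<le> (\<Sum>j\<le>n. N\<^sup>2)"
    by (intro sum_mono le) simp
  also have "\<dots> = real (Suc n) * N\<^sup>2" by simp
  also have "\<dots> \<le> (real (Suc n))\<^sup>2 * N\<^sup>2"
    by (intro mult_right_mono) (simp_all add: power2_eq_square)
  also have "\<dots> = (real (Suc n) * N)\<^sup>2" by (simp only: power_mult_distrib)
  finally have sq: "(\<Sum>j\<le>n. (L2_norm (weak_deriv j g))\<^sup>2) \<le> (real (Suc n) * N)\<^sup>2" .
  show "Sobolev_norm n g \<le> real (Suc n) * N"
    unfolding Sobolev_norm_def by (rule real_le_lsqrt[OF _ sq]) (use assms(2) in simp)
qed

lemma Sobolev_imp_sob_le:
  assumes "f \<in> Sobolev m" shows "sob_le m f (Sobolev_norm m f)"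
proof -
  have d: "weak_deriv j f \<in> L2" "has_weak_deriv j f (weak_deriv j f)" if "j \<le> m" for j
    using assms that L2_norm_weak_deriv(1) has_weak_deriv_weak_deriv unfolding Sobolev_def by blast+
  have n: "L2_norm (weak_deriv j f) \<le> Sobolev_norm m f" if "j \<le> m" for j
  proof -
    have "(L2_norm (weak_deriv j f))\<^sup>2 \<le> (\<Sum>j\<le>m. (L2_norm (weak_deriv j f))\<^sup>2)"
      by (rule member_le_sum) (use that in auto)
    then show ?thesis unfolding Sobolev_norm_def by (rule real_le_rsqrt)
  qed
  have "i + j = m \<Longrightarrow> sob_le i (weak_deriv j f) (Sobolev_norm m f)" for i j
  proof (induction i arbitrary: j)
    case 0
    then show ?case using d[of j] n[of j] by simp
  next
    case (Suc i)
    have "has_weak_deriv 1 (weak_deriv j f) (weak_deriv (Suc j) f)"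
      using has_weak_deriv_Suc_iff[OF d(2)[of j]] d(2)[of "Suc j"] Suc.prems by simp
    then show ?case using Suc.IH[of "Suc j"] d(1)[of j] n[of j] Suc.prems by auto
  qed
  from this[of m 0] have s: "sob_le m (weak_deriv 0 f) (Sobolev_norm m f)" by simp
  have "f \<in> L2" using assms by (simp add: Sobolev_def)
  then have "has_weak_deriv 0 f f" by (intro has_weak_deriv_0 loc_integrable_unit L2_integrable)
  then have "AE x in unit_ivl. weak_deriv 0 f x = f x" using has_weak_deriv_unique[OF d(2)[of 0]] by simp
  then show ?thesis by (rule sob_le_AE_cong[OF s])
qed

lemma vector_derivative_imp_continuous_on:
  assumes "\<And>x. x \<in> S \<Longrightarrow> (a has_vector_derivative a' x) (at x within S)"
  shows "continuous_on S a"
  unfolding continuous_on_eq_continuous_within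
proof
  fix x assume "x \<in> S"
  then show "continuous (at x within S) a"
    by (rule has_vector_derivative_continuous[OF assms])
qed

text \<open>
  The product of a coefficient and a test function need not be a test function. But \<open>g\<close> is, up to a
  constant, the primitive of \<open>g'\<close>, and for primitives \<open>integral_prim_by_parts\<close> admits such products.
\<close>

lemma has_weak_deriv_mult:
  assumes g: "g \<in> L2" and g': "g' \<in> L2" and w: "has_weak_deriv 1 g g'"
    and d: "\<And>x. x \<in> {0..1} \<Longrightarrow> (a has_vector_derivative a' x) (at x within {0..1})"
    and a': "continuous_on {0..1} a'"
  shows "has_weak_deriv 1 (\<lambda>x. a x * g x) (\<lambda>x. a' x * g x + a x * g' x)"
proof -
  have a: "continuous_on {0..1} a" by (rule vector_derivative_imp_continuous_on[OF d])
  note gi = L2_integrable[OF g] and gi' = L2_integrable[OF g']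
  have i1: "integrable unit_ivl (\<lambda>x. a x * g x)" "integrable unit_ivl (\<lambda>x. a' x * g x)" "integrable unit_ivl (\<lambda>x. a x * g' x)"
    using integrable_unit_mult_continuous[OF gi a] integrable_unit_mult_continuous[OF gi a']
      integrable_unit_mult_continuous[OF gi' a] by (simp_all add: mult.commute)
  obtain c where c: "AE x in unit_ivl. g x = c + prim g' x" using du_Bois_Reymond[OF w gi'] by blast
  show ?thesis
    unfolding has_weak_deriv_def
  proof (intro conjI ballI)
    show "loc_integrable (\<lambda>x. a x * g x)" "loc_integrable (\<lambda>x. a' x * g x + a x * g' x)"
      using i1 by (auto intro!: loc_integrable_unit)
    fix \<phi> assume \<phi>: "\<phi> \<in> test_fun"
    let ?r = "\<lambda>x. a x * \<phi> x" and ?r' = "\<lambda>x. a x * deriv \<phi> x + a' x * \<phi> x"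
    have rd: "(?r has_vector_derivative ?r' x) (at x within {0..1})" if "x \<in> {0..1}" for x
      using has_vector_derivative_mult[OF d[OF that] test_fun_vector_derivative[OF \<phi>]] by simp
    have rc: "continuous_on {0..1} ?r'"
      by (intro continuous_on_add continuous_on_mult a a' test_fun_cont[OF \<phi>] test_fun_cont[OF test_fun_deriv[OF \<phi>]])
    have r0: "?r 1 = 0" using test_fun_zero[OF \<phi>, of 1] by simp
    have "(\<integral>x. indicator {0<..} x * ?r' x \<partial>unit_ivl) = ?r 1 - ?r 0"
      by (rule integral_tail_deriv[OF rc rd]) auto
    moreover have "(\<integral>x. indicator {0<..} x * ?r' x \<partial>unit_ivl) = (\<integral>x. ?r' x \<partial>unit_ivl)"
      by (rule Bochner_Integration.integral_cong) auto
    ultimately have r'0: "(\<integral>x. ?r' x \<partial>unit_ivl) = 0"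
      using test_fun_zero[OF \<phi>, of 1] test_fun_zero[OF \<phi>, of 0] by simp
    have r'i: "integrable unit_ivl ?r'"
      using integrable_unit_mult_continuous[OF U.integrable_const rc, of 1] by simp
    have pi: "integrable unit_ivl (\<lambda>x. prim g' x * ?r' x)"
      by (rule integrable_unit_mult_continuous[OF integrable_prim[OF gi'] rc])
    have gri: "integrable unit_ivl (\<lambda>x. g x * ?r' x)" by (rule integrable_unit_mult_continuous[OF gi rc])
    have "(\<integral>x. g x * ?r' x \<partial>unit_ivl) = (\<integral>x. c * ?r' x + prim g' x * ?r' x \<partial>unit_ivl)"
    proof (rule integral_cong_AE)
      show "AE x in unit_ivl. g x * ?r' x = c * ?r' x + prim g' x * ?r' x"
        using c by eventually_elim (simp add: distrib_right)
    qed (use gri r'i pi in auto)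
    also have "\<dots> = c * (\<integral>x. ?r' x \<partial>unit_ivl) + (\<integral>x. prim g' x * ?r' x \<partial>unit_ivl)"
      by (subst Bochner_Integration.integral_add[OF _ pi]) (use r'i in simp_all)
    also have "\<dots> = - (\<integral>x. g' x * ?r x \<partial>unit_ivl)"
    proof -
      have "(\<integral>x. prim g' x * ?r' x \<partial>unit_ivl) = - (\<integral>x. g' x * ?r x \<partial>unit_ivl)"
        by (rule integral_prim_by_parts[OF gi' rc rd r0])
      then show ?thesis by (simp only: r'0)
    qed
    finally have main: "(\<integral>x. g x * ?r' x \<partial>unit_ivl) = - (\<integral>x. g' x * ?r x \<partial>unit_ivl)" .
    have ti: "integrable unit_ivl (\<lambda>x. a x * g x * deriv \<phi> x)" "integrable unit_ivl (\<lambda>x. a' x * g x * \<phi> x)" "integrable unit_ivl (\<lambda>x. a x * g' x * \<phi> x)"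
      by (rule integrable_test_fun_mult[OF loc_integrable_unit[OF i1(1)] test_fun_deriv[OF \<phi>]],
          rule integrable_test_fun_mult[OF loc_integrable_unit[OF i1(2)] \<phi>],
          rule integrable_test_fun_mult[OF loc_integrable_unit[OF i1(3)] \<phi>])
    have "(\<integral>x. g x * ?r' x \<partial>unit_ivl) = (\<integral>x. a x * g x * deriv \<phi> x + a' x * g x * \<phi> x \<partial>unit_ivl)"
      by (rule Bochner_Integration.integral_cong) (auto simp: algebra_simps)
    also have "\<dots> = (\<integral>x. a x * g x * deriv \<phi> x \<partial>unit_ivl) + (\<integral>x. a' x * g x * \<phi> x \<partial>unit_ivl)"
      by (rule Bochner_Integration.integral_add[OF ti(1,2)])
    finally have "(\<integral>x. a x * g x * deriv \<phi> x \<partial>unit_ivl) + (\<integral>x. a' x * g x * \<phi> x \<partial>unit_ivl) = - (\<integral>x. a x * g' x * \<phi> x \<partial>unit_ivl)"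
      using main by (simp add: mult_ac)
    moreover have "(\<integral>x. (a' x * g x + a x * g' x) * \<phi> x \<partial>unit_ivl) = (\<integral>x. a' x * g x * \<phi> x \<partial>unit_ivl) + (\<integral>x. a x * g' x * \<phi> x \<partial>unit_ivl)"
      unfolding distrib_right by (rule Bochner_Integration.integral_add[OF ti(2,3)])
    ultimately show "L2_inner (\<lambda>x. a x * g x) ((deriv ^^ 1) \<phi>) = (- 1) ^ 1 * L2_inner (\<lambda>x. a' x * g x + a x * g' x) \<phi>"
      by (simp add: L2_inner_def)
  qed
qed

text \<open>
  The spaces \<open>Ck\<close> without reference to iterated derivatives, which keeps products and reciprocals
  simple.
\<close>

fun cont_diff :: "nat \<Rightarrow> (real \<Rightarrow> real) \<Rightarrow> bool" where
  "cont_diff 0 a \<longleftrightarrow> continuous_on {0..1} a"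
| "cont_diff (Suc n) a \<longleftrightarrow>
    (\<exists>a'. (\<forall>x\<in>{0..1}. (a has_vector_derivative a' x) (at x within {0..1})) \<and> cont_diff n a')"

lemma cont_diff_continuous: assumes "cont_diff n a" shows "continuous_on {0..1} a"
proof (cases n)
  case (Suc k)
  then obtain a' where "\<forall>x\<in>{0..1}. (a has_vector_derivative a' x) (at x within {0..1})" using assms by auto
  then show ?thesis by (intro vector_derivative_imp_continuous_on[where a'=a']) blast
qed (use assms in simp)

lemma cont_diff_lower: "cont_diff (Suc n) a \<Longrightarrow> cont_diff n a"
proof (induction n arbitrary: a)
  case 0
  then show ?case using cont_diff_continuous by fastforce
qed auto

lemma cont_diff_const: "cont_diff n (\<lambda>_. c)"
  by (induction n arbitrary: c) (auto intro!: exI[of _ "\<lambda>_. 0"])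

lemma cont_diff_add: "cont_diff n a \<Longrightarrow> cont_diff n b \<Longrightarrow> cont_diff n (\<lambda>x. a x + b x)"
proof (induction n arbitrary: a b)
  case (Suc n)
  then obtain a' b' where ab: "\<forall>x\<in>{0..1}. (a has_vector_derivative a' x) (at x within {0..1})" "cont_diff n a'"
    "\<forall>x\<in>{0..1}. (b has_vector_derivative b' x) (at x within {0..1})" "cont_diff n b'" by auto
  have "\<forall>x\<in>{0..1}. ((\<lambda>x. a x + b x) has_vector_derivative a' x + b' x) (at x within {0..1})"
    using ab(1,3) by (auto intro: has_vector_derivative_add)
  then show ?case using Suc.IH[OF ab(2,4)] by auto
qed (auto intro: continuous_on_add)

lemma cont_diff_mult: "cont_diff n a \<Longrightarrow> cont_diff n b \<Longrightarrow> cont_diff n (\<lambda>x. a x * b x)"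
proof (induction n arbitrary: a b)
  case (Suc n)
  then obtain a' b' where ab: "\<forall>x\<in>{0..1}. (a has_vector_derivative a' x) (at x within {0..1})" "cont_diff n a'"
    "\<forall>x\<in>{0..1}. (b has_vector_derivative b' x) (at x within {0..1})" "cont_diff n b'" by auto
  have "\<forall>x\<in>{0..1}. ((\<lambda>x. a x * b x) has_vector_derivative a x * b' x + a' x * b x) (at x within {0..1})"
    using ab(1,3) has_vector_derivative_mult by blast
  moreover have "cont_diff n (\<lambda>x. a x * b' x + a' x * b x)"
    by (intro cont_diff_add Suc.IH ab cont_diff_lower[OF Suc.prems(1)] cont_diff_lower[OF Suc.prems(2)])
  ultimately show ?case by auto
qed (auto intro: continuous_on_mult)

lemma cont_diff_inverse:
  assumes "cont_diff n a" "\<And>x. x \<in> {0..1} \<Longrightarrow> a x \<noteq> 0" shows "cont_diff n (\<lambda>x. 1 / a x)"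
  using assms
proof (induction n arbitrary: a)
  case 0
  then show ?case by (auto intro!: continuous_on_divide)
next
  case (Suc n)
  then obtain a' where a': "\<forall>x\<in>{0..1}. (a has_vector_derivative a' x) (at x within {0..1})" "cont_diff n a'" by auto
  have D: "((\<lambda>x. 1 / a x) has_vector_derivative (-1 * a' x) * (1 / a x * (1 / a x))) (at x within {0..1})" if x: "x \<in> {0..1}" for x
  proof -
    have "(a has_real_derivative a' x) (at x within {0..1})"
      using a'(1) x by (simp add: has_real_derivative_iff_has_vector_derivative)
    from DERIV_divide[OF DERIV_const this Suc.prems(2)[OF x], of 1] show ?thesis
      by (simp add: has_real_derivative_iff_has_vector_derivative)
  qed
  have i: "cont_diff n (\<lambda>x. 1 / a x)"
    by (rule Suc.IH[OF cont_diff_lower[OF Suc.prems(1)] Suc.prems(2)])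
  have c: "cont_diff n (\<lambda>x. (-1 * a' x) * (1 / a x * (1 / a x)))"
    by (intro cont_diff_mult cont_diff_const a' i)
  show ?case unfolding cont_diff.simps
    by (rule exI[of _ "\<lambda>x. (-1 * a' x) * (1 / a x * (1 / a x))"], rule conjI, rule ballI, rule D, assumption, rule c)
qed

lemma Ck_imp_cont_diff:
  assumes "g \<in> Ck k" shows "cont_diff k g"
proof -
  have "i + j = k \<Longrightarrow> cont_diff i (cderiv j g)" for i j
  proof (induction i arbitrary: j)
    case 0
    then show ?case using assms by (auto simp: Ck_def)
  next
    case (Suc i)
    have "cderiv j g differentiable_on {0..1}" using assms Suc.prems by (auto simp: Ck_def)
    then have "\<forall>x\<in>{0..1}. (cderiv j g has_vector_derivative cderiv (Suc j) g x) (at x within {0..1})"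
      by (simp add: differentiable_on_def vector_derivative_works cderiv_def)
    then show ?case using Suc.IH[of "Suc j"] Suc.prems by auto
  qed
  from this[of k 0] show ?thesis by (simp add: cderiv_def)
qed

lemma Ck_norm_nonneg: "g \<in> Ck k \<Longrightarrow> 0 \<le> Ck_norm k g"
proof -
  assume g: "g \<in> Ck k"
  have "continuous_on {0..1} (cderiv 0 g)" using g by (simp add: Ck_def)
  then obtain B where "\<And>x. x \<in> {0..1} \<Longrightarrow> \<bar>cderiv 0 g x\<bar> \<le> B"
    using continuous_unit(2) by blast
  then have "bdd_above ((\<lambda>x. \<bar>cderiv 0 g x\<bar>) ` {0..1})" by (auto intro!: bdd_aboveI[of _ B])
  then have "\<bar>cderiv 0 g 0\<bar> \<le> (SUP x\<in>{0..1}. \<bar>cderiv 0 g x\<bar>)" by (rule cSUP_upper[rotated]) simp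
  also have "\<dots> \<le> Ck_norm k g" unfolding Ck_norm_def by (rule Max_ge) auto
  finally show ?thesis by (rule order_trans[OF abs_ge_zero])
qed

text \<open>
  Induction over the order with the product rule \<open>(a g)' = a' g + a g'\<close>; the constant depends only on
  the coefficient.
\<close>

lemma sob_le_mult:
  "cont_diff n a \<Longrightarrow> \<exists>C\<ge>0. \<forall>g N. sob_le n g N \<longrightarrow> sob_le n (\<lambda>x. a x * g x) (C * N)"
proof (induction n arbitrary: a)
  case 0
  obtain B where B: "0 \<le> B" "\<And>x. x \<in> {0..1} \<Longrightarrow> \<bar>a x\<bar> \<le> B"
    using continuous_unit(2)[OF cont_diff_continuous[OF 0]] by blast
  note am = continuous_unit(1)[OF cont_diff_continuous[OF 0]]
  have "sob_le 0 (\<lambda>x. a x * g x) (B * N)" if "sob_le 0 g N" for g N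
  proof -
    have g: "g \<in> L2" "L2_norm g \<le> N" using that by auto
    have m: "(\<lambda>x. a x * g x) \<in> L2" "L2_norm (\<lambda>x. a x * g x) \<le> B * L2_norm g"
      by (rule L2_mult_bounded[OF g(1) am _ B(1)]; use B(2) in simp)+
    then show ?thesis using mult_left_mono[OF g(2) B(1)] by simp
  qed
  then show ?case using B(1) by blast
next
  case (Suc n)
  obtain B where B: "0 \<le> B" "\<And>x. x \<in> {0..1} \<Longrightarrow> \<bar>a x\<bar> \<le> B"
    using continuous_unit(2)[OF cont_diff_continuous[OF Suc.prems]] by blast
  note am = continuous_unit(1)[OF cont_diff_continuous[OF Suc.prems]]
  obtain a' where a': "\<forall>x\<in>{0..1}. (a has_vector_derivative a' x) (at x within {0..1})" "cont_diff n a'"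
    using Suc.prems by auto
  obtain C1 where C1: "0 \<le> C1" "\<And>g N. sob_le n g N \<Longrightarrow> sob_le n (\<lambda>x. a' x * g x) (C1 * N)"
    using Suc.IH[OF a'(2)] by blast
  obtain C2 where C2: "0 \<le> C2" "\<And>g N. sob_le n g N \<Longrightarrow> sob_le n (\<lambda>x. a x * g x) (C2 * N)"
    using Suc.IH[OF cont_diff_lower[OF Suc.prems]] by blast
  let ?C = "B + 2 * (C1 + C2)"
  have "sob_le (Suc n) (\<lambda>x. a x * g x) (?C * N)" if g: "sob_le (Suc n) g N" for g N
  proof -
    have gL: "g \<in> L2" "L2_norm g \<le> N" using g by auto
    have N: "0 \<le> N" using gL(2) L2_norm_nonneg[of g] by linarith
    obtain g' where g': "has_weak_deriv 1 g g'" "sob_le n g' N" using g by auto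
    have m: "(\<lambda>x. a x * g x) \<in> L2" "L2_norm (\<lambda>x. a x * g x) \<le> B * L2_norm g"
      by (rule L2_mult_bounded[OF gL(1) am _ B(1)]; use B(2) in simp)+
    have "B * L2_norm g \<le> B * N" by (rule mult_left_mono[OF gL(2) B(1)])
    also have "\<dots> \<le> ?C * N" using N C1(1) C2(1) by (simp add: distrib_right)
    finally have n: "L2_norm (\<lambda>x. a x * g x) \<le> ?C * N" using m(2) by linarith
    have "sob_le n (\<lambda>x. a' x * g x + a x * g' x) (2 * (C1 * N + C2 * N))"
      by (rule sob_le_add[OF C1(2)[OF sob_le_lower[OF g]] C2(2)[OF g'(2)]])
    then have "sob_le n (\<lambda>x. a' x * g x + a x * g' x) (?C * N)"
      by (rule sob_le_mono) (use N B(1) in \<open>simp add: algebra_simps\<close>)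
    moreover have "has_weak_deriv 1 (\<lambda>x. a x * g x) (\<lambda>x. a' x * g x + a x * g' x)"
      by (rule has_weak_deriv_mult[OF gL(1) sob_le_L2(1)[OF g'(2)] g'(1) _ cont_diff_continuous[OF a'(2)]]) (use a' in blast)
    ultimately show ?thesis using m(1) n by auto
  qed
  then show ?case using B(1) C1(1) C2(1) by (intro exI[of _ ?C]) auto
qed

section \<open>Regularity of the weak solution\<close>

text \<open>
  The set where the bound fails inside the open interval is open and null, hence empty; continuity
  extends the bound to the end points.
\<close>

lemma continuous_AE_ge:
  fixes K :: "real \<Rightarrow> real"
  assumes c: "continuous_on {0..1} K" and ae: "AE x in unit_ivl. k \<le> K x" and x: "x \<in> {0..1}"
  shows "k \<le> K x"
proof -
  let ?S = "{0<..<1} \<inter> K -` {..<k}"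
  have "continuous_on {0<..<1} K" by (rule continuous_on_subset[OF c]) auto
  from continuous_on_open_vimage[OF open_greaterThanLessThan, THEN iffD1, OF this, rule_format, OF open_lessThan]
  have o: "open ?S" by (simp only: Int_commute)
  have "AE x in lebesgue. x \<notin> ?S" using ae unfolding AE_unit_iff by eventually_elim auto
  then have "?S \<in> null_sets lebesgue" using o by (subst AE_iff_null_sets) auto
  then have "?S = {}" using o open_not_negligible negligible_iff_null_sets by blast
  then have *: "k \<le> K y" if "y \<in> {0<..<1}" for y using that by force
  have cl: "closure {0<..<1} = {0..1::real}" by (rule closure_greaterThanLessThan) simp
  show ?thesis
    by (rule continuous_ge_on_closure[of "{0<..<1}" K x k]) (use c x * cl in auto)
qed

lemma has_weak_deriv_test_fun:
  assumes \<phi>: "\<phi> \<in> test_fun" shows "has_weak_deriv 1 \<phi> (deriv \<phi>)"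
  unfolding has_weak_deriv_def
proof (intro conjI ballI)
  note d = test_fun_deriv[OF \<phi>]
  show "loc_integrable \<phi>" "loc_integrable (deriv \<phi>)"
    by (rule loc_integrable_unit[OF test_fun_integrable], rule \<phi> d)+
  fix \<zeta> assume \<zeta>: "\<zeta> \<in> test_fun"
  have eq: "L2_inner f g = (\<integral>x. f x * g x \<partial>lborel)" if f: "f \<in> test_fun" and g: "g \<in> test_fun" for f g
  proof -
    have [measurable]: "f \<in> borel_measurable borel" "g \<in> borel_measurable borel" using f g test_fun_borel by auto
    have "L2_inner f g = (\<integral>x. indicator {0<..<1} x *\<^sub>R (f x * g x) \<partial>lborel)"
      unfolding L2_inner_def set_lebesgue_integral_def[symmetric] by (rule integral_unit_lborel) measurable
    also have "\<dots> = (\<integral>x. f x * g x \<partial>lborel)"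
    proof (rule Bochner_Integration.integral_cong[OF refl])
      fix x show "indicator {0<..<1} x *\<^sub>R (f x * g x) = f x * g x"
        using test_fun_zero[OF f, of x] by (cases "x \<in> {0<..<1}") auto
    qed
    finally show ?thesis .
  qed
  show "L2_inner \<phi> ((deriv ^^ 1) \<zeta>) = (- 1) ^ 1 * L2_inner (deriv \<phi>) \<zeta>"
    using integral_parts_shift[OF \<phi> \<zeta>, of 0] by (simp add: eq[OF \<phi> test_fun_deriv[OF \<zeta>]] eq[OF d \<zeta>])
qed

lemma has_weak_deriv_divide: "has_weak_deriv k w g \<Longrightarrow> has_weak_deriv k (\<lambda>x. w x / r) (\<lambda>x. g x / r)"
proof -
  assume a: "has_weak_deriv k w g"
  have "L2_inner (\<lambda>x. f x / r) \<phi> = L2_inner f \<phi> / r" for f \<phi> by (simp add: L2_inner_def)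
  then show ?thesis
    using a loc_integrable_cmult[of w "1 / r"] loc_integrable_cmult[of g "1 / r"] by (simp add: has_weak_deriv_def)
qed

text \<open>
  Tested with smooth functions, the Petrov-Galerkin equation says that the flux has the weak derivative
  \<open>- f\<close>, so that \<open>du_Bois_Reymond\<close> applies.
\<close>

lemma weak_solution_flux:
  assumes s: "weak_solution \<beta> \<theta> K f u" and K: "continuous_on {0..1} K" and f: "f \<in> L2"
    and H: "has_weak_deriv 1 (frac_int \<beta> \<theta> u) H" "H \<in> L2"
  obtains c where "AE x in unit_ivl. K x * H x = c - prim f x"
proof -
  note Km = continuous_unit(1)[OF K]
  have KH: "integrable unit_ivl (\<lambda>x. K x * H x)"
    using integrable_unit_mult_continuous[OF L2_integrable[OF H(2)] K] by (simp add: mult.commute)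
  let ?W = "weak_deriv 1 (frac_int \<beta> \<theta> u)"
  have W: "AE x in unit_ivl. H x = ?W x" by (rule weak_deriv_AE[OF H(1)])
  have Wm: "?W \<in> borel_measurable unit_ivl" by (rule measurable_unit_AE_cong[OF _ W]) (use H(2) in \<open>simp add: L2_def\<close>)
  have fi: "integrable unit_ivl (\<lambda>x. - f x)" using L2_integrable[OF f] by simp
  have "has_weak_deriv 1 (\<lambda>x. K x * H x) (\<lambda>x. - f x)"
    unfolding has_weak_deriv_def
  proof (intro conjI ballI)
    show "loc_integrable (\<lambda>x. K x * H x)" "loc_integrable (\<lambda>x. - f x)"
      by (rule loc_integrable_unit, fact)+
    fix \<phi> assume \<phi>: "\<phi> \<in> test_fun"
    note w\<phi> = weak_deriv_AE[OF has_weak_deriv_test_fun[OF \<phi>]]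
    have dm: "deriv \<phi> \<in> borel_measurable unit_ivl" by (rule measurable_unit[OF test_fun_borel[OF test_fun_deriv[OF \<phi>]]])
    have w\<phi>m: "weak_deriv 1 \<phi> \<in> borel_measurable unit_ivl" by (rule measurable_unit_AE_cong[OF dm w\<phi>])
    have "L2_inner (\<lambda>x. K x * ?W x) (weak_deriv 1 \<phi>) = L2_inner f \<phi>"
      using s test_fun_H0[OF \<phi>, of 1] by (simp add: weak_solution_def)
    moreover have "L2_inner (\<lambda>x. K x * H x) (deriv \<phi>) = L2_inner (\<lambda>x. K x * ?W x) (weak_deriv 1 \<phi>)"
      unfolding L2_inner_def
    proof (rule integral_cong_AE)
      show "AE x in unit_ivl. K x * H x * deriv \<phi> x = K x * ?W x * weak_deriv 1 \<phi> x"
        using W w\<phi> by eventually_elim simp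
    qed (use Km KH Wm dm w\<phi>m in \<open>auto intro!: borel_measurable_times\<close>)
    ultimately show "L2_inner (\<lambda>x. K x * H x) ((deriv ^^ 1) \<phi>) = (- 1) ^ 1 * L2_inner (\<lambda>x. - f x) \<phi>"
      by (simp add: L2_inner_def)
  qed
  then obtain c where "AE x in unit_ivl. K x * H x = c + prim (\<lambda>x. - f x) x"
    using du_Bois_Reymond[OF _ fi] by blast
  moreover have "prim (\<lambda>x. - f x) x = - prim f x" for x by (simp add: prim_def)
  ultimately show ?thesis by (intro that[of c]) simp
qed

lemma (in abel_kernel) \<psi>_integrals:
  shows "integrable unit_ivl \<psi>" "1 \<le> (\<integral>x. \<psi> x \<partial>unit_ivl)" "(\<lambda>x. x * \<psi> x) \<in> L2"
proof -
  show i: "integrable unit_ivl \<psi>" by (rule L2_integrable[OF \<psi>_L2])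
  have "(\<integral>x. 1 \<partial>unit_ivl) \<le> (\<integral>x. \<psi> x \<partial>unit_ivl)"
    by (rule integral_mono[OF _ i]) (use \<psi>_ge in auto)
  then show "1 \<le> (\<integral>x. \<psi> x \<partial>unit_ivl)" using U.prob_space by simp
  show "(\<lambda>x. x * \<psi> x) \<in> L2"
    by (rule L2_mult_bounded(1)[OF \<psi>_L2 measurable_id_unit, of 1]) auto
qed

text \<open>
  The moment against \<open>\<psi>\<close> vanishes, so the constant of integration in the flux is a weighted mean
  of the values of \<open>prim f\<close>.
\<close>

lemma (in abel_kernel) flux_constant_le:
  assumes \<kappa>: "continuous_on {0..1} \<kappa>" "\<And>x. x \<in> {0..1} \<Longrightarrow> 0 < \<kappa> x" and f: "f \<in> L2" and H: "H \<in> L2"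
    and eq: "AE x in unit_ivl. H x = \<kappa> x * (a - prim f x)" and 0: "(\<integral>x. H x * \<psi> x \<partial>unit_ivl) = 0"
  shows "\<bar>a\<bar> \<le> L2_norm f"
proof -
  note fi = L2_integrable[OF f]
  have pb: "\<bar>prim f x\<bar> \<le> L2_norm f" for x
    using prim_bound[OF fi, of x] integral_abs_le_L2_norm[OF f] by simp
  have k\<psi>: "integrable unit_ivl (\<lambda>x. \<psi> x * \<kappa> x)" by (rule integrable_unit_mult_continuous[OF \<psi>_integrals(1) \<kappa>(1)])
  have pk: "integrable unit_ivl (\<lambda>x. \<psi> x * \<kappa> x * prim f x)"
    by (rule integrable_unit_mult_bounded[OF k\<psi> prim_measurable[OF fi] pb])
  have pos: "0 < (\<integral>x. \<psi> x * \<kappa> x \<partial>unit_ivl)"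
  proof -
    obtain x0 where x0: "x0 \<in> {0..1}" "\<And>x. x \<in> {0..1} \<Longrightarrow> \<kappa> x0 \<le> \<kappa> x"
      using continuous_attains_inf[OF _ _ \<kappa>(1)] by auto
    have "(\<integral>x. \<kappa> x0 \<partial>unit_ivl) \<le> (\<integral>x. \<psi> x * \<kappa> x \<partial>unit_ivl)"
    proof (rule integral_mono[OF _ k\<psi>])
      fix x assume x: "x \<in> space unit_ivl"
      have "1 * \<kappa> x0 \<le> \<psi> x * \<kappa> x" using x x0 \<psi>_ge[of x] \<kappa>(2)[OF x0(1)] by (intro mult_mono) auto
      then show "\<kappa> x0 \<le> \<psi> x * \<kappa> x" by simp
    qed simp
    then show ?thesis using \<kappa>(2)[OF x0(1)] U.prob_space by simp
  qed
  have "(\<integral>x. H x * \<psi> x \<partial>unit_ivl) = (\<integral>x. a * (\<psi> x * \<kappa> x) - \<psi> x * \<kappa> x * prim f x \<partial>unit_ivl)"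
  proof (rule integral_cong_AE)
    show "AE x in unit_ivl. H x * \<psi> x = a * (\<psi> x * \<kappa> x) - \<psi> x * \<kappa> x * prim f x"
      using eq
    proof eventually_elim
      case (elim x)
      show ?case unfolding elim by (simp add: algebra_simps)
    qed
  qed (use L2_mult_integrable[OF H \<psi>_L2] k\<psi> pk in auto)
  also have "\<dots> = a * (\<integral>x. \<psi> x * \<kappa> x \<partial>unit_ivl) - (\<integral>x. \<psi> x * \<kappa> x * prim f x \<partial>unit_ivl)"
    using k\<psi> pk by simp
  finally have "a * (\<integral>x. \<psi> x * \<kappa> x \<partial>unit_ivl) = (\<integral>x. \<psi> x * \<kappa> x * prim f x \<partial>unit_ivl)" using 0 by simp
  then have "\<bar>a\<bar> * (\<integral>x. \<psi> x * \<kappa> x \<partial>unit_ivl) = \<bar>\<integral>x. \<psi> x * \<kappa> x * prim f x \<partial>unit_ivl\<bar>"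
    using pos by (metis abs_mult abs_of_pos)
  also have "\<dots> \<le> (\<integral>x. \<bar>\<psi> x * \<kappa> x * prim f x\<bar> \<partial>unit_ivl)" by (rule integral_abs_bound)
  also have "\<dots> \<le> (\<integral>x. L2_norm f * (\<psi> x * \<kappa> x) \<partial>unit_ivl)"
  proof (rule integral_mono[OF integrable_abs[OF pk]])
    show "integrable unit_ivl (\<lambda>x. L2_norm f * (\<psi> x * \<kappa> x))" using k\<psi> by simp
    fix x assume x: "x \<in> space unit_ivl"
    then have "0 \<le> \<psi> x * \<kappa> x" using \<psi>_ge[of x] \<kappa>(2)[of x] by simp
    then show "\<bar>\<psi> x * \<kappa> x * prim f x\<bar> \<le> L2_norm f * (\<psi> x * \<kappa> x)"
      unfolding abs_mult[of _ "prim f x"] using mult_left_mono[OF pb[of x], of "\<psi> x * \<kappa> x"] by (simp add: mult.commute)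
  qed
  also have "\<dots> = L2_norm f * (\<integral>x. \<psi> x * \<kappa> x \<partial>unit_ivl)" by simp
  finally show ?thesis using pos by simp
qed

text \<open>
  The moment of \<open>H\<close> against \<open>x * \<psi> x\<close> gives the integral of \<open>u\<close>, hence the pairing of the fractional
  integral with \<open>\<psi>\<close>, and this determines the constant by which the fractional integral differs from
  \<open>prim H\<close>.
\<close>

lemma (in abel_kernel) frac_int_le:
  assumes u: "u \<in> H0 (1 - \<beta>)" and H: "H \<in> L2" "has_weak_deriv 1 (frac_int \<beta> \<theta> u) H"
    and m: "(\<integral>x. H x * (x * \<psi> x) \<partial>unit_ivl) = - ((1 - \<beta>) * c * (\<integral>s. u s \<partial>unit_ivl)) / Gamma \<beta>"
  shows "frac_int \<beta> \<theta> u \<in> L2"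
    and "L2_norm (frac_int \<beta> \<theta> u) \<le> (L2_norm (\<lambda>x. x * \<psi> x) / (1 - \<beta>) + (\<integral>x. \<psi> x \<partial>unit_ivl) + 1) * L2_norm H"
proof -
  let ?w = "frac_int \<beta> \<theta> u"
  define X where "X = L2_norm (\<lambda>x. x * \<psi> x)"
  define S where "S = (\<integral>x. \<psi> x \<partial>unit_ivl)"
  define P where "P = (\<integral>x. prim H x * \<psi> x \<partial>unit_ivl)"
  define Q where "Q = (\<integral>x. H x * (x * \<psi> x) \<partial>unit_ivl)"
  have S: "1 \<le> S" unfolding S_def by (rule \<psi>_integrals(2))
  have X: "0 \<le> X" by (simp add: X_def)
  have uint: "integrable unit_ivl u" using u by (intro L2_integrable) (simp add: H0_def)
  note Hi = L2_integrable[OF H(1)]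
  have pb: "\<bar>prim H x\<bar> \<le> L2_norm H" for x
    using prim_bound[OF Hi, of x] integral_abs_le_L2_norm[OF H(1)] by simp
  have pi: "integrable unit_ivl (\<lambda>x. \<psi> x * prim H x)"
    by (rule integrable_unit_mult_bounded[OF \<psi>_integrals(1) prim_measurable[OF Hi] pb])
  have Pb: "\<bar>P\<bar> \<le> L2_norm H * S"
  proof -
    have "\<bar>P\<bar> \<le> (\<integral>x. \<bar>\<psi> x * prim H x\<bar> \<partial>unit_ivl)"
      unfolding P_def by (simp only: mult.commute[of "prim H _"] integral_abs_bound)
    also have "\<dots> \<le> (\<integral>x. L2_norm H * \<psi> x \<partial>unit_ivl)"
    proof (rule integral_mono[OF integrable_abs[OF pi]])
      show "integrable unit_ivl (\<lambda>x. L2_norm H * \<psi> x)" using \<psi>_integrals(1) by simp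
      fix x assume "x \<in> space unit_ivl"
      then have "0 \<le> \<psi> x" using \<psi>_ge[of x] by simp
      then show "\<bar>\<psi> x * prim H x\<bar> \<le> L2_norm H * \<psi> x"
        unfolding abs_mult using mult_left_mono[OF pb[of x], of "\<psi> x"] by (simp add: mult.commute)
    qed
    also have "\<dots> = L2_norm H * S" by (simp add: S_def)
    finally show ?thesis .
  qed
  have Qb: "\<bar>Q\<bar> \<le> L2_norm H * X"
    unfolding Q_def X_def by (rule Cauchy_Schwarz_unit[OF H(1) \<psi>_integrals(3)])
  obtain w0 where w0: "AE x in unit_ivl. ?w x = w0 + prim H x"
    using du_Bois_Reymond[OF H(2) Hi] by blast
  have "(\<integral>x. frac_conv \<beta> \<theta> u x * \<psi> x / Gamma \<beta> \<partial>unit_ivl) = (\<integral>x. w0 * \<psi> x + \<psi> x * prim H x \<partial>unit_ivl)"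
  proof (rule integral_cong_AE)
    show "AE x in unit_ivl. frac_conv \<beta> \<theta> u x * \<psi> x / Gamma \<beta> = w0 * \<psi> x + \<psi> x * prim H x"
      using w0 frac_int_AE[OF uint]
    proof eventually_elim
      case (elim x)
      then have "frac_conv \<beta> \<theta> u x / Gamma \<beta> = w0 + prim H x" by simp
      then have "frac_conv \<beta> \<theta> u x / Gamma \<beta> * \<psi> x = (w0 + prim H x) * \<psi> x" by (rule arg_cong)
      then show ?case by (simp add: algebra_simps)
    qed
    show "(\<lambda>x. frac_conv \<beta> \<theta> u x * \<psi> x / Gamma \<beta>) \<in> borel_measurable unit_ivl"
      using frac_conv_pairing(1)[OF uint] by simp
    show "(\<lambda>x. w0 * \<psi> x + \<psi> x * prim H x) \<in> borel_measurable unit_ivl"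
      using pi \<psi>_integrals(1) by auto
  qed
  also have "\<dots> = w0 * S + P"
    using pi \<psi>_integrals(1) by (simp add: S_def P_def mult.commute)
  finally have 1: "c * (\<integral>s. u s \<partial>unit_ivl) / Gamma \<beta> = w0 * S + P"
    using frac_conv_pairing(2)[OF uint] by simp
  have "Q = - (1 - \<beta>) * (c * (\<integral>s. u s \<partial>unit_ivl) / Gamma \<beta>)"
    unfolding Q_def m using Gamma_real_pos[OF \<beta>(1)] by (simp add: field_simps)
  then have "w0 * S = - Q / (1 - \<beta>) - P" unfolding 1 using \<beta> by (simp add: field_simps)
  then have "\<bar>w0 * S\<bar> \<le> \<bar>Q\<bar> / (1 - \<beta>) + \<bar>P\<bar>"
    using \<beta> abs_triangle_ineq4[of "- Q / (1 - \<beta>)" P] by simp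
  also have "\<dots> \<le> L2_norm H * X / (1 - \<beta>) + L2_norm H * S"
    using Qb Pb \<beta> by (intro add_mono divide_right_mono) auto
  finally have "\<bar>w0\<bar> * S \<le> L2_norm H * (X / (1 - \<beta>) + S)"
    using S by (simp add: abs_mult distrib_left)
  moreover have "\<bar>w0\<bar> * 1 \<le> \<bar>w0\<bar> * S" using S by (intro mult_left_mono) auto
  ultimately have w0b: "\<bar>w0\<bar> \<le> L2_norm H * (X / (1 - \<beta>) + S)" by simp
  have wb: "AE x in unit_ivl. \<bar>?w x\<bar> \<le> (X / (1 - \<beta>) + S + 1) * L2_norm H"
    using w0
  proof eventually_elim
    case (elim x)
    have "\<bar>?w x\<bar> \<le> \<bar>w0\<bar> + \<bar>prim H x\<bar>" unfolding elim by (rule abs_triangle_ineq)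
    also have "\<dots> \<le> L2_norm H * (X / (1 - \<beta>) + S) + L2_norm H" by (rule add_mono[OF w0b pb])
    finally show ?case by (simp add: algebra_simps)
  qed
  have wm: "?w \<in> borel_measurable unit_ivl"
    by (rule measurable_unit_AE_cong[of "\<lambda>x. w0 + prim H x"])
      (use prim_measurable[OF Hi] w0 in \<open>auto simp: eq_commute\<close>)
  have nn: "0 \<le> (X / (1 - \<beta>) + S + 1) * L2_norm H" using X S \<beta> by (intro mult_nonneg_nonneg) auto
  show "?w \<in> L2" by (rule L2_bounded(1)[OF wm wb nn])
  show "L2_norm ?w \<le> (L2_norm (\<lambda>x. x * \<psi> x) / (1 - \<beta>) + (\<integral>x. \<psi> x \<partial>unit_ivl) + 1) * L2_norm H"
    using L2_bounded(2)[OF wm wb nn] unfolding X_def S_def .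
qed

text \<open>
  With \<open>H = (a - prim f) / K\<close> for the weak derivative of the fractional integral, the norm of order
  \<open>m + 1\<close> of \<open>a - prim f\<close> is controlled by \<open>f\<close> alone, the product rule transfers this to \<open>H\<close>, and
  \<open>frac_int_le\<close> adds the norm of the fractional integral itself.
\<close>

theorem (in abel_kernel) weak_solution_regularity:
  assumes K: "cont_diff (Suc m) K" "\<And>x. x \<in> {0..1} \<Longrightarrow> 0 < K x"
  obtains C where "0 < C"
    "\<And>f u. f \<in> Sobolev m \<Longrightarrow> weak_solution \<beta> \<theta> K f u \<Longrightarrow> sob_le (m + 2) (frac_int \<beta> \<theta> u) (C * Sobolev_norm m f)"
proof -
  let ?k = "\<lambda>x. 1 / K x"
  have Kc: "continuous_on {0..1} K" by (rule cont_diff_continuous[OF K(1)])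
  have kd: "cont_diff (Suc m) ?k" by (rule cont_diff_inverse[OF K(1)]) (use K(2) in force)
  have kc: "continuous_on {0..1} ?k" by (rule cont_diff_continuous[OF kd])
  obtain C1 where C1: "0 \<le> C1" "\<And>g N. sob_le (Suc m) g N \<Longrightarrow> sob_le (Suc m) (\<lambda>x. ?k x * g x) (C1 * N)"
    using sob_le_mult[OF kd] by blast
  obtain C2 where C2: "0 \<le> C2" "\<And>g N. sob_le m g N \<Longrightarrow> sob_le m (\<lambda>x. - 1 * g x) (C2 * N)"
    using sob_le_mult[OF cont_diff_const[of m "-1"]] by blast
  define E where "E = L2_norm (\<lambda>x. x * \<psi> x) / (1 - \<beta>) + (\<integral>x. \<psi> x \<partial>unit_ivl) + 1"
  have E: "1 \<le> E" using \<psi>_integrals(2) \<beta> by (simp add: E_def)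
  define C3 where "C3 = C1 * (2 + C2)"
  have C3: "0 \<le> C3" using C1(1) C2(1) by (simp add: C3_def)
  have G0: "0 < Gamma \<beta>" by (rule Gamma_real_pos[OF \<beta>(1)])
  have main: "sob_le (m + 2) (frac_int \<beta> \<theta> u) (E * C3 * Sobolev_norm m f)"
    if f: "f \<in> Sobolev m" and s: "weak_solution \<beta> \<theta> K f u" for f u
  proof -
    define N where "N = Sobolev_norm m f"
    have fN: "sob_le m f N" unfolding N_def by (rule Sobolev_imp_sob_le[OF f])
    have f2: "f \<in> L2" "L2_norm f \<le> N" using sob_le_L2[OF fN] by auto
    have N: "0 \<le> N" using f2(2) L2_norm_nonneg[of f] by linarith
    note fi = L2_integrable[OF f2(1)]
    have u: "u \<in> H0 (1 - \<beta>)" using s by (simp add: weak_solution_def)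
    have uint: "integrable unit_ivl u" using u by (intro L2_integrable) (simp add: H0_def)
    obtain h where h: "h \<in> L2" "has_weak_deriv 1 (frac_conv \<beta> \<theta> u) h"
      "(\<integral>x. h x * \<psi> x \<partial>unit_ivl) = 0"
      "(\<integral>x. h x * (x * \<psi> x) \<partial>unit_ivl) = - ((1 - \<beta>) * c * (\<integral>s. u s \<partial>unit_ivl))"
      using frac_conv_weak_deriv[OF u] by blast
    define H where "H x = h x / Gamma \<beta>" for x
    have H2: "H \<in> L2" using L2_mult_bounded(1)[OF h(1), of "\<lambda>_. 1 / Gamma \<beta>" "1 / Gamma \<beta>"] G0
      by (simp add: H_def[abs_def])
    have Hw: "has_weak_deriv 1 (frac_int \<beta> \<theta> u) H"
    proof (rule has_weak_deriv_AE_cong[OF has_weak_deriv_divide[OF h(2), of "Gamma \<beta>"]])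
      show "AE x in unit_ivl. frac_conv \<beta> \<theta> u x / Gamma \<beta> = frac_int \<beta> \<theta> u x"
        using frac_int_AE[OF uint] by eventually_elim simp
    qed (simp add: H_def)
    have H0: "(\<integral>x. H x * \<psi> x \<partial>unit_ivl) = 0" using h(3) by (simp add: H_def)
    have H1: "(\<integral>x. H x * (x * \<psi> x) \<partial>unit_ivl) = - ((1 - \<beta>) * c * (\<integral>s. u s \<partial>unit_ivl)) / Gamma \<beta>"
      using h(4) by (simp add: H_def)
    obtain a where a: "AE x in unit_ivl. K x * H x = a - prim f x"
      using weak_solution_flux[OF s Kc f2(1) Hw H2] by blast
    have "AE x in unit_ivl. x \<in> {0<..<1}" by (rule AE_I2) simp
    with a have Heq: "AE x in unit_ivl. H x = ?k x * (a - prim f x)"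
    proof eventually_elim
      case (elim x)
      then show ?case using K(2)[of x] by (simp add: field_simps)
    qed
    have ab: "\<bar>a\<bar> \<le> L2_norm f"
      by (rule flux_constant_le[OF kc _ f2(1) H2 Heq H0]) (use K(2) in simp)
    have pf: "\<bar>a - prim f x\<bar> \<le> 2 * N" for x
      using ab f2(2) prim_bound[OF fi, of x] integral_abs_le_L2_norm[OF f2(1)] by linarith
    have Gm: "(\<lambda>x. a - prim f x) \<in> borel_measurable unit_ivl" using prim_measurable[OF fi] by simp
    have GL: "(\<lambda>x. a - prim f x) \<in> L2" "L2_norm (\<lambda>x. a - prim f x) \<le> 2 * N"
      using N by (auto intro!: L2_bounded[OF Gm] pf)
    have "has_weak_deriv 1 (\<lambda>x. a + prim (\<lambda>x. - 1 * f x) x) (\<lambda>x. - 1 * f x)"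
      by (rule has_weak_deriv_prim) (use fi in simp)
    moreover have "(\<lambda>x. a + prim (\<lambda>x. - 1 * f x) x) = (\<lambda>x. a - prim f x)" by (simp add: prim_def)
    ultimately have Gw: "has_weak_deriv 1 (\<lambda>x. a - prim f x) (\<lambda>x. - 1 * f x)" by (simp only:)
    have le: "2 * N \<le> (2 + C2) * N" "C2 * N \<le> (2 + C2) * N" using N C2(1) by (auto intro: mult_right_mono)
    have "sob_le (Suc m) (\<lambda>x. a - prim f x) ((2 + C2) * N)"
      using GL le Gw sob_le_mono[OF C2(2)[OF fN] le(2)] by (auto intro: order_trans)
    from C1(2)[OF this] have "sob_le (Suc m) (\<lambda>x. ?k x * (a - prim f x)) (C3 * N)"
      by (simp add: C3_def mult.assoc)
    then have Hs: "sob_le (Suc m) H (C3 * N)"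
      by (rule sob_le_AE_cong) (use Heq in \<open>simp add: eq_commute\<close>)
    have "E * L2_norm H \<le> E * (C3 * N)" using sob_le_L2(2)[OF Hs] E by (intro mult_left_mono) auto
    then have wN: "L2_norm (frac_int \<beta> \<theta> u) \<le> E * C3 * N"
      using frac_int_le(2)[OF u H2 Hw H1, folded E_def] by (simp add: mult.assoc)
    have "1 * (C3 * N) \<le> E * (C3 * N)" using E C3 N by (intro mult_right_mono) auto
    then have "sob_le (Suc m) H (E * C3 * N)" by (intro sob_le_mono[OF Hs]) (simp add: mult.assoc)
    then have "sob_le (Suc (Suc m)) (frac_int \<beta> \<theta> u) (E * C3 * N)"
      using frac_int_le(1)[OF u H2 Hw H1] wN Hw by (subst sob_le.simps(2)) blast
    then show ?thesis by (simp add: N_def)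
  qed
  show ?thesis
  proof (rule that[of "E * C3 + 1"])
    show "0 < E * C3 + 1" using E C3 by (simp add: add_nonneg_pos)
    fix f u assume f: "f \<in> Sobolev m" "weak_solution \<beta> \<theta> K f u"
    have "0 \<le> Sobolev_norm m f" by (simp add: Sobolev_norm_def sum_nonneg)
    then show "sob_le (m + 2) (frac_int \<beta> \<theta> u) ((E * C3 + 1) * Sobolev_norm m f)"
      by (intro sob_le_mono[OF main[OF f]] mult_right_mono) auto
  qed
qed

theorem theorem6p5:
  fixes \<beta> \<theta> K\<^sub>m K\<^sub>M :: real and K ul :: "real \<Rightarrow> real" and m :: nat
  assumes "0 < \<beta>" and "\<beta> < 1 / 2"
    and "0 \<le> \<theta>" and "\<theta> \<le> 1"
    and "K \<in> borel_measurable unit_ivl"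
    and "0 < K\<^sub>m" and "AE x in unit_ivl. K\<^sub>m \<le> K x \<and> K x \<le> K\<^sub>M"
    and "is_ul \<beta> \<theta> K ul"
    and "1 + \<theta> * left_int \<beta> ul 1 - (1 - \<theta>) * right_int \<beta> ul 0 \<noteq> 0"
    and "K \<in> Ck (m + 1)"
  shows "\<exists>C>0. \<forall>f u. f \<in> Sobolev m \<longrightarrow> weak_solution \<beta> \<theta> K f u \<longrightarrow>
     frac_int \<beta> \<theta> u \<in> Sobolev (m + 2) \<and>
     Sobolev_norm (m + 2) (frac_int \<beta> \<theta> u) \<le> C * (Ck_norm (m + 1) K + Sobolev_norm m f) \<and>
     (\<exists>g\<in>L2. has_weak_deriv (m + 2) (frac_int \<beta> \<theta> u) g \<and>
        L2_norm g \<le> C * (Ck_norm (m + 1) K + Sobolev_norm m f))"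
proof -
  obtain c \<psi> where "abel_kernel \<beta> \<theta> c \<psi>" using abel_kernel_exists[OF assms(1-4)] by blast
  then interpret abel_kernel \<beta> \<theta> c \<psi> .
  have Kd: "cont_diff (Suc m) K" using Ck_imp_cont_diff[OF assms(10)] by simp
  have Kp: "0 < K x" if "x \<in> {0..1}" for x
  proof -
    have "AE x in unit_ivl. K\<^sub>m \<le> K x" using assms(7) by eventually_elim simp
    then have "K\<^sub>m \<le> K x" by (rule continuous_AE_ge[OF cont_diff_continuous[OF Kd] _ that])
    then show ?thesis using assms(6) by simp
  qed
  obtain C where C: "0 < C" "\<And>f u. f \<in> Sobolev m \<Longrightarrow> weak_solution \<beta> \<theta> K f u \<Longrightarrow>
      sob_le (m + 2) (frac_int \<beta> \<theta> u) (C * Sobolev_norm m f)"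
    using weak_solution_regularity[OF Kd Kp] by blast
  \<comment> \<open>The Sobolev norm of order \<open>m + 2\<close> collects \<open>m + 3\<close> derivatives, the zeroth included.\<close>
  let ?C = "real (m + 3) * C"
  have C': "0 < ?C" by (rule mult_pos_pos[OF _ C(1)]) simp
  have Kn: "0 \<le> Ck_norm (m + 1) K" by (rule Ck_norm_nonneg[OF assms(10)])
  show ?thesis
  proof (intro exI[of _ ?C] conjI allI impI C')
    fix f u assume f: "f \<in> Sobolev m" and u: "weak_solution \<beta> \<theta> K f u"
    have s: "sob_le (m + 2) (frac_int \<beta> \<theta> u) (C * Sobolev_norm m f)" by (rule C(2)[OF f u])
    have Nf: "0 \<le> Sobolev_norm m f" by (simp add: Sobolev_norm_def sum_nonneg)
    then have N: "0 \<le> C * Sobolev_norm m f" using C(1) by simp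
    show "frac_int \<beta> \<theta> u \<in> Sobolev (m + 2)" by (rule sob_le_imp_Sobolev(1)[OF s N])
    have "real (Suc (m + 2)) * (C * Sobolev_norm m f) = ?C * Sobolev_norm m f" by simp
    also have "\<dots> \<le> ?C * (Ck_norm (m + 1) K + Sobolev_norm m f)" using C'(1) Kn by (intro mult_left_mono) auto
    finally have le: "real (Suc (m + 2)) * (C * Sobolev_norm m f) \<le> ?C * (Ck_norm (m + 1) K + Sobolev_norm m f)" .
    then show "Sobolev_norm (m + 2) (frac_int \<beta> \<theta> u) \<le> ?C * (Ck_norm (m + 1) K + Sobolev_norm m f)"
      using sob_le_imp_Sobolev(2)[OF s N] by linarith
    obtain g where g: "g \<in> L2" "has_weak_deriv (m + 2) (frac_int \<beta> \<theta> u) g" "L2_norm g \<le> C * Sobolev_norm m f"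
      using sob_le_derivs[OF s order_refl] by blast
    have "1 * (C * Sobolev_norm m f) \<le> real (Suc (m + 2)) * (C * Sobolev_norm m f)"
      using N by (intro mult_right_mono) auto
    then have "L2_norm g \<le> ?C * (Ck_norm (m + 1) K + Sobolev_norm m f)" using g(3) le by linarith
    then show "\<exists>g\<in>L2. has_weak_deriv (m + 2) (frac_int \<beta> \<theta> u) g \<and>
        L2_norm g \<le> ?C * (Ck_norm (m + 1) K + Sobolev_norm m f)" using g by blast
  qed
qed

end
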